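(* Let $\mathfrak C:X'Y'\to Z$ be a quantum multiple access channel. Let $\mathcal U,\mathcal X,\mathcal Y$ be finite sets, for each $x\in\mathcal X$ let $\sigma^{X'}_x$ be a state on $X'$ and for each $y\in\mathcal Y$ let $\sigma_y^{Y'}$ be a state on $Y'$, and let $p(u)p(x|u)p(y|u)$ be a probability distribution on $\mathcal U\times\mathcal X\times\mathcal Y$. Let $$\rho^{UXYZ}:=\sum_{u,x,y}p(u)p(x|u)p(y|u)|u,x,y\rangle\langle u,x,y|^{UXY}\otimes\mathfrak C(\sigma^{X'}_x\otimes\sigma^{Y'}_y).$$ Let $0<\epsilon<1$ and $R_1,R_2$ satisfy $R_1\le I^\epsilon_H(X:YZ|U)_\rho-2-\log\frac1\epsilon$, $R_2\le I^\epsilon_H(Y:XZ|U)_\rho-2-\log\frac1\epsilon$, $R_1+R_2\le I^\epsilon_H(XY:Z|U)_\rho-2-\log\frac1\epsilon$. Then there exists an $(R_1,R_2,2^{135}\epsilon^{1/3})$-quantum MAC code for sending classical information through $\mathfrak C$.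
   Context: Writing $\rho^{XZ}_u,\rho^{YZ}_u,\rho^Z_u,\rho^X_u,\rho^Y_u,\rho^{XY}_u$ for the conditional marginals of $\rho^{UXYZ}$ given $U=u$: $I^\epsilon_H(X:YZ|U)_\rho:=D^\epsilon_H(\rho^{UXYZ}\|\sum_u p(u)|u\rangle\langle u|\otimes\rho^X_u\otimes\rho^{YZ}_u)$, $I^\epsilon_H(Y:XZ|U)_\rho:=D^\epsilon_H(\rho^{UXYZ}\|\sum_u p(u)|u\rangle\langle u|\otimes\rho^Y_u\otimes\rho^{XZ}_u)$, $I^\epsilon_H(XY:Z|U)_\rho:=D^\epsilon_H(\rho^{UXYZ}\|\sum_u p(u)|u\rangle\langle u|\otimes\rho^{XY}_u\otimes\rho^{Z}_u)$, where $D^\epsilon_H(\alpha\|\beta):=\max_\Pi-\log_2\operatorname{Tr}[\Pi\beta]$ over POVM elements $0\le\Pi\le\mathbb 1$ with $\operatorname{Tr}[\Pi\alpha]\ge1-\epsilon$; logs base 2. An $(R_1,R_2,\eta)$-quantum MAC code for classical information through $\mathfrak C$ consists of an encoding of each message $m_1\in[2^{R_1}]$ into a state $\alpha_{m_1}$ on $X'$, of each $m_2\in[2^{R_2}]$ into a state $\beta_{m_2}$ on $Y'$, and a POVM $\{\Lambda_{m_1,m_2}\}$ on $Z$ with average decoding error $2^{-(R_1+R_2)}\sum_{m_1,m_2}\operatorname{Tr}[(\mathbb 1-\Lambda_{m_1,m_2})\mathfrak C(\alpha_{m_1}\otimes\beta_{m_2})]\le\eta$. *)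

theory Defs
  imports "HOL-Analysis.Analysis" "Jordan_Normal_Form.Matrix"
begin

text \<open>Hilbert spaces are C^d; tensor products C^a (x) C^b = C^(a*b) with index i*b+j
  (Kronecker convention). Finite alphabets are {0..<n}.\<close>

definition mtrace :: "complex mat \<Rightarrow> complex" where
  "mtrace M = (\<Sum>i<dim_row M. M $$ (i,i))"

definition psd :: "nat \<Rightarrow> complex mat \<Rightarrow> bool" where
  "psd d M \<longleftrightarrow> M \<in> carrier_mat d d \<and>
     (\<forall>v :: nat \<Rightarrow> complex.
        Im (\<Sum>i<d. \<Sum>j<d. cnj (v i) * M $$ (i,j) * v j) = 0 \<and>
        Re (\<Sum>i<d. \<Sum>j<d. cnj (v i) * M $$ (i,j) * v j) \<ge> 0)"

definition density :: "nat \<Rightarrow> complex mat \<Rightarrow> bool" where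
  "density d \<rho> \<longleftrightarrow> psd d \<rho> \<and> mtrace \<rho> = 1"

definition povm_elem :: "nat \<Rightarrow> complex mat \<Rightarrow> bool" where
  "povm_elem d P \<longleftrightarrow> psd d P \<and> psd d (1\<^sub>m d - P)"

definition kron :: "complex mat \<Rightarrow> complex mat \<Rightarrow> complex mat" where
  "kron A B = mat (dim_row A * dim_row B) (dim_col A * dim_col B)
     (\<lambda>(i,j). A $$ (i div dim_row B, j div dim_col B) * B $$ (i mod dim_row B, j mod dim_col B))"

definition ket_proj :: "nat \<Rightarrow> nat \<Rightarrow> complex mat" where
  "ket_proj n k = mat n n (\<lambda>(i,j). if i = k \<and> j = k then 1 else 0)"

definition msum :: "nat \<Rightarrow> ('i \<Rightarrow> complex mat) \<Rightarrow> 'i set \<Rightarrow> complex mat" where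
  "msum d f S = mat d d (\<lambda>ij. \<Sum>s\<in>S. f s $$ ij)"

definition ptrace_mid :: "nat \<Rightarrow> nat \<Rightarrow> nat \<Rightarrow> complex mat \<Rightarrow> complex mat" where
  "ptrace_mid a b c M = mat (a*c) (a*c)
     (\<lambda>(i,j). \<Sum>k<b. M $$ ((i div c * b + k) * c + i mod c, (j div c * b + k) * c + j mod c))"

text \<open>Reordering A (x) B (x) C (x) D  -->  A (x) C (x) B (x) D  (dims a,b,c,d), i.e. conjugation
  by the swap of the two middle tensor factors.\<close>
definition swap_mid_idx :: "nat \<Rightarrow> nat \<Rightarrow> nat \<Rightarrow> nat \<Rightarrow> nat \<Rightarrow> nat" where
  "swap_mid_idx a b c d i =
     (let ia = i div (c*b*d); ic = (i div (b*d)) mod c; ib = (i div d) mod b; id = i mod d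
      in ((ia*b + ib)*c + ic)*d + id)"

definition swap_mid :: "nat \<Rightarrow> nat \<Rightarrow> nat \<Rightarrow> nat \<Rightarrow> complex mat \<Rightarrow> complex mat" where
  "swap_mid a b c d M = mat (a*c*b*d) (a*c*b*d)
     (\<lambda>(i,j). M $$ (swap_mid_idx a b c d i, swap_mid_idx a b c d j))"

text \<open>For a classical-quantum operator M on U (x) R (dims dU, dR): the block <u|M|u> on R,
  its weight p(u) = Tr <u|M|u>, and the conditional state given U = u.\<close>
definition cblock :: "nat \<Rightarrow> complex mat \<Rightarrow> nat \<Rightarrow> complex mat" where
  "cblock dR M u = mat dR dR (\<lambda>(j,k). M $$ (u*dR + j, u*dR + k))"

definition cprob :: "nat \<Rightarrow> complex mat \<Rightarrow> nat \<Rightarrow> real" where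
  "cprob dR M u = Re (mtrace (cblock dR M u))"

definition ccond :: "nat \<Rightarrow> complex mat \<Rightarrow> nat \<Rightarrow> complex mat" where
  "ccond dR M u = complex_of_real (1 / cprob dR M u) \<cdot>\<^sub>m cblock dR M u"

text \<open>(id_n (x) C)(M) for M on C^n (x) C^din, defined blockwise (by linearity).\<close>
definition id_tensor :: "nat \<Rightarrow> nat \<Rightarrow> nat \<Rightarrow> (complex mat \<Rightarrow> complex mat) \<Rightarrow> complex mat \<Rightarrow> complex mat" where
  "id_tensor n din dout C M = mat (n*dout) (n*dout)
     (\<lambda>(i,j). C (mat din din (\<lambda>(k,l). M $$ (i div dout * din + k, j div dout * din + l)))
               $$ (i mod dout, j mod dout))"

definition quantum_channel :: "nat \<Rightarrow> nat \<Rightarrow> (complex mat \<Rightarrow> complex mat) \<Rightarrow> bool" where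
  "quantum_channel din dout C \<longleftrightarrow>
     (\<forall>A \<in> carrier_mat din din. C A \<in> carrier_mat dout dout) \<and>
     (\<forall>A \<in> carrier_mat din din. \<forall>B \<in> carrier_mat din din. \<forall>a b :: complex.
        C (a \<cdot>\<^sub>m A + b \<cdot>\<^sub>m B) = a \<cdot>\<^sub>m C A + b \<cdot>\<^sub>m C B) \<and>
     (\<forall>A \<in> carrier_mat din din. mtrace (C A) = mtrace A) \<and>
     (\<forall>n M. psd (n*din) M \<longrightarrow> psd (n*dout) (id_tensor n din dout C M))"

definition DH :: "nat \<Rightarrow> real \<Rightarrow> complex mat \<Rightarrow> complex mat \<Rightarrow> ereal" where
  "DH d \<epsilon> \<alpha> \<beta> =
     (SUP P \<in> {P. povm_elem d P \<and> Re (mtrace (P * \<alpha>)) \<ge> 1 - \<epsilon>}.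
        (if Re (mtrace (P * \<beta>)) \<le> 0 then \<infinity> else ereal (- log 2 (Re (mtrace (P * \<beta>))))))"

definition rhoUXYZ :: "nat \<Rightarrow> nat \<Rightarrow> nat \<Rightarrow> nat \<Rightarrow> (nat \<Rightarrow> real) \<Rightarrow> (nat \<Rightarrow> nat \<Rightarrow> real)
    \<Rightarrow> (nat \<Rightarrow> nat \<Rightarrow> real) \<Rightarrow> (nat \<Rightarrow> complex mat) \<Rightarrow> (nat \<Rightarrow> complex mat)
    \<Rightarrow> (complex mat \<Rightarrow> complex mat) \<Rightarrow> complex mat" where
  "rhoUXYZ nU nX nY dZ pU pX pY \<sigma>X \<sigma>Y C =
     msum (nU*nX*nY*dZ)
       (\<lambda>(u,x,y). complex_of_real (pU u * pX u x * pY u y) \<cdot>\<^sub>m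
          kron (ket_proj (nU*nX*nY) ((u*nX + x)*nY + y)) (C (kron (\<sigma>X x) (\<sigma>Y y))))
       ({..<nU} \<times> {..<nX} \<times> {..<nY})"

definition IH_X_YZ :: "nat \<Rightarrow> nat \<Rightarrow> nat \<Rightarrow> nat \<Rightarrow> real \<Rightarrow> complex mat \<Rightarrow> ereal" where
  "IH_X_YZ nU nX nY dZ \<epsilon> \<rho> =
     (let R = nX*nY*dZ;
          ref = msum (nU*R) (\<lambda>u. let \<rho>u = ccond R \<rho> u in
                  complex_of_real (cprob R \<rho> u) \<cdot>\<^sub>m
                  kron (ket_proj nU u) (kron (ptrace_mid nX (nY*dZ) 1 \<rho>u) (ptrace_mid 1 nX (nY*dZ) \<rho>u)))
                {..<nU}
      in DH (nU*R) \<epsilon> \<rho> ref)"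

text \<open>I_H^eps(Y:XZ|U): reference sum_u p(u)|u><u| (x) rho^Y_u (x) rho^{XZ}_u, with the factors
  Y and X reordered to match the ordering U X Y Z of rho.\<close>
definition IH_Y_XZ :: "nat \<Rightarrow> nat \<Rightarrow> nat \<Rightarrow> nat \<Rightarrow> real \<Rightarrow> complex mat \<Rightarrow> ereal" where
  "IH_Y_XZ nU nX nY dZ \<epsilon> \<rho> =
     (let R = nX*nY*dZ;
          ref = msum (nU*R) (\<lambda>u. let \<rho>u = ccond R \<rho> u in
                  complex_of_real (cprob R \<rho> u) \<cdot>\<^sub>m
                  swap_mid nU nY nX dZ
                    (kron (ket_proj nU u)
                       (kron (ptrace_mid nY dZ 1 (ptrace_mid 1 nX (nY*dZ) \<rho>u))
                             (ptrace_mid nX nY dZ \<rho>u))))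
                {..<nU}
      in DH (nU*R) \<epsilon> \<rho> ref)"

definition IH_XY_Z :: "nat \<Rightarrow> nat \<Rightarrow> nat \<Rightarrow> nat \<Rightarrow> real \<Rightarrow> complex mat \<Rightarrow> ereal" where
  "IH_XY_Z nU nX nY dZ \<epsilon> \<rho> =
     (let R = nX*nY*dZ;
          ref = msum (nU*R) (\<lambda>u. let \<rho>u = ccond R \<rho> u in
                  complex_of_real (cprob R \<rho> u) \<cdot>\<^sub>m
                  kron (ket_proj nU u) (kron (ptrace_mid (nX*nY) dZ 1 \<rho>u) (ptrace_mid 1 (nX*nY) dZ \<rho>u)))
                {..<nU}
      in DH (nU*R) \<epsilon> \<rho> ref)"

definition num_msgs :: "real \<Rightarrow> nat" where
  "num_msgs R = max 1 (nat \<lfloor>2 powr R\<rfloor>)"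

definition mac_code :: "nat \<Rightarrow> nat \<Rightarrow> nat \<Rightarrow> (complex mat \<Rightarrow> complex mat) \<Rightarrow> real \<Rightarrow> real \<Rightarrow> real \<Rightarrow> bool" where
  "mac_code dX dY dZ C R1 R2 \<eta> \<longleftrightarrow>
     (\<exists>(\<alpha> :: nat \<Rightarrow> complex mat) (\<beta> :: nat \<Rightarrow> complex mat) (\<Lambda> :: nat \<Rightarrow> nat \<Rightarrow> complex mat).
        (\<forall>m1 < num_msgs R1. density dX (\<alpha> m1)) \<and>
        (\<forall>m2 < num_msgs R2. density dY (\<beta> m2)) \<and>
        (\<forall>m1 < num_msgs R1. \<forall>m2 < num_msgs R2. psd dZ (\<Lambda> m1 m2)) \<and>
        msum dZ (\<lambda>(m1,m2). \<Lambda> m1 m2) ({..<num_msgs R1} \<times> {..<num_msgs R2}) = 1\<^sub>m dZ \<and>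
        (1 / real (num_msgs R1 * num_msgs R2)) *
          (\<Sum>m1 < num_msgs R1. \<Sum>m2 < num_msgs R2.
             Re (mtrace ((1\<^sub>m dZ - \<Lambda> m1 m2) * C (kron (\<alpha> m1) (\<beta> m2))))) \<le> \<eta>)"

end

theory Submission
  imports Defs "HOL-Library.Function_Algebras" "Jordan_Normal_Form.Determinant"
begin

text \<open>
  Let P1, P2, P3 be near-optimal tests for the three mutual informations and use a random code. The
  receiver needs one test per message pair that inherits the small acceptance probability of P1
  (only the first message wrong), of P2 (only the second wrong) and of P3 (both wrong), although
  the three tests do not commute. Append to Z a register with a basis vector |0>, one
  basis vector |m1> per first message and one |m2> per second message, and pretend that
  message (m1,m2) arrives with the register in the slightly tilted state v = |0> + s|m1> + s|m2>.
  The test for (m1',m2') lives on the span of |0>, |m1'>, |m2'>. Projected to that span, v becomes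
  w1 = |0> + s|m2'> if only the first message differs, w2 = |0> + s|m1'> if only the second differs,
  and w3 = |0> if both differ.
  Since w1, w2, w3 are linearly independent, the inverse of the operator
  1 + sum_i (Pi^-1 - 1) (x) |wi><wi| is a test that accepts h (x) wi about as often as Pi accepts h,
  and still accepts h (x) v up to O(1/s^2) times the failure probabilities of the Pi on h. Decoding
  sequentially with these tests fails with probability at most four times the sum of all single
  error terms, replacing v by the true register state |0> costs O(s^2), and s^2 = sqrt eps gives
  total error O(sqrt eps).
\<close>

section \<open>Operators as functions on finitely indexed vectors\<close>

text \<open>Tests are bounded only through quadratic forms at single vectors. Gram vectors of the
  channel outputs carry such bounds over to traces, so neither eigenvalues nor operator square roots
  occur. The inverses of the \<open>Pi\<close> need not exist, so each test is first mixed with a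
  small amount \<open>k\<close> of the identity; \<open>k = eps / (M1 M2)\<close> keeps the extra
  false acceptances, summed over all wrong pairs, of order \<open>eps\<close>. The register is never
  sent: the decoder is the sequential measurement compressed by the isometry that attaches |0>. Its
  dimension grows with the number of messages, but each test acts on three basis vectors only, so no
  constant depends on it. Given \<open>u\<close>, distinct codewords are independent, hence a wrong
  test meets an output distributed exactly as in the matching reference operator. Finally
  \<open>u\<close> is fixed together with the two codebooks, so the senders share no randomness. The
  competing costs \<open>eps / s^2\<close> and \<open>s^2\<close> balance at
  \<open>sqrt eps\<close>, which is below \<open>eps powr (1/3)\<close> as
  \<open>eps < 1\<close>.\<close>

definition smul :: "complex \<Rightarrow> ('i \<Rightarrow> complex) \<Rightarrow> 'i \<Rightarrow> complex" where
  "smul c f = (\<lambda>i. c * f i)"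

text \<open>For a complex-linear operator, symmetry with respect to the real part of the inner product
  already means self-adjointness, so the imaginary part is never needed.\<close>

definition rip :: "'i set \<Rightarrow> ('i \<Rightarrow> complex) \<Rightarrow> ('i \<Rightarrow> complex) \<Rightarrow> real" where
  "rip S f g = (\<Sum>i\<in>S. Re (cnj (f i) * g i))"

definition linop :: "(('i \<Rightarrow> complex) \<Rightarrow> 'j \<Rightarrow> complex) \<Rightarrow> bool" where
  "linop A \<longleftrightarrow> (\<forall>f g. A (f + g) = A f + A g) \<and> (\<forall>c f. A (smul c f) = smul c (A f))"

definition symop :: "'i set \<Rightarrow> (('i \<Rightarrow> complex) \<Rightarrow> 'i \<Rightarrow> complex) \<Rightarrow> bool" where
  "symop S A \<longleftrightarrow> (\<forall>f g. rip S f (A g) = rip S (A f) g)"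

definition posop :: "'i set \<Rightarrow> (('i \<Rightarrow> complex) \<Rightarrow> 'i \<Rightarrow> complex) \<Rightarrow> bool" where
  "posop S A \<longleftrightarrow> linop A \<and> symop S A \<and> (\<forall>f. 0 \<le> rip S f (A f))"

lemma smul_apply: "smul c f i = c * f i"
  by (simp add: smul_def)

lemmas fun_apply = smul_apply plus_fun_apply minus_apply zero_fun_apply

text \<open>Pointwise evaluation must not fire by default, or sums inside \<open>rip\<close> are turned into
  abstractions that \<open>rip_add_right\<close> no longer matches.\<close>

declare plus_fun_apply [simp del] minus_apply [simp del] zero_fun_apply [simp del]

lemma rip_sym: "rip S f g = rip S g f"
  by (simp add: rip_def mult.commute)

lemma rip_nonneg [simp]: "0 \<le> rip S f f"
  by (auto simp: rip_def intro!: sum_nonneg)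

lemma rip_cong:
  assumes "\<And>i. i \<in> S \<Longrightarrow> f i = f' i" "\<And>i. i \<in> S \<Longrightarrow> g i = g' i"
  shows "rip S f g = rip S f' g'"
  unfolding rip_def by (rule sum.cong) (use assms in auto)

lemma rip_add_right [simp]: "rip S f (g + h) = rip S f g + rip S f h"
  by (simp add: fun_apply rip_def algebra_simps sum.distrib)

lemma rip_add_left [simp]: "rip S (g + h) f = rip S g f + rip S h f"
  by (simp add: fun_apply rip_def algebra_simps sum.distrib)

lemma rip_diff_right [simp]: "rip S f (g - h) = rip S f g - rip S f h"
  by (simp add: fun_apply rip_def algebra_simps sum.distrib sum_subtractf)

lemma rip_diff_left [simp]: "rip S (g - h) f = rip S g f - rip S h f"
  by (simp add: fun_apply rip_def algebra_simps sum.distrib sum_subtractf)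

lemma rip_smul_right [simp]: "rip S f (smul (complex_of_real a) g) = a * rip S f g"
  by (simp add: fun_apply rip_def sum_distrib_left algebra_simps)

lemma rip_smul_left [simp]: "rip S (smul (complex_of_real a) f) g = a * rip S f g"
  by (simp add: fun_apply rip_def sum_distrib_left algebra_simps)

lemma rip_zero_left [simp]: "rip S 0 f = 0"
  by (simp add: fun_apply rip_def)

lemma rip_zero_right [simp]: "rip S f 0 = 0"
  by (simp add: fun_apply rip_def)

lemma sum_fun_apply: "(\<Sum>i\<in>I. f i) x = (\<Sum>i\<in>I. f i x)" for f :: "'i \<Rightarrow> 'j \<Rightarrow> complex"
  by (induction I rule: infinite_finite_induct) (auto simp: fun_apply)

lemma rip_sum_right: "rip S f (\<Sum>i\<in>I. g i) = (\<Sum>i\<in>I. rip S f (g i))"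
  unfolding rip_def by (subst sum.swap) (simp add: sum_fun_apply sum_distrib_left Re_sum)

lemma rip_sum_left: "rip S (\<Sum>i\<in>I. g i) f = (\<Sum>i\<in>I. rip S (g i) f)"
  by (simp only: rip_sym[of S _ f] rip_sum_right)

lemma rip_self_eq_0:
  assumes "finite S" "rip S f f = 0" "i \<in> S" shows "f i = 0"
proof -
  have "\<forall>i\<in>S. Re (cnj (f i) * f i) = 0"
    using assms(1,2) by (subst sum_nonneg_eq_0_iff[symmetric]) (auto simp: rip_def)
  hence "Re (cnj (f i) * f i) = 0" using assms(3) by blast
  thus ?thesis by (auto simp: complex_eq_iff sum_power2_eq_zero_iff simp flip: power2_eq_square)
qed

lemma rip_eqI:
  assumes "finite S" "\<And>h. rip S h f = rip S h g" "i \<in> S"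
  shows "f i = g i"
  using rip_self_eq_0[of S "f - g" i] assms by (simp add: fun_apply)

lemma linop_add: "linop A \<Longrightarrow> A (f + g) = A f + A g"
  by (simp add: linop_def)

lemma linop_smul: "linop A \<Longrightarrow> A (smul c f) = smul c (A f)"
  by (simp add: linop_def)

lemma linop_zero: "linop A \<Longrightarrow> A 0 = 0"
  using linop_smul[of A 0 0] by (simp add: smul_def zero_fun_def)

lemma linop_diff: "linop A \<Longrightarrow> A (f - g) = A f - A g"
proof -
  assume A: "linop A"
  have "f - g = f + smul (-1) g" by (auto simp: fun_eq_iff fun_apply)
  hence "A (f - g) = A f + smul (-1) (A g)" by (simp only: linop_add[OF A] linop_smul[OF A])
  thus ?thesis by (auto simp: fun_eq_iff fun_apply)
qed

lemma linop_sum: "linop A \<Longrightarrow> A (\<Sum>i\<in>I. f i) = (\<Sum>i\<in>I. A (f i))"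
  by (induction I rule: infinite_finite_induct) (auto simp: linop_zero linop_add)

lemma posop_linop: "posop S A \<Longrightarrow> linop A"
  and posop_sym: "posop S A \<Longrightarrow> rip S f (A g) = rip S (A f) g"
  and posop_nonneg: "posop S A \<Longrightarrow> 0 \<le> rip S f (A f)"
  by (auto simp: posop_def symop_def)

text \<open>Vectors are functions on the whole index type, while \<open>rip S\<close> sees only
  \<open>S\<close>. Moving \<open>A\<close> to the other argument by symmetry shows that values
  outside \<open>S\<close> cannot influence the result on \<open>S\<close>.\<close>

lemma posop_local:
  assumes "finite S" "posop S A" "\<And>i. i \<in> S \<Longrightarrow> f i = g i" "i \<in> S"
  shows "A f i = A g i"
proof (rule rip_eqI[OF assms(1) _ assms(4)])
  fix h
  show "rip S h (A f) = rip S h (A g)"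
    using assms(2,3) by (simp add: posop_sym cong: rip_cong)
qed

definition delta :: "'i \<Rightarrow> 'i \<Rightarrow> complex" where
  "delta s = (\<lambda>t. if t = s then 1 else 0)"

lemma posop_expand:
  assumes S: "finite S" and A: "posop S A" and i: "i \<in> S"
  shows "A f i = (\<Sum>s\<in>S. A (delta s) i * f s)"
proof -
  have "A f i = A (\<Sum>s\<in>S. smul (f s) (delta s)) i"
  proof (rule posop_local[OF S A _ i])
    fix j assume "j \<in> S"
    thus "f j = (\<Sum>s\<in>S. smul (f s) (delta s)) j"
      using S by (simp add: fun_apply sum_fun_apply delta_def if_distrib cong: if_cong)
  qed
  also have "\<dots> = (\<Sum>s\<in>S. A (delta s) i * f s)"
    using posop_linop[OF A] by (simp add: linop_sum linop_smul fun_apply sum_fun_apply mult.commute)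
  finally show ?thesis .
qed

text \<open>On \<open>S\<close> the operator \<open>1 + A\<close> is a square matrix, so injectivity
  suffices: if \<open>f + A f\<close> vanishes on \<open>S\<close>, pairing with \<open>f\<close>
  gives \<open>rip S f f + rip S f (A f) = 0\<close>, where both terms are nonnegative. The inverse
  matrix, extended by zero outside \<open>S\<close>, is \<open>Z\<close>.\<close>

lemma posop_resolvent_ex:
  assumes S: "finite S" and A: "posop S A"
  shows "\<exists>Z. linop Z \<and> (\<forall>f. \<forall>i. i \<notin> S \<longrightarrow> Z f i = 0) \<and> (\<forall>f. \<forall>i\<in>S. Z f i + A (Z f) i = f i)"
proof -
  obtain b :: "nat \<Rightarrow> 'a" and n where b: "bij_betw b {0..<n} S"
    using ex_bij_betw_nat_finite[OF S] by blast
  define c where "c = inv_into {0..<n} b"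
  have cb: "c (b j) = j" if "j < n" for j
    using b that by (simp add: c_def bij_betw_def)
  have bc: "b (c s) = s" and cn: "c s < n" if "s \<in> S" for s
    using b that by (auto simp: c_def bij_betw_def f_inv_into_f)
  have bS: "b j \<in> S" if "j < n" for j
    using b that by (auto simp: bij_betw_def)
  have sumS: "(\<Sum>s\<in>S. h s) = (\<Sum>j = 0..<n. h (b j))" for h :: "'a \<Rightarrow> complex"
    using sum.reindex_bij_betw[OF b, of h] by simp
  define M where "M = mat n n (\<lambda>(i,j). (if i = j then 1 else 0) + A (delta (b j)) (b i))"
  have M: "M \<in> carrier_mat n n" by (simp add: M_def)
  have Mv: "(\<Sum>j = 0..<n. M $$ (i,j) * f (b j)) = f (b i) + A f (b i)" if i: "i < n" for f i
  proof -
    have "(\<Sum>j = 0..<n. M $$ (i,j) * f (b j))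
        = (\<Sum>j = 0..<n. (if i = j then f (b j) else 0) + A (delta (b j)) (b i) * f (b j))"
      using i by (intro sum.cong) (auto simp: M_def algebra_simps)
    also have "\<dots> = f (b i) + (\<Sum>j = 0..<n. A (delta (b j)) (b i) * f (b j))"
      using i by (simp add: sum.distrib)
    also have "(\<Sum>j = 0..<n. A (delta (b j)) (b i) * f (b j)) = A f (b i)"
      using posop_expand[OF S A bS[OF i], of f] by (simp add: sumS)
    finally show ?thesis .
  qed
  have "det M \<noteq> 0"
  proof
    assume "det M = 0"
    then obtain v where v: "v \<in> carrier_vec n" "v \<noteq> 0\<^sub>v n" "M *\<^sub>v v = 0\<^sub>v n"
      using det_0_iff_vec_prod_zero_field[OF M] by blast
    define f where "f s = v $ c s" for s
    have fb: "f (b j) = v $ j" if "j < n" for j using that by (simp add: f_def cb)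
    have "f s + A f s = 0" if s: "s \<in> S" for s
    proof -
      have "f s + A f s = (\<Sum>j = 0..<n. M $$ (c s,j) * f (b j))"
        using Mv[OF cn[OF s]] by (simp add: bc[OF s])
      also have "\<dots> = (M *\<^sub>v v) $ c s"
        using M v(1) cn[OF s] by (simp add: scalar_prod_def fb)
      finally show ?thesis using v(3) cn[OF s] by simp
    qed
    hence "rip S f (f + A f) = rip S f 0" by (intro rip_cong) (auto simp: fun_apply)
    hence "rip S f f + rip S f (A f) = 0" by simp
    hence "rip S f f = 0" using posop_nonneg[OF A, of f] rip_nonneg[of S f] by linarith
    hence "f s = 0" if "s \<in> S" for s using rip_self_eq_0[OF S] that by blast
    hence "v $ j = 0" if "j < n" for j using fb[OF that] bS[OF that] by simp
    hence "v = 0\<^sub>v n" using v(1) by auto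
    thus False using v(2) by simp
  qed
  from det_non_zero_imp_unit[OF M this, of "()"]
  obtain B where B: "B \<in> carrier_mat n n" "M * B = 1\<^sub>m n"
    by (auto simp: Units_def ring_mat_def)
  define Z where "Z f = (\<lambda>s. if s \<in> S then \<Sum>j = 0..<n. B $$ (c s, j) * f (b j) else 0)" for f
  have "linop Z"
    by (auto simp: linop_def Z_def fun_apply fun_eq_iff algebra_simps sum.distrib sum_distrib_left)
  moreover have "Z f s + A (Z f) s = f s" if s: "s \<in> S" for f s
  proof -
    let ?i = "c s"
    have i: "?i < n" by (rule cn[OF s])
    have "Z f s + A (Z f) s = (\<Sum>k = 0..<n. M $$ (?i,k) * Z f (b k))"
      using Mv[OF i, of "Z f"] by (simp add: bc[OF s])
    also have "\<dots> = (\<Sum>k = 0..<n. \<Sum>j = 0..<n. M $$ (?i,k) * B $$ (k,j) * f (b j))"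
      by (intro sum.cong) (auto simp: Z_def bS cb sum_distrib_left algebra_simps)
    also have "\<dots> = (\<Sum>j = 0..<n. (\<Sum>k = 0..<n. M $$ (?i,k) * B $$ (k,j)) * f (b j))"
      by (subst sum.swap) (simp add: sum_distrib_right)
    also have "\<dots> = (\<Sum>j = 0..<n. (M * B) $$ (?i,j) * f (b j))"
      using M B(1) i by (intro sum.cong) (auto simp: scalar_prod_def)
    also have "\<dots> = (\<Sum>j = 0..<n. if ?i = j then f (b j) else 0)"
      using i by (intro sum.cong) (auto simp: B(2))
    also have "\<dots> = f s" using i bc[OF s] by simp
    finally show ?thesis .
  qed
  ultimately show ?thesis by (intro exI[of _ Z]) (auto simp: Z_def)
qed

text \<open>The last property is the variational characterisation of the inverse of
  \<open>1 + A\<close>: any trial vector \<open>h\<close> bounds the inverse from below, with no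
  formula for the inverse itself.\<close>

lemma posop_resolvent:
  assumes S: "finite S" and A: "posop S A"
  obtains Z where "posop S Z" "\<And>f i. i \<notin> S \<Longrightarrow> Z f i = 0" "\<And>f i. i \<in> S \<Longrightarrow> Z f i + A (Z f) i = f i"
    "\<And>f. rip S (Z f) (Z f) + rip S (Z f) (A (Z f)) = rip S f (Z f)"
    "\<And>f. rip S f (Z f) \<le> rip S f f"
    "\<And>f h. 2 * rip S f h - rip S h h - rip S h (A h) \<le> rip S f (Z f)"
proof -
  obtain Z where Z: "linop Z" "\<And>f i. i \<notin> S \<Longrightarrow> Z f i = 0" "\<And>f i. i \<in> S \<Longrightarrow> Z f i + A (Z f) i = f i"
    using posop_resolvent_ex[OF S A] by blast
  have e: "rip S h f = rip S h (Z f) + rip S h (A (Z f))" for h f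
    using rip_cong[of S h h f "Z f + A (Z f)"] Z(3)
    by (auto simp: fun_apply simp del: rip_add_right simp flip: rip_add_right)
  have q: "rip S (Z f) (Z f) + rip S (Z f) (A (Z f)) = rip S f (Z f)" for f
    using e[of "Z f" f] by (simp add: rip_sym)
  have sym: "rip S f (Z g) = rip S (Z f) g" for f g
    using e[of "Z g" f] e[of "Z f" g] posop_sym[OF A, of "Z g" "Z f"]
    by (simp add: rip_sym[of S _ "Z g"] rip_sym[of S "Z f" g] rip_sym[of S "A (Z g)" "Z f"])
  have pos: "posop S Z"
    unfolding posop_def symop_def using Z(1) sym q rip_nonneg posop_nonneg[OF A]
    by (metis add_nonneg_nonneg)
  have le: "rip S f (Z f) \<le> rip S f f" for f
  proof -
    have "0 \<le> rip S (f - Z f) (f - Z f)" by (rule rip_nonneg)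
    thus ?thesis using q[of f] posop_nonneg[OF A, of "Z f"] by (simp add: rip_sym[of S "Z f" f])
  qed
  have var: "2 * rip S f h - rip S h h - rip S h (A h) \<le> rip S f (Z f)" for f h
  proof -
    \<comment> \<open>The form of \<open>1 + A\<close> is evaluated at the deviation of
      \<open>h\<close> from the optimal trial vector \<open>Z f\<close>.\<close>
    have "0 \<le> rip S (Z f - h) (Z f - h) + rip S (Z f - h) (A (Z f - h))"
      by (rule add_nonneg_nonneg[OF rip_nonneg posop_nonneg[OF A]])
    also have "\<dots> = rip S f (Z f) - 2 * rip S f h + rip S h h + rip S h (A h)"
      using q[of f] e[of h f] posop_sym[OF A, of "Z f" h]
      by (simp add: linop_diff[OF posop_linop[OF A]] rip_sym[of S h "Z f"] rip_sym[of S h f]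
          rip_sym[of S h "A (Z f)"])
    finally show ?thesis by simp
  qed
  show ?thesis using that[OF pos Z(2,3) q le var] by blast
qed

section \<open>Sequential decoding\<close>

text \<open>Expand the form at \<open>2 f - g\<close>. The weights 2 and 1/2 are chosen so that the
  \<open>g\<close> terms can be absorbed in \<open>sequential_decoding_bound\<close>.\<close>

lemma posop_am_gm:
  assumes A: "posop S A"
  shows "2 * rip S f (A g) \<le> 2 * rip S f (A f) + rip S g (A g) / 2"
proof -
  let ?f = "smul (complex_of_real 2) f"
  have "0 \<le> rip S (?f - g) (A (?f - g))" by (rule posop_nonneg[OF A])
  also have "A (?f - g) = smul (complex_of_real 2) (A f) - A g"
    by (simp only: linop_diff[OF posop_linop[OF A]] linop_smul[OF posop_linop[OF A]])
  finally show ?thesis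
    using posop_sym[OF A, of g f] by (simp del: of_real_numeral add: rip_sym[of S "A g" f])
qed

definition effect :: "'i set \<Rightarrow> (('i \<Rightarrow> complex) \<Rightarrow> 'i \<Rightarrow> complex) \<Rightarrow> bool" where
  "effect S A \<longleftrightarrow> posop S A \<and> (\<forall>f. rip S f (A f) \<le> rip S f f)"

lemma effect_posop: "effect S A \<Longrightarrow> posop S A"
  and effect_le: "effect S A \<Longrightarrow> rip S f (A f) \<le> rip S f f"
  by (auto simp: effect_def)

text \<open>In place of functional calculus, positivity of \<open>A\<close> at
  \<open>f - A f\<close> is combined with the effect bound at \<open>A f\<close>.\<close>

lemma effect_square_le:
  assumes A: "effect S A"
  shows "rip S (A f) (A f) \<le> rip S f (A f)"
proof -
  note P = effect_posop[OF A]
  have "0 \<le> rip S (f - A f) (A (f - A f))" by (rule posop_nonneg[OF P])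
  also have "\<dots> = rip S f (A f) - 2 * rip S (A f) (A f) + rip S (A f) (A (A f))"
    using posop_sym[OF P, of f "A f"] by (simp add: linop_diff[OF posop_linop[OF P]])
  finally show ?thesis using effect_le[OF A, of "A f"] by linarith
qed

lemma effect_compl:
  assumes A: "effect S A"
  shows "effect S (\<lambda>f. f - A f)"
proof -
  note P = effect_posop[OF A]
  have "linop (\<lambda>f. f - A f)"
    unfolding linop_def
    by (auto simp only: linop_add[OF posop_linop[OF P]] linop_smul[OF posop_linop[OF P]])
      (auto simp: fun_apply fun_eq_iff algebra_simps)
  thus ?thesis
    using posop_sym[OF P] posop_nonneg[OF P] effect_le[OF A]
    by (auto simp: effect_def posop_def symop_def)
qed

text \<open>The unnormalised state after the tests \<open>T 0, ..., T (k - 1)\<close> have all rejected. Rejection acts by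
  \<open>1 - T i\<close> instead of its square root; acceptance then has the effect \<open>1 - (1 - T i)\<^sup>2 \<ge> T i\<close>.\<close>

fun seqv :: "(nat \<Rightarrow> ('i \<Rightarrow> complex) \<Rightarrow> 'i \<Rightarrow> complex) \<Rightarrow> nat \<Rightarrow> ('i \<Rightarrow> complex) \<Rightarrow> 'i \<Rightarrow> complex" where
  "seqv T 0 f = f"
| "seqv T (Suc k) f = seqv T k f - T k (seqv T k f)"

lemma linop_seqv:
  assumes "\<And>i. i < k \<Longrightarrow> linop (T i)"
  shows "linop (seqv T k)"
  using assms
proof (induction k)
  case 0
  show ?case by (simp add: linop_def)
next
  case (Suc k)
  hence a: "linop (seqv T k)" and b: "linop (T k)" by auto
  show ?case
    unfolding linop_def seqv.simps linop_add[OF a] linop_add[OF b] linop_smul[OF a] linop_smul[OF b]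
    by (auto simp: fun_apply fun_eq_iff algebra_simps)
qed

text \<open>With \<open>y = seqv T k f\<close>, the squared norm of \<open>y - T k y\<close>
  contains the cross term of \<open>y\<close> and \<open>T k y\<close> twice with a minus sign;
  \<open>effect_square_le\<close> pays the square of \<open>T k y\<close> with one of them.\<close>

lemma seqv_drop:
  assumes "effect S (T k)"
  shows "rip S (seqv T (Suc k) f) (seqv T (Suc k) f) + rip S (seqv T k f) (T k (seqv T k f))
           \<le> rip S (seqv T k f) (seqv T k f)"
  using effect_square_le[OF assms, of "seqv T k f"]
  by (simp add: rip_sym[of S "T k (seqv T k f)" "seqv T k f"])

text \<open>Telescoped \<open>seqv_drop\<close>. It provides a budget: the weight met by all the
  tests along the sequence, plus what survives, never exceeds the initial weight, however many tests
  there are.\<close>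

lemma seqv_weight:
  assumes "\<And>i. i < k \<Longrightarrow> effect S (T i)"
  shows "rip S (seqv T k f) (seqv T k f) + (\<Sum>i<k. rip S (seqv T i f) (T i (seqv T i f))) \<le> rip S f f"
  using assms
proof (induction k)
  case (Suc k)
  have "rip S (seqv T k f) (seqv T k f) + (\<Sum>i<k. rip S (seqv T i f) (T i (seqv T i f))) \<le> rip S f f"
    using Suc.prems by (intro Suc.IH) auto
  thus ?case using seqv_drop[of S T k f] Suc.prems[of k] by (simp del: seqv.simps)
qed simp

lemma seqv_decreasing:
  assumes "\<And>i. i < k \<Longrightarrow> effect S (T i)"
  shows "rip S (seqv T k f) (seqv T k f) \<le> rip S f f"
proof -
  have "0 \<le> (\<Sum>i<k. rip S (seqv T i f) (T i (seqv T i f)))"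
    using assms by (intro sum_nonneg posop_nonneg effect_posop) auto
  thus ?thesis using seqv_weight[of k S T f] assms by fastforce
qed

lemma seqv_telescope: "rip S f (f - seqv T k f) = (\<Sum>i<k. rip S f (T i (seqv T i f)))"
  by (induction k) (simp_all add: algebra_simps)

text \<open>The vector \<open>x = T k z\<close> is close to \<open>f\<close>: write
  \<open>f - x = (f - z) + (z - x)\<close>, where \<open>f - z\<close> telescopes into the vectors
  removed by the earlier tests and \<open>z - x\<close> is what test \<open>k\<close> rejects.
  \<open>posop_am_gm\<close> turns the mixed terms into error terms at \<open>f\<close> itself plus
  half of the weights along the sequence. By \<open>seqv_weight\<close> that half is at most half
  the weight of \<open>f\<close>, so it moves to the left side; this doubles the factor 2 to
  4.\<close>

lemma sequential_decoding_bound: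
  assumes T: "\<And>i. i \<le> k \<Longrightarrow> effect S (T i)"
  shows "rip S f f - (rip S (seqv T k f) (seqv T k f) - rip S (seqv T (Suc k) f) (seqv T (Suc k) f))
     \<le> 4 * ((\<Sum>i<k. rip S f (T i f)) + (rip S f f - rip S f (T k f)))"
proof -
  define z where "z = seqv T k f"
  define x where "x = T k z"
  have Tk: "effect S (T k)" using T by simp
  note Pk = effect_posop[OF Tk]
  define B where "B = (\<Sum>i<k. rip S (seqv T i f) (T i (seqv T i f)))"
  have w: "rip S z z + B \<le> rip S f f"
    unfolding z_def B_def using T by (intro seqv_weight) auto
  have sq: "rip S x x \<le> rip S z x" unfolding x_def by (rule effect_square_le[OF Tk])
  have "2 * rip S f (f - z) = (\<Sum>i<k. 2 * rip S f (T i (seqv T i f)))"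
    unfolding z_def seqv_telescope by (simp add: sum_distrib_left)
  also have "\<dots> \<le> (\<Sum>i<k. 2 * rip S f (T i f) + rip S (seqv T i f) (T i (seqv T i f)) / 2)"
    using T by (intro sum_mono posop_am_gm effect_posop) auto
  also have "\<dots> = 2 * (\<Sum>i<k. rip S f (T i f)) + B / 2"
    by (simp add: B_def sum.distrib sum_distrib_left sum_divide_distrib)
  finally have 1: "2 * rip S f (f - z) \<le> 2 * (\<Sum>i<k. rip S f (T i f)) + B / 2" .
  have 2: "2 * rip S f (z - x) \<le> 2 * (rip S f f - rip S f (T k f)) + (rip S z z - rip S z x) / 2"
    using posop_am_gm[OF effect_posop[OF effect_compl[OF Tk]], of f z] by (simp add: x_def)
  have 3: "0 \<le> rip S (f - x) (f - x)" by (rule rip_nonneg)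
  have 4: "rip S (seqv T (Suc k) f) (seqv T (Suc k) f) = rip S z z - 2 * rip S z x + rip S x x"
    by (simp add: z_def x_def rip_sym)
  define a where "a = (\<Sum>i<k. rip S f (T i f))"
  have "2 * rip S f f - 2 * rip S f z \<le> 2 * a + B / 2"
    using 1 by (simp add: a_def)
  moreover have "2 * rip S f x \<le> rip S f f + rip S x x"
    using 3 by (simp add: rip_sym[of S x f])
  ultimately show ?thesis
    using 2 sq w unfolding 4 z_def[symmetric] a_def[symmetric] rip_diff_right
    by (simp add: field_simps)
qed

text \<open>\<open>Q = (P + k) / (1 + k)\<close> is invertible and \<open>N = Q\<^sup>-\<^sup>1 - 1\<close>.\<close>

lemma regularise_effect:
  assumes D: "finite D" and P: "effect D P" and k: "0 < (k::real)"
  obtains Q N where "effect D Q" "posop D N" "\<And>f j. j \<in> D \<Longrightarrow> N (Q f) j + Q f j = f j"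
    "\<And>f. rip D f (Q f) \<le> rip D f (P f) + k * rip D f f"
    "\<And>f. rip D f f - rip D f (Q f) \<le> rip D f f - rip D f (P f)"
proof -
  note PP = effect_posop[OF P]
  note lP = posop_linop[OF PP]
  \<comment> \<open>Up to the factor \<open>k / (1 + k)\<close>, \<open>Q\<close> is
    \<open>1 + P / k\<close>, so the resolvent of \<open>P / k\<close> supplies its inverse.\<close>
  define A where "A f = smul (complex_of_real (1/k)) (P f)" for f
  have lA: "linop A"
    unfolding linop_def A_def linop_add[OF lP] linop_smul[OF lP]
    by (auto simp: fun_apply fun_eq_iff algebra_simps)
  have A: "posop D A"
    unfolding posop_def symop_def using lA posop_sym[OF PP] posop_nonneg[OF PP] k
    by (auto simp del: of_real_divide simp: A_def)
  obtain Z where Z: "posop D Z" "\<And>f i. i \<in> D \<Longrightarrow> Z f i + A (Z f) i = f i"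
    "\<And>f h. 2 * rip D f h - rip D h h - rip D h (A h) \<le> rip D f (Z f)"
    using posop_resolvent[OF D A] by metis
  note lZ = posop_linop[OF Z(1)]
  have ZA: "Z (f + A f) i = f i" if "i \<in> D" for f i
  proof (rule rip_eqI[OF D _ that])
    fix h
    have "rip D h (Z (f + A f)) = rip D (Z h) f + rip D (A (Z h)) f"
      using posop_sym[OF Z(1), of h "f + A f"] posop_sym[OF A, of "Z h" f] by simp
    also have "\<dots> = rip D (Z h + A (Z h)) f" by simp
    also have "\<dots> = rip D h f" by (rule rip_cong) (auto simp: Z(2) fun_apply)
    finally show "rip D h (Z (f + A f)) = rip D h f" .
  qed
  define Q where "Q f = smul (complex_of_real (k/(1+k))) (f + A f)" for f
  define N where "N f = smul (complex_of_real ((1+k)/k)) (Z f) - f" for f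
  have lQ: "linop Q"
    unfolding linop_def Q_def linop_add[OF lA] linop_smul[OF lA]
    by (auto simp: fun_apply fun_eq_iff algebra_simps add_divide_distrib)
  have lN: "linop N"
    unfolding linop_def N_def linop_add[OF lZ] linop_smul[OF lZ]
    by (auto simp: fun_apply fun_eq_iff algebra_simps add_divide_distrib)
  have qQ: "rip D f (Q f) = (k * rip D f f + rip D f (P f)) / (1 + k)" for f
  proof -
    have "rip D f (Q f) = k * (rip D f f + 1/k * rip D f (P f)) / (1 + k)"
      by (simp del: of_real_divide of_real_add add: Q_def A_def)
    also have "k * (rip D f f + 1/k * rip D f (P f)) = k * rip D f f + rip D f (P f)"
      using k by (simp add: algebra_simps)
    finally show ?thesis .
  qed
  have "0 \<le> rip D f (Q f)" "rip D f (Q f) \<le> rip D f f" for f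
    using k posop_nonneg[OF PP, of f] effect_le[OF P, of f] unfolding qQ
    by (auto simp: field_simps)
  moreover have "symop D Q"
    using posop_sym[OF A] by (auto simp: symop_def Q_def simp del: of_real_divide of_real_add)
  ultimately have Q: "effect D Q" using lQ by (auto simp: effect_def posop_def)
  have "symop D N"
    using posop_sym[OF Z(1)] by (auto simp: symop_def N_def simp del: of_real_divide of_real_add)
  moreover have "0 \<le> rip D f (N f)" for f
  proof -
    \<comment> \<open>Nonnegativity of \<open>N\<close> amounts to
      \<open>c * rip D f f \<le> rip D f (Z f)\<close>. The trial vector \<open>c f\<close> yields
      it, and this \<open>c\<close> solves \<open>c * (1 + 1/k) = 1\<close>.\<close>
    define c where "c = k / (1 + k)"
    have "1 + 1/k = (1 + k) / k" using k by (simp add: add_divide_distrib)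
    hence c: "c > 0" "c * (1 + 1/k) = 1" using k by (auto simp: c_def)
    have "2 * c * rip D f f - c^2 * rip D f f - c^2 * (1/k) * rip D f (P f) \<le> rip D f (Z f)"
      using Z(3)[of f "smul (complex_of_real c) f"]
      by (simp add: A_def linop_smul[OF lP] power2_eq_square algebra_simps del: of_real_divide of_real_add)
    moreover have "c^2 * (1/k) * rip D f (P f) \<le> c^2 * (1/k) * rip D f f"
      using k by (intro mult_left_mono effect_le[OF P]) auto
    moreover have "c^2 + c^2 * (1/k) = c * (c * (1 + 1/k))" by (simp add: power2_eq_square algebra_simps)
    hence "c^2 + c^2 * (1/k) = c" using c(2) by simp
    ultimately have "c * rip D f f \<le> rip D f (Z f)"
      by (smt (verit, best) distrib_right)
    hence "rip D f f \<le> rip D f (Z f) / c" using c by (simp add: field_simps)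
    thus ?thesis using k by (simp add: N_def c_def mult.commute del: of_real_divide of_real_add)
  qed
  ultimately have N: "posop D N" using lN by (auto simp: posop_def)
  have NQ: "N (Q f) j + Q f j = f j" if "j \<in> D" for f j
  proof -
    have "Z (Q f) = smul (complex_of_real (k/(1+k))) (Z (f + A f))"
      unfolding Q_def by (rule linop_smul[OF lZ])
    hence "N (Q f) j + Q f j = complex_of_real ((1+k)/k) * (complex_of_real (k/(1+k)) * f j)"
      using ZA[OF that, of f] by (simp add: N_def fun_apply del: of_real_divide)
    also have "\<dots> = complex_of_real ((1+k)/k * (k/(1+k))) * f j"
      by (simp only: of_real_mult mult.assoc)
    also have "(1+k)/k * (k/(1+k)) = 1" using k by simp
    finally show ?thesis by simp
  qed
  have "rip D f (Q f) \<le> rip D f (P f) + k * rip D f f" for f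
    unfolding qQ using k posop_nonneg[OF PP, of f] rip_nonneg[of D f] 
    by (simp add: field_simps) 
  moreover have "rip D f (P f) \<le> rip D f (Q f)" for f
    unfolding qQ using k effect_le[OF P, of f] by (simp add: field_simps)
  ultimately show ?thesis using that[OF Q N NQ] by (simp add: algebra_simps)
qed

section \<open>Tilted tests\<close>

definition ten :: "('a \<Rightarrow> real) \<Rightarrow> ('j \<Rightarrow> complex) \<Rightarrow> 'a \<times> 'j \<Rightarrow> complex" where
  "ten w h = (\<lambda>(a, j). complex_of_real (w a) * h j)"

text \<open>The partial inner product with \<open>w\<close> on the register, that is, the adjoint of
  \<open>ten w\<close>.\<close>

definition con :: "'a set \<Rightarrow> ('a \<Rightarrow> real) \<Rightarrow> ('a \<times> 'j \<Rightarrow> complex) \<Rightarrow> 'j \<Rightarrow> complex" where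
  "con A w f = (\<lambda>j. \<Sum>a\<in>A. complex_of_real (w a) * f (a, j))"

lemma linop_con: "linop (con A w)"
  by (auto simp: linop_def con_def fun_apply fun_eq_iff algebra_simps sum.distrib sum_distrib_left)

lemma linop_ten: "linop (ten w)"
  by (auto simp: linop_def ten_def fun_apply fun_eq_iff algebra_simps)

lemma rip_ten_left: "rip (A \<times> D) (ten w h) f = rip D h (con A w f)"
proof -
  have "rip (A \<times> D) (ten w h) f = (\<Sum>a\<in>A. \<Sum>j\<in>D. Re (cnj (ten w h (a,j)) * f (a,j)))"
    by (simp add: rip_def sum.cartesian_product case_prod_unfold)
  also have "\<dots> = (\<Sum>j\<in>D. \<Sum>a\<in>A. Re (cnj (ten w h (a,j)) * f (a,j)))" by (rule sum.swap)
  also have "\<dots> = rip D h (con A w f)"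
    unfolding rip_def con_def ten_def
    by (intro sum.cong refl) (simp add: sum_distrib_left sum_subtractf[symmetric] algebra_simps)
  finally show ?thesis .
qed

lemma rip_ten_right: "rip (A \<times> D) f (ten w h) = rip D (con A w f) h"
  using rip_ten_left[of A D w h f] by (simp add: rip_sym)

lemma con_ten: "con A w (ten w' h) = smul (complex_of_real (\<Sum>a\<in>A. w a * w' a)) h"
  by (auto simp: con_def ten_def fun_apply fun_eq_iff sum_distrib_left algebra_simps)

lemma rip_ten_ten: "rip (A \<times> D) (ten w h) (ten w' h') = (\<Sum>a\<in>A. w a * w' a) * rip D h h'"
  by (simp add: rip_ten_left con_ten del: of_real_sum)

text \<open>Cauchy-Schwarz for the register factor, read off from the squared norm of
  \<open>n f - ten w c\<close> with \<open>c\<close> the contraction of \<open>f\<close>.\<close>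

lemma con_norm_le:
  assumes "(\<Sum>a\<in>A. (w a)\<^sup>2) \<le> n" "0 < n"
  shows "rip D (con A w f) (con A w f) \<le> n * rip (A \<times> D) f f"
proof -
  let ?c = "con A w f"
  have "0 \<le> rip (A \<times> D) (smul (complex_of_real n) f - ten w ?c) (smul (complex_of_real n) f - ten w ?c)"
    by (rule rip_nonneg)
  also have "\<dots> = n * (n * rip (A \<times> D) f f) - 2 * n * rip D ?c ?c + (\<Sum>a\<in>A. (w a)\<^sup>2) * rip D ?c ?c"
    by (simp add: rip_ten_ten rip_ten_left[of A D w "con A w f" f] rip_ten_right[of A D f w "con A w f"]
        power2_eq_square algebra_simps)
  also have "\<dots> \<le> n * (n * rip (A \<times> D) f f) - 2 * n * rip D ?c ?c + n * rip D ?c ?c"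
    using assms(1) by (simp add: mult_right_mono)
  finally have "n * rip D ?c ?c \<le> n * (n * rip (A \<times> D) f f)" by (simp add: algebra_simps)
  thus ?thesis using assms(2) by simp
qed

lemma rip_sum_square_le:
  assumes "finite I"
  shows "rip S (\<Sum>i\<in>I. x i) (\<Sum>i\<in>I. x i) \<le> real (card I) * (\<Sum>i\<in>I. rip S (x i) (x i))"
proof -
  have am: "rip S f g \<le> (rip S f f + rip S g g) / 2" for f g
    using rip_nonneg[of S "f - g"] by (simp add: rip_sym[of S g f])
  have "rip S (\<Sum>i\<in>I. x i) (\<Sum>i\<in>I. x i) = (\<Sum>i\<in>I. \<Sum>j\<in>I. rip S (x i) (x j))"
    by (simp only: rip_sum_left) (simp only: rip_sum_right)
  also have "\<dots> \<le> (\<Sum>i\<in>I. \<Sum>j\<in>I. (rip S (x i) (x i) + rip S (x j) (x j)) / 2)"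
    by (intro sum_mono am)
  also have "\<dots> = real (card I) * (\<Sum>i\<in>I. rip S (x i) (x i))"
    by (simp add: add_divide_distrib sum.distrib sum_distrib_left sum_divide_distrib[symmetric])
  finally show ?thesis .
qed

text \<open>\<open>T = (1 + \<Sum>i. N i \<otimes> w i (w i)\<^sup>T)\<^sup>-\<^sup>1\<close>. By the variational formula for the resolvent, the last bound
  only needs a trial vector close to \<open>v \<otimes> h\<close> on which the penalty is small; the dual basis \<open>d\<close> provides
  \<open>\<Sum>i. g i d i \<otimes> Q i h\<close>.\<close>

lemma tilted_test:
  fixes w d :: "'i \<Rightarrow> 'a \<Rightarrow> real" and n :: real and D :: "'j set"
  assumes A: "finite A" and D: "finite D" and I: "finite I"
    and Q: "\<And>i. i \<in> I \<Longrightarrow> effect D (Q i)" and N: "\<And>i. i \<in> I \<Longrightarrow> posop D (N i)"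
    and NQ: "\<And>i f j. i \<in> I \<Longrightarrow> j \<in> D \<Longrightarrow> N i (Q i f) j + Q i f j = f j"
    and n: "1 \<le> n" "\<And>i. i \<in> I \<Longrightarrow> (\<Sum>a\<in>A. (w i a)\<^sup>2) \<le> n"
    and dual: "\<And>i j. i \<in> I \<Longrightarrow> j \<in> I \<Longrightarrow> (\<Sum>a\<in>A. w j a * d i a) = (if i = j then 1 else 0)"
    and v: "\<And>a. a \<in> A \<Longrightarrow> v a = (\<Sum>i\<in>I. g i * d i a)"
  obtains T where "effect (A \<times> D) T" "\<And>f x. x \<notin> A \<times> D \<Longrightarrow> T f x = 0"
    "\<And>i h. i \<in> I \<Longrightarrow> rip (A \<times> D) (ten (w i) h) (T (ten (w i) h)) \<le> n * rip D h (Q i h)"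
    "\<And>h. rip (A \<times> D) (ten v h) (ten v h) - rip (A \<times> D) (ten v h) (T (ten v h))
        \<le> (\<Sum>i\<in>I. (real (card I) * (\<Sum>a\<in>A. (d i a)\<^sup>2) + 1) * (g i)\<^sup>2 * (rip D h h - rip D h (Q i h)))"
proof -
  let ?S = "A \<times> D"
  have S: "finite ?S" using A D by simp
  define M where "M f = (\<Sum>i\<in>I. ten (w i) (N i (con A (w i) f)))" for f
  have lN: "linop (N i)" if "i \<in> I" for i using posop_linop[OF N[OF that]] .
  have M1: "rip ?S f (M f') = (\<Sum>i\<in>I. rip D (con A (w i) f) (N i (con A (w i) f')))" for f f'
    unfolding M_def rip_sum_right rip_ten_right ..
  have "linop M"
    unfolding linop_def
  proof (intro conjI allI)
    fix f f' :: "'a \<times> 'j \<Rightarrow> complex" and c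
    show "M (f + f') = M f + M f'"
      unfolding M_def by (simp add: linop_add[OF linop_con] linop_add[OF lN] linop_add[OF linop_ten] sum.distrib)
    have "M (smul c f) = (\<Sum>i\<in>I. smul c (ten (w i) (N i (con A (w i) f))))"
      unfolding M_def by (simp add: linop_smul[OF linop_con] linop_smul[OF lN] linop_smul[OF linop_ten])
    also have "\<dots> = smul c (M f)"
      by (auto simp: M_def fun_eq_iff sum_fun_apply fun_apply sum_distrib_left)
    finally show "M (smul c f) = smul c (M f)" .
  qed
  moreover have "symop ?S M"
    unfolding symop_def
  proof (intro allI)
    fix f f'
    have "rip ?S (M f) f' = (\<Sum>i\<in>I. rip D (con A (w i) f') (N i (con A (w i) f)))"
      by (subst rip_sym) (rule M1)
    also have "\<dots> = (\<Sum>i\<in>I. rip D (con A (w i) f) (N i (con A (w i) f')))"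
      by (intro sum.cong refl, subst posop_sym[OF N], assumption, rule rip_sym)
    finally show "rip ?S f (M f') = rip ?S (M f) f'" using M1 by simp
  qed
  moreover have "0 \<le> rip ?S f (M f)" for f
    unfolding M1 using N by (intro sum_nonneg posop_nonneg)
  ultimately have M: "posop ?S M" by (simp add: posop_def)
  obtain T where T: "posop ?S T" "\<And>f x. x \<notin> ?S \<Longrightarrow> T f x = 0" 
    "\<And>f. rip ?S (T f) (T f) + rip ?S (T f) (M (T f)) = rip ?S f (T f)"
    "\<And>f. rip ?S f (T f) \<le> rip ?S f f"
    "\<And>f h. 2 * rip ?S f h - rip ?S h h - rip ?S h (M h) \<le> rip ?S f (T f)"
    using posop_resolvent[OF S M] by metis
  have wrong: "rip ?S (ten (w i) h) (T (ten (w i) h)) \<le> n * rip D h (Q i h)" if i: "i \<in> I" for i h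
  proof -
    define f where "f = ten (w i) h"
    define c where "c = con A (w i) (T f)"
    define t where "t = rip ?S f (T f)"
    have t: "t = rip D h c" by (simp add: t_def f_def c_def rip_ten_left)
    have "rip D c (N i c) \<le> (\<Sum>i\<in>I. rip D (con A (w i) (T f)) (N i (con A (w i) (T f))))"
      unfolding c_def using i I N by (intro member_le_sum posop_nonneg) auto
    hence "rip ?S (T f) (T f) + rip D c (N i c) \<le> t"
      using T(3)[of f] M1[of "T f" "T f"] by (simp add: t_def)
    hence "n * rip ?S (T f) (T f) + n * rip D c (N i c) \<le> n * t"
      using n(1) by (metis (no_types) distrib_left mult_left_mono order_trans zero_le_one)
    moreover have "rip D c c \<le> n * rip ?S (T f) (T f)"
      unfolding c_def using n i by (intro con_norm_le) auto
    moreover have "rip D c (N i c) \<le> n * rip D c (N i c)"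
      using n(1) posop_nonneg[OF N[OF i], of c] by (simp add: mult_le_cancel_right1)
    ultimately have nt: "rip D c c + rip D c (N i c) \<le> n * t" by linarith
    \<comment> \<open>Since \<open>(1 + N i) q = n h\<close> on \<open>D\<close>, completing the
      square around \<open>q\<close> in the form of \<open>1 + N i\<close> bounds the linear
      quantity \<open>t = rip D h c\<close> by \<open>n\<close> times the form of
      \<open>Q i\<close>, given the quadratic bound \<open>nt\<close> on \<open>c\<close>.\<close>
    define q where "q = smul (complex_of_real n) (Q i h)"
    have Nq: "rip D y (N i q) + rip D y q = n * rip D y h" for y
    proof -
      have "rip D y (N i q) + rip D y q = n * rip D y (N i (Q i h) + Q i h)"
        by (simp add: q_def linop_smul[OF lN[OF i]] algebra_simps)
      also have "rip D y (N i (Q i h) + Q i h) = rip D y h"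
        using NQ[OF i] by (intro rip_cong) (auto simp: fun_apply)
      finally show ?thesis .
    qed
    have "0 \<le> rip D (q - c) (q - c) + rip D (q - c) (N i (q - c))"
      by (rule add_nonneg_nonneg[OF rip_nonneg posop_nonneg[OF N[OF i]]])
    also have "\<dots> = (rip D q (N i q) + rip D q q) - 2 * (rip D c (N i q) + rip D c q) + (rip D c c + rip D c (N i c))"
      using posop_sym[OF N[OF i], of q c]
      by (simp add: linop_diff[OF lN[OF i]] rip_sym[of D q c] rip_sym[of D "N i q" c])
    also have "\<dots> = n * (n * rip D h (Q i h)) - 2 * (n * t) + (rip D c c + rip D c (N i c))"
      unfolding Nq t by (simp add: q_def rip_sym)
    also have "\<dots> \<le> n * (n * rip D h (Q i h)) - n * t" using nt by simp
    finally have "n * t \<le> n * (n * rip D h (Q i h))" by simp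
    thus ?thesis using n(1) by (simp add: t_def f_def)
  qed
  have right: "rip ?S (ten v h) (ten v h) - rip ?S (ten v h) (T (ten v h))
        \<le> (\<Sum>i\<in>I. (real (card I) * (\<Sum>a\<in>A. (d i a)\<^sup>2) + 1) * (g i)\<^sup>2 * (rip D h h - rip D h (Q i h)))" for h
  proof -
    \<comment> \<open>The trial vector replaces \<open>h\<close> by \<open>Q i h\<close> in every
      component of \<open>ten v h\<close> along the dual basis; \<open>r\<close> is the error made
      thereby.\<close>
    define y where "y = (\<Sum>i\<in>I. smul (complex_of_real (g i)) (ten (d i) (Q i h)))"
    define r where "r = (\<Sum>i\<in>I. smul (complex_of_real (g i)) (ten (d i) (h - Q i h)))"
    have W: "effect D (\<lambda>h. h - Q i h)" if "i \<in> I" for i by (rule effect_compl[OF Q[OF that]])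
    have xr: "ten v h x - y x = r x" if xS: "x \<in> ?S" for x
    proof -
      obtain a j where x: "x = (a, j)" "a \<in> A" using xS by auto
      show ?thesis
        by (simp add: x(1) y_def r_def sum_fun_apply fun_apply ten_def v[OF x(2)] sum_distrib_left sum_distrib_right
            sum_subtractf[symmetric] algebra_simps)
    qed
    have "rip ?S (ten v h - y) (ten v h - y) = rip ?S r r"
      by (rule rip_cong) (auto simp: fun_apply xr)
    also have "\<dots> \<le> real (card I) * (\<Sum>i\<in>I. (g i)\<^sup>2 * ((\<Sum>a\<in>A. (d i a)\<^sup>2) * rip D (h - Q i h) (h - Q i h)))"
      unfolding r_def using rip_sum_square_le[OF I, of ?S "\<lambda>i. smul (complex_of_real (g i)) (ten (d i) (h - Q i h))"]
      by (simp add: rip_ten_ten power2_eq_square mult.assoc del: rip_diff_left rip_diff_right)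
    also have "\<dots> \<le> real (card I) * (\<Sum>i\<in>I. (g i)\<^sup>2 * ((\<Sum>a\<in>A. (d i a)\<^sup>2) * rip D h (h - Q i h)))"
      using effect_square_le[OF W] by (intro mult_left_mono sum_mono) (auto intro: sum_nonneg simp del: rip_diff_left rip_diff_right)
    finally have 1: "rip ?S (ten v h - y) (ten v h - y)
        \<le> real (card I) * (\<Sum>i\<in>I. (g i)\<^sup>2 * ((\<Sum>a\<in>A. (d i a)\<^sup>2) * (rip D h h - rip D h (Q i h))))" by simp
    \<comment> \<open>Duality separates the components: the penalty in direction \<open>w j\<close>
      sees only \<open>Q j h\<close>, on which \<open>N j\<close> acts as \<open>1 - Q j\<close>, so
      the inverse of a possibly small \<open>Q j\<close> never enters the bound.\<close>
    have cy: "con A (w j) y = smul (complex_of_real (g j)) (Q j h)" if j: "j \<in> I" for j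
    proof -
      have "con A (w j) y = (\<Sum>i\<in>I. smul (complex_of_real (g i)) (smul (complex_of_real (if i = j then 1 else 0)) (Q i h)))"
        unfolding y_def using dual j
        by (simp add: linop_sum[OF linop_con] linop_smul[OF linop_con] con_ten del: of_real_sum)
      also have "\<dots> = (\<Sum>i\<in>I. if i = j then smul (complex_of_real (g j)) (Q j h) else 0)"
        by (intro sum.cong) (auto simp: fun_apply fun_eq_iff)
      finally show ?thesis using I j by simp
    qed
    have "rip ?S y (M y) = (\<Sum>j\<in>I. (g j)\<^sup>2 * rip D (Q j h) (N j (Q j h)))"
      unfolding M1 by (intro sum.cong) (auto simp: cy linop_smul[OF lN] power2_eq_square)
    also have "\<dots> \<le> (\<Sum>j\<in>I. (g j)\<^sup>2 * (rip D h h - rip D h (Q j h)))"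
    proof (intro sum_mono mult_left_mono)
      fix j assume j: "j \<in> I"
      have "rip D (Q j h) (N j (Q j h)) = rip D (Q j h) (h - Q j h)"
        using NQ[OF j, of _ h] by (intro rip_cong) (auto simp: fun_apply algebra_simps)
      moreover have "0 \<le> rip D (h - Q j h) (h - Q j h)" by (rule rip_nonneg)
      ultimately show "rip D (Q j h) (N j (Q j h)) \<le> rip D h h - rip D h (Q j h)"
        by (simp add: rip_sym[of D "Q j h" h])
    qed auto
    finally have 2: "rip ?S y (M y) \<le> (\<Sum>j\<in>I. (g j)\<^sup>2 * (rip D h h - rip D h (Q j h)))" .
    \<comment> \<open>The variational bound at \<open>y\<close>, rearranged: the loss is at most the
      squared distance to the trial vector plus its penalty.\<close>
    have "rip ?S (ten v h) (ten v h) - rip ?S (ten v h) (T (ten v h))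
        \<le> rip ?S (ten v h - y) (ten v h - y) + rip ?S y (M y)"
      using T(5)[of "ten v h" y] by (simp add: rip_sym[of ?S y "ten v h"])
    also have "\<dots> \<le> real (card I) * (\<Sum>i\<in>I. (g i)\<^sup>2 * ((\<Sum>a\<in>A. (d i a)\<^sup>2) * (rip D h h - rip D h (Q i h))))
        + (\<Sum>j\<in>I. (g j)\<^sup>2 * (rip D h h - rip D h (Q j h)))"
      using 1 2 by simp
    also have "\<dots> = (\<Sum>i\<in>I. (real (card I) * (\<Sum>a\<in>A. (d i a)\<^sup>2) + 1) * (g i)\<^sup>2 * (rip D h h - rip D h (Q i h)))"
      by (subst sum_distrib_left, subst sum.distrib[symmetric]) (intro sum.cong, auto simp: algebra_simps)
    finally show ?thesis .
  qed
  have eff: "effect ?S T" using T(1,4) by (simp add: effect_def)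
  show ?thesis by (rule that[OF eff T(2) wrong right])
qed

section \<open>Product indices, changes of support, and the POVM of a sequential measurement\<close>

lemma sum_mult_index: "(\<Sum>i<a*b. f i) = (\<Sum>x<a. \<Sum>y<b. f (x * b + y))"
  for f :: "nat \<Rightarrow> 'c :: comm_monoid_add"
proof -
  have "(\<Sum>i<a*b. f i) = (\<Sum>x<a. sum f {x*b..<x*b+b})" by (simp add: sum.nat_group)
  also have "\<dots> = (\<Sum>x<a. \<Sum>y<b. f (x * b + y))"
  proof (rule sum.cong[OF refl])
    fix x
    show "sum f {x*b..<x*b+b} = (\<Sum>y<b. f (x * b + y))"
      using sum.shift_bounds_nat_ivl[of f 0 "x*b" b] by (simp add: add.commute lessThan_atLeast0)
  qed
  finally show ?thesis .
qed

lemma mult_index_less: "x < a \<Longrightarrow> y < b \<Longrightarrow> x * b + y < a * b" for x y a b :: nat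
proof -
  assume "x < a" "y < b"
  hence "x * b + y < Suc x * b" by simp
  also have "\<dots> \<le> a * b" using \<open>x < a\<close> by (intro mult_right_mono) auto
  finally show ?thesis .
qed

lemma rip_superset:
  assumes "finite S'" "S \<subseteq> S'" "\<And>x. x \<notin> S \<Longrightarrow> g x = 0"
  shows "rip S' f g = rip S f g" "rip S' g f = rip S g f"
  unfolding rip_def by (rule sum.mono_neutral_right; use assms in auto)+

text \<open>Each tilted test lives on the register vectors of its own message pair. Vanishing
  outside that support makes it an effect on the common space where all tests are applied in
  sequence.\<close>

lemma effect_superset:
  assumes S: "finite S'" "S \<subseteq> S'" and T: "effect S T" and z: "\<And>f x. x \<notin> S \<Longrightarrow> T f x = 0"
  shows "effect S' T"
proof -
  note P = effect_posop[OF T]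
  have le: "rip S f f \<le> rip S' f f" for f
    unfolding rip_def using S by (intro sum_mono2) auto
  have e: "rip S' f (T g) = rip S f (T g)" "rip S' (T g) f = rip S (T g) f" for f g
    by (rule rip_superset[OF S z]; assumption)+
  show ?thesis
    unfolding effect_def posop_def symop_def e
    using posop_sym[OF P] posop_nonneg[OF P] posop_linop[OF P] order_trans[OF effect_le[OF T] le]
    by blast
qed

lemma seqv_local:
  assumes S: "finite S" and T: "\<And>i. i < k \<Longrightarrow> effect S (T i)" and fg: "\<And>x. x \<in> S \<Longrightarrow> f x = g x"
    and x: "x \<in> S"
  shows "seqv T k f x = seqv T k g x"
  using T x
proof (induction k arbitrary: x)
  case 0
  thus ?case using fg by simp
next
  case (Suc k)
  have eq: "seqv T k f y = seqv T k g y" if "y \<in> S" for y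
    using Suc.prems(1) that by (intro Suc.IH) auto
  have "T k (seqv T k f) x = T k (seqv T k g) x"
    by (rule posop_local[OF S effect_posop[OF Suc.prems(1)] eq Suc.prems(2)]) auto
  thus ?case by (simp only: seqv.simps minus_apply eq[OF Suc.prems(2)])
qed

text \<open>The inner difference is the weight lost at test \<open>k\<close>, that is, the weight
  with which test \<open>k\<close> is the first to accept.\<close>

definition seq_fail ::
  "'i set \<Rightarrow> (nat \<Rightarrow> ('i \<Rightarrow> complex) \<Rightarrow> 'i \<Rightarrow> complex) \<Rightarrow> nat \<Rightarrow> ('i \<Rightarrow> complex) \<Rightarrow> real" where
  "seq_fail S T k f = rip S f f
     - (rip S (seqv T k f) (seqv T k f) - rip S (seqv T (Suc k) f) (seqv T (Suc k) f))"

text \<open>\<open>seq_fail\<close> is a nonnegative quadratic form bounded by the squared norm, so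
  the parallelogram law applies. It pays for replacing the tilted register state by |0>.\<close>

lemma seq_fail_diff:
  assumes T: "\<And>i. i \<le> k \<Longrightarrow> effect S (T i)"
  shows "seq_fail S T k (f - g) \<le> 2 * seq_fail S T k f + 2 * rip S g g"
proof -
  have l: "linop (seqv T k)" "linop (seqv T (Suc k))"
    by (rule linop_seqv, rule posop_linop[OF effect_posop], rule T, simp)+
  have dec: "rip S (seqv T k f) (seqv T k f) \<le> rip S f f" for f
    using T by (intro seqv_decreasing) auto
  have "0 \<le> seq_fail S T k (f + g)"
    using dec[of "f + g"] rip_nonneg[of S "seqv T (Suc k) (f + g)"] unfolding seq_fail_def by linarith
  moreover have "seq_fail S T k g \<le> rip S g g"
    using seqv_drop[of S T k g, OF T] posop_nonneg[OF effect_posop[OF T], of k "seqv T k g"]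
    by (simp add: seq_fail_def del: seqv.simps)
  moreover have "seq_fail S T k (f + g) + seq_fail S T k (f - g) = 2 * seq_fail S T k f + 2 * seq_fail S T k g"
    unfolding seq_fail_def linop_add[OF l(1)] linop_add[OF l(2)] linop_diff[OF l(1)] linop_diff[OF l(2)]
    by (simp del: seqv.simps)
  ultimately show ?thesis by linarith
qed

definition mop :: "nat \<Rightarrow> complex mat \<Rightarrow> (nat \<Rightarrow> complex) \<Rightarrow> nat \<Rightarrow> complex" where
  "mop d M f = (\<lambda>i. \<Sum>j<d. M $$ (i,j) * f j)"

lemma rip_mop: "rip {..<d} f (mop d M g) = Re (\<Sum>i<d. \<Sum>j<d. cnj (f i) * M $$ (i,j) * g j)"
  by (simp add: rip_def mop_def sum_distrib_left mult.assoc)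

text \<open>Outcome \<open>k\<close> has the quadratic form \<open>|seqv T k f|\<^sup>2 - |seqv T (k + 1) f|\<^sup>2\<close>; what is left after all tests
  goes to outcome 0.\<close>

lemma sequential_povm:
  fixes T :: "nat \<Rightarrow> ('i \<Rightarrow> complex) \<Rightarrow> 'i \<Rightarrow> complex" and J :: "(nat \<Rightarrow> complex) \<Rightarrow> 'i \<Rightarrow> complex"
  assumes S: "finite S" and T: "\<And>k. k < K \<Longrightarrow> effect S (T k)" and K: "0 < K"
    and J: "linop J" "\<And>f g. rip S (J f) (J g) = rip {..<d} f g"
  obtains L where "\<And>k. k < K \<Longrightarrow> psd d (L k)" "msum d L {..<K} = 1\<^sub>m d"
    "\<And>k h. k < K \<Longrightarrow> rip {..<d} h h - rip {..<d} h (mop d (L k) h) \<le> seq_fail S T k (J h)"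
proof -
  \<comment> \<open>The matrix in the standard basis of the quadratic form \<open>R k\<close>,
    pulled back along \<open>J\<close>.\<close>
  define G where "G k a b = (\<Sum>x\<in>S. cnj (seqv T k (J (delta a)) x) * seqv T k (J (delta b)) x)" for k a b
  define R where "R k h = rip S (seqv T k (J h)) (seqv T k (J h))" for k h
  define L where "L k = mat d d (\<lambda>(a,b). G k a b - G (Suc k) a b + (if k = 0 then G K a b else 0))" for k
  have form: "(\<Sum>a<d. \<Sum>b<d. cnj (h a) * G k a b * h b) = complex_of_real (R k h)" if k: "k \<le> K" for k h
  proof -
    \<comment> \<open>Entries of \<open>h\<close> beyond \<open>d\<close> are cut off. As
      \<open>J\<close> is isometric for the inner product over \<open>{..<d}\<close>, the discarded
      part is mapped to zero on \<open>S\<close>.\<close>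
    define h' where "h' = (\<Sum>b<d. smul (h b) (delta b))"
    have h': "h' a = h a" if "a < d" for a
      using that by (simp add: h'_def sum_fun_apply fun_apply delta_def if_distrib cong: if_cong)
    have "rip S (J (h - h')) (J (h - h')) = rip {..<d} 0 0"
      unfolding J(2) by (rule rip_cong) (auto simp: fun_apply h')
    hence "J (h - h') x = 0" if "x \<in> S" for x
      using rip_self_eq_0[OF S _ that] by simp
    hence Jh: "J h x = J h' x" if "x \<in> S" for x
      using that by (simp add: linop_diff[OF J(1)] fun_apply)
    have lin: "linop (seqv T k)"
      using k by (intro linop_seqv posop_linop[OF effect_posop[OF T]]) auto
    define y where "y = seqv T k (J h)"
    have y: "y x = (\<Sum>b<d. h b * seqv T k (J (delta b)) x)" if x: "x \<in> S" for x
    proof -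
      have "y x = seqv T k (J h') x"
        unfolding y_def using k by (intro seqv_local[OF S T] Jh x) auto
      thus ?thesis
        by (simp add: h'_def linop_sum[OF J(1)] linop_smul[OF J(1)] linop_sum[OF lin] linop_smul[OF lin]
            sum_fun_apply fun_apply)
    qed
    have "complex_of_real (R k h) = (\<Sum>x\<in>S. cnj (y x) * y x)"
      unfolding R_def rip_def y_def[symmetric] of_real_sum by (intro sum.cong) (auto simp: complex_eq_iff)
    also have "\<dots> = (\<Sum>x\<in>S. \<Sum>a<d. \<Sum>b<d. cnj (h a) * (cnj (seqv T k (J (delta a)) x) * seqv T k (J (delta b)) x) * h b)"
    proof (intro sum.cong refl)
      fix x assume "x \<in> S"
      show "cnj (y x) * y x = (\<Sum>a<d. \<Sum>b<d. cnj (h a) * (cnj (seqv T k (J (delta a)) x) * seqv T k (J (delta b)) x) * h b)"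
        unfolding y[OF \<open>x \<in> S\<close>] cnj_sum complex_cnj_mult sum_product
        by (intro sum.cong refl) (simp add: algebra_simps)
    qed
    also have "\<dots> = (\<Sum>a<d. \<Sum>b<d. \<Sum>x\<in>S. cnj (h a) * (cnj (seqv T k (J (delta a)) x) * seqv T k (J (delta b)) x) * h b)"
      by (subst sum.swap, intro sum.cong refl, rule sum.swap)
    also have "\<dots> = (\<Sum>a<d. \<Sum>b<d. cnj (h a) * G k a b * h b)"
      by (simp add: G_def sum_distrib_left sum_distrib_right)
    finally show ?thesis ..
  qed
  have L: "(\<Sum>a<d. \<Sum>b<d. cnj (h a) * L k $$ (a,b) * h b)
      = complex_of_real (R k h - R (Suc k) h + (if k = 0 then R K h else 0))" if k: "k < K" for k h
  proof -
    have "(\<Sum>a<d. \<Sum>b<d. cnj (h a) * L k $$ (a,b) * h b)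
      = (\<Sum>a<d. \<Sum>b<d. cnj (h a) * G k a b * h b - cnj (h a) * G (Suc k) a b * h b
          + (if k = 0 then cnj (h a) * G K a b * h b else 0))"
      by (intro sum.cong refl) (auto simp: L_def algebra_simps)
    also have "\<dots> = (\<Sum>a<d. \<Sum>b<d. cnj (h a) * G k a b * h b) - (\<Sum>a<d. \<Sum>b<d. cnj (h a) * G (Suc k) a b * h b)
        + (if k = 0 then (\<Sum>a<d. \<Sum>b<d. cnj (h a) * G K a b * h b) else 0)"
      by (simp add: sum.distrib sum_subtractf)
    finally show ?thesis using k by (simp add: form)
  qed
  have dec: "R (Suc k) h \<le> R k h" if "k < K" for k h
    using seqv_drop[of S T k "J h", OF T[OF that]] posop_nonneg[OF effect_posop[OF T[OF that]], of "seqv T k (J h)"]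
    by (simp add: R_def del: seqv.simps)
  have G0: "G 0 a b = (if a = b then 1 else 0)" if ab: "a < d" "b < d" for a b
  proof -
    have "Re (G 0 a b) = rip {..<d} (delta a) (delta b)"
      unfolding J(2)[symmetric] by (simp add: G_def rip_def)
    moreover have "rip {..<d} (delta a) (delta b) = (\<Sum>i<d. if i = a then (if a = b then 1 else 0) else 0)"
      unfolding rip_def by (intro sum.cong) (auto simp: delta_def)
    ultimately have re: "Re (G 0 a b) = (if a = b then 1 else 0)" using ab by simp
    \<comment> \<open>\<open>J\<close> is known to preserve real parts only; multiplying one
      argument by the imaginary unit turns the imaginary part into a real part.\<close>
    have "Im (G 0 a b) = rip S (smul \<i> (J (delta a))) (J (delta b))"
      unfolding G_def rip_def Im_sum by (intro sum.cong refl) (simp add: smul_apply)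
    moreover have "rip S (smul \<i> (J (delta a))) (J (delta b)) = rip {..<d} (smul \<i> (delta a)) (delta b)"
      by (simp only: linop_smul[OF J(1), symmetric] J(2))
    moreover have "rip {..<d} (smul \<i> (delta a)) (delta b) = 0"
      unfolding rip_def by (intro sum.neutral ballI) (simp add: smul_apply delta_def)
    ultimately show ?thesis using re by (simp add: complex_eq_iff)
  qed
  have "psd d (L k)" if "k < K" for k
    unfolding psd_def L[OF that] using dec[OF that] by (auto simp: L_def R_def simp del: seqv.simps)
  moreover have "msum d L {..<K} = 1\<^sub>m d"
  proof (rule eq_matI)
    fix a b assume "a < dim_row (1\<^sub>m d :: complex mat)" "b < dim_col (1\<^sub>m d :: complex mat)"
    hence ab: "a < d" "b < d" by auto
    have "msum d L {..<K} $$ (a,b) = (\<Sum>k<K. G k a b - G (Suc k) a b + (if k = 0 then G K a b else 0))"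
      using ab by (simp add: msum_def L_def)
    also have "\<dots> = (\<Sum>k<K. G k a b - G (Suc k) a b) + G K a b"
      using K by (simp add: sum.distrib)
    also have "(\<Sum>k<K. G k a b - G (Suc k) a b) = G 0 a b - G K a b" by (rule sum_lessThan_telescope')
    finally show "msum d L {..<K} $$ (a,b) = 1\<^sub>m d $$ (a,b)" using ab G0[OF ab] by simp
  qed (auto simp: msum_def)
  moreover have "rip {..<d} h h - rip {..<d} h (mop d (L k) h) \<le> seq_fail S T k (J h)" if "k < K" for k h
    unfolding rip_mop L[OF that] using rip_nonneg[of S "seqv T K (J h)"]
    by (simp add: seq_fail_def J(2) R_def del: seqv.simps)
  ultimately show ?thesis using that[of L] by blast
qed

section \<open>Simultaneous decoder for two senders\<close>

text \<open>The register basis is indexed by \<open>(0,0)\<close>, by \<open>(1,m1)\<close> for first messages and by \<open>(2,m2)\<close> for second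
  messages. The index \<open>i = 0, 1, 2\<close> stands for: first message wrong, second message wrong, both wrong.\<close>

definition tilt_supp :: "nat \<Rightarrow> nat \<Rightarrow> (nat \<times> nat) set" where
  "tilt_supp m1 m2 = {(0,0), (1,m1), (2,m2)}"

definition tilt_v :: "real \<Rightarrow> nat \<Rightarrow> nat \<Rightarrow> nat \<times> nat \<Rightarrow> real" where
  "tilt_v s m1 m2 a = (if a = (0,0) then 1 else if a = (1,m1) \<or> a = (2,m2) then s else 0)"

definition tilt_w :: "real \<Rightarrow> nat \<Rightarrow> nat \<Rightarrow> nat \<Rightarrow> nat \<times> nat \<Rightarrow> real" where
  "tilt_w s m1 m2 i a =
     (if a = (0,0) then 1 else if i = 0 \<and> a = (2,m2) \<or> i = 1 \<and> a = (1,m1) then s else 0)"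

text \<open>The basis dual to \<open>tilt_w\<close> in the span of the three register vectors. Its
  entries of size \<open>1/s\<close> are the price for tilted vectors that are nearly
  parallel.\<close>

definition tilt_d :: "real \<Rightarrow> nat \<Rightarrow> nat \<Rightarrow> nat \<Rightarrow> nat \<times> nat \<Rightarrow> real" where
  "tilt_d s m1 m2 i a =
     (if i = 0 then (if a = (2,m2) then 1/s else 0)
      else if i = 1 then (if a = (1,m1) then 1/s else 0)
      else (if a = (0,0) then 1 else if a = (1,m1) \<or> a = (2,m2) then - 1/s else 0))"

lemma mac_tilted_test:
  fixes E :: "nat \<Rightarrow> ('j \<Rightarrow> complex) \<Rightarrow> 'j \<Rightarrow> complex"
  assumes D: "finite D" and E: "\<And>i. i < 3 \<Longrightarrow> effect D (E i)" and k: "0 < (k::real)" and s: "0 < s" "s \<le> 1"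
  shows "\<exists>T. effect (tilt_supp m1 m2 \<times> D) T \<and> (\<forall>f x. x \<notin> tilt_supp m1 m2 \<times> D \<longrightarrow> T f x = 0) \<and>
    (\<forall>i<3. \<forall>h. rip (tilt_supp m1 m2 \<times> D) (ten (tilt_w s m1 m2 i) h) (T (ten (tilt_w s m1 m2 i) h))
        \<le> 2 * (rip D h (E i h) + k * rip D h h)) \<and>
    (\<forall>h. rip (tilt_supp m1 m2 \<times> D) (ten (tilt_v s m1 m2) h) (ten (tilt_v s m1 m2) h)
         - rip (tilt_supp m1 m2 \<times> D) (ten (tilt_v s m1 m2) h) (T (ten (tilt_v s m1 m2) h))
        \<le> 16 / s\<^sup>2 * (\<Sum>i<3. rip D h h - rip D h (E i h)))"
proof -
  have "\<forall>i. \<exists>Q N. i < 3 \<longrightarrow> effect D Q \<and> posop D N \<and> (\<forall>f. \<forall>j\<in>D. N (Q f) j + Q f j = f j) \<and>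
     (\<forall>f. rip D f (Q f) \<le> rip D f (E i f) + k * rip D f f) \<and>
     (\<forall>f. rip D f f - rip D f (Q f) \<le> rip D f f - rip D f (E i f))"
    using regularise_effect[OF D E k] by metis
  then obtain Q N where Q: "\<And>i. i < 3 \<Longrightarrow> effect D (Q i)" and N: "\<And>i. i < 3 \<Longrightarrow> posop D (N i)"
    and NQ: "\<And>i f j. i < 3 \<Longrightarrow> j \<in> D \<Longrightarrow> N i (Q i f) j + Q i f j = f j"
    and Q1: "\<And>i f. i < 3 \<Longrightarrow> rip D f (Q i f) \<le> rip D f (E i f) + k * rip D f f"
    and Q2: "\<And>i f. i < 3 \<Longrightarrow> rip D f f - rip D f (Q i f) \<le> rip D f f - rip D f (E i f)"
    by metis
  define A where "A = tilt_supp m1 m2"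
  define w where "w = tilt_w s m1 m2"
  define d where "d = tilt_d s m1 m2"
  define v where "v = tilt_v s m1 m2"
  \<comment> \<open>The inner products of \<open>v\<close> with the \<open>w i\<close>, hence the
    coefficients of \<open>v\<close> in the dual basis. The bound 2 on the squared norms of the
    \<open>w i\<close> comes from \<open>1 + s\<^sup>2\<close>.\<close>
  define g where "g i = (if i < 2 then 1 + s\<^sup>2 else 1)" for i :: nat
  have A: "finite A" by (simp add: A_def tilt_supp_def)
  have sumA: "(\<Sum>a\<in>A. F a) = F (0,0) + F (1,m1) + F (2,m2)" for F :: "nat \<times> nat \<Rightarrow> real"
    by (simp add: A_def tilt_supp_def)
  have i3: "i = 0 \<or> i = 1 \<or> i = 2" if "i < 3" for i :: nat using that by linarith
  have s2: "s\<^sup>2 \<le> 1" "0 < s\<^sup>2" using s by (auto simp: power_le_one)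
  have w2: "(\<Sum>a\<in>A. (w i a)\<^sup>2) \<le> 2" if "i \<in> {..<3}" for i
    using i3[of i] that s2 unfolding sumA by (auto simp: w_def tilt_w_def)
  have dual: "(\<Sum>a\<in>A. w j a * d i a) = (if i = j then 1 else 0)" if "i \<in> {..<3}" "j \<in> {..<3}" for i j
    using i3[of i] i3[of j] that s unfolding sumA by (auto simp: w_def d_def tilt_w_def tilt_d_def)
  have v: "v a = (\<Sum>i\<in>{..<3}. g i * d i a)" if "a \<in> A" for a
    using that s by (auto simp: A_def tilt_supp_def v_def tilt_v_def d_def tilt_d_def g_def numeral_3_eq_3
        field_simps power2_eq_square)
  obtain T where T: "effect (A \<times> D) T" "\<And>f x. x \<notin> A \<times> D \<Longrightarrow> T f x = 0"
    "\<And>i h. i \<in> {..<3} \<Longrightarrow> rip (A \<times> D) (ten (w i) h) (T (ten (w i) h)) \<le> 2 * rip D h (Q i h)"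
    "\<And>h. rip (A \<times> D) (ten v h) (ten v h) - rip (A \<times> D) (ten v h) (T (ten v h))
        \<le> (\<Sum>i\<in>{..<3}. (real (card {..<3::nat}) * (\<Sum>a\<in>A. (d i a)\<^sup>2) + 1) * (g i)\<^sup>2 * (rip D h h - rip D h (Q i h)))"
    by (rule tilted_test[where A = A and D = D and I = "{..<3::nat}" and Q = Q and N = N and w = w and d = d
          and n = 2 and v = v and g = g])
      (use A D Q N NQ w2 dual v in auto)
  \<comment> \<open>For \<open>i < 2\<close> this is
    \<open>(3/s\<^sup>2 + 1) * (1 + s\<^sup>2)\<^sup>2\<close>, at most \<open>4/s\<^sup>2\<close>
    times 4; for \<open>i = 2\<close> it is \<open>4 + 6/s\<^sup>2\<close>.\<close>
  have c: "(real (card {..<3::nat}) * (\<Sum>a\<in>A. (d i a)\<^sup>2) + 1) * (g i)\<^sup>2 \<le> 16 / s\<^sup>2" if "i < 3" for i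
  proof -
    have b: "1 \<le> 1 / s\<^sup>2" using s2 by simp
    have "(\<Sum>a\<in>A. (d i a)\<^sup>2) = (if i < 2 then 1 / s\<^sup>2 else 1 + 2 / s\<^sup>2)"
      using i3[OF that] unfolding sumA by (auto simp: d_def tilt_d_def power_divide)
    moreover have "(g i)\<^sup>2 \<le> 4" if "i < 2"
      using that s2 power_mono[of "1 + s\<^sup>2" 2 2] by (simp add: g_def)
    moreover have "(3 * (1/s\<^sup>2) + 1) * (g i)\<^sup>2 \<le> (4 * (1/s\<^sup>2)) * 4" if "i < 2"
      using b calculation(2)[OF that] by (intro mult_mono) auto
    ultimately show ?thesis using b by (auto simp: g_def)
  qed
  have right: "rip (A \<times> D) (ten v h) (ten v h) - rip (A \<times> D) (ten v h) (T (ten v h))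
     \<le> 16 / s\<^sup>2 * (\<Sum>i<3. rip D h h - rip D h (E i h))" for h
  proof -
    have "(\<Sum>i\<in>{..<3}. (real (card {..<3::nat}) * (\<Sum>a\<in>A. (d i a)\<^sup>2) + 1) * (g i)\<^sup>2 * (rip D h h - rip D h (Q i h)))
      \<le> (\<Sum>i<3. 16 / s\<^sup>2 * (rip D h h - rip D h (E i h)))"
      using Q Q2 c effect_le[OF Q] by (intro sum_mono mult_mono) auto
    thus ?thesis using T(4)[of h] by (simp add: sum_distrib_left)
  qed
  have wrong: "rip (A \<times> D) (ten (w i) h) (T (ten (w i) h)) \<le> 2 * (rip D h (E i h) + k * rip D h h)" if "i < 3" for i h
    using T(3)[of i h] Q1[of i h] that by simp
  show ?thesis
    using T(1,2) right wrong unfolding A_def[symmetric] w_def[symmetric] v_def[symmetric] by blast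
qed

text \<open>The factor 8 is the 4 of \<open>sequential_decoding_bound\<close> times the 2 of
  \<open>seq_fail_diff\<close>; the summand \<open>4 * s\<^sup>2\<close> is twice the squared norm
  \<open>2 * s\<^sup>2\<close> of the tilt. The bound holds for every vector \<open>h\<close>, which
  later allows summation over the Gram vectors of a state.\<close>

theorem mac_decoder:
  fixes E :: "nat \<Rightarrow> nat \<Rightarrow> nat \<Rightarrow> (nat \<Rightarrow> complex) \<Rightarrow> nat \<Rightarrow> complex"
  assumes E: "\<And>i m1 m2. i < 3 \<Longrightarrow> m1 < M1 \<Longrightarrow> m2 < M2 \<Longrightarrow> effect {..<d} (E i m1 m2)"
    and M: "0 < M1" "0 < M2" and k: "0 < (k::real)" and s: "0 < s" "s \<le> 1"
  shows "\<exists>L. (\<forall>m1<M1. \<forall>m2<M2. psd d (L m1 m2)) \<and>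
    msum d (\<lambda>(m1,m2). L m1 m2) ({..<M1} \<times> {..<M2}) = 1\<^sub>m d \<and>
    (\<forall>m1<M1. \<forall>m2<M2. \<forall>h. rip {..<d} h h - rip {..<d} h (mop d (L m1 m2) h) \<le>
       8 * ((\<Sum>m1'<M1. \<Sum>m2'<M2. if m1' = m1 \<and> m2' = m2 then 0 else
              2 * (rip {..<d} h (E (if m2' = m2 then 0 else if m1' = m1 then 1 else 2) m1' m2' h) + k * rip {..<d} h h))
            + 16 / s\<^sup>2 * (\<Sum>i<3. rip {..<d} h h - rip {..<d} h (E i m1 m2 h)))
       + 4 * s\<^sup>2 * rip {..<d} h h)"
proof -
  define D where "D = {..<d}"
  have D: "finite D" by (simp add: D_def)
  define S :: "((nat \<times> nat) \<times> nat) set" where "S = (insert (0,0) ({1} \<times> {..<M1} \<union> {2} \<times> {..<M2})) \<times> D"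
  have S: "finite S" by (simp add: S_def D)
  have E': "effect D (E i m1 m2)" if "i < 3" "m1 < M1" "m2 < M2" for i m1 m2
    unfolding D_def by (rule E[OF that])
  define good where "good m1 m2 T \<longleftrightarrow> effect (tilt_supp m1 m2 \<times> D) T \<and> (\<forall>f x. x \<notin> tilt_supp m1 m2 \<times> D \<longrightarrow> T f x = 0) \<and>
    (\<forall>i<3. \<forall>h. rip (tilt_supp m1 m2 \<times> D) (ten (tilt_w s m1 m2 i) h) (T (ten (tilt_w s m1 m2 i) h))
        \<le> 2 * (rip D h (E i m1 m2 h) + k * rip D h h)) \<and>
    (\<forall>h. rip (tilt_supp m1 m2 \<times> D) (ten (tilt_v s m1 m2) h) (ten (tilt_v s m1 m2) h)
         - rip (tilt_supp m1 m2 \<times> D) (ten (tilt_v s m1 m2) h) (T (ten (tilt_v s m1 m2) h))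
        \<le> 16 / s\<^sup>2 * (\<Sum>i<3. rip D h h - rip D h (E i m1 m2 h)))" for m1 m2 T
  have "\<exists>T. good m1 m2 T" if "m1 < M1" "m2 < M2" for m1 m2
    unfolding good_def by (rule mac_tilted_test[OF D E'[OF _ that] k s])
  then obtain T where good: "\<And>m1 m2. m1 < M1 \<Longrightarrow> m2 < M2 \<Longrightarrow> good m1 m2 (T m1 m2)" by metis
  have T: "\<And>m1 m2. m1 < M1 \<Longrightarrow> m2 < M2 \<Longrightarrow> effect (tilt_supp m1 m2 \<times> D) (T m1 m2)"
    and T0: "\<And>m1 m2 f x. m1 < M1 \<Longrightarrow> m2 < M2 \<Longrightarrow> x \<notin> tilt_supp m1 m2 \<times> D \<Longrightarrow> T m1 m2 f x = 0"
    and Tw: "\<And>m1 m2 i h. m1 < M1 \<Longrightarrow> m2 < M2 \<Longrightarrow> i < 3 \<Longrightarrow>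
      rip (tilt_supp m1 m2 \<times> D) (ten (tilt_w s m1 m2 i) h) (T m1 m2 (ten (tilt_w s m1 m2 i) h))
        \<le> 2 * (rip D h (E i m1 m2 h) + k * rip D h h)"
    and Tv: "\<And>m1 m2 h. m1 < M1 \<Longrightarrow> m2 < M2 \<Longrightarrow>
      rip (tilt_supp m1 m2 \<times> D) (ten (tilt_v s m1 m2) h) (ten (tilt_v s m1 m2) h)
         - rip (tilt_supp m1 m2 \<times> D) (ten (tilt_v s m1 m2) h) (T m1 m2 (ten (tilt_v s m1 m2) h))
        \<le> 16 / s\<^sup>2 * (\<Sum>i<3. rip D h h - rip D h (E i m1 m2 h))"
    using good unfolding good_def by blast+
  have sub: "tilt_supp m1 m2 \<times> D \<subseteq> S" if "m1 < M1" "m2 < M2" for m1 m2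
    using that by (auto simp: tilt_supp_def S_def)
  have TS: "effect S (T m1 m2)" if "m1 < M1" "m2 < M2" for m1 m2
    by (rule effect_superset[OF S sub[OF that] T[OF that] T0[OF that]])
  have ripT: "rip S f (T m1 m2 g) = rip (tilt_supp m1 m2 \<times> D) f (T m1 m2 g)" if "m1 < M1" "m2 < M2" for m1 m2 f g
    by (rule rip_superset(1)[OF S sub[OF that] T0[OF that]])
  define K where "K = M1 * M2"
  define Tk where "Tk j = T (j div M2) (j mod M2)" for j
  have ix: "j div M2 < M1" "j mod M2 < M2" if "j < K" for j
    using that M(2) by (auto simp: K_def less_mult_imp_div_less)
  have eff: "effect S (Tk j)" if "j < K" for j
    unfolding Tk_def by (rule TS[OF ix[OF that]])
  define e0 :: "nat \<times> nat \<Rightarrow> real" where "e0 a = (if a = (0,0) then 1 else 0)" for a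
  have e0_sum: "(\<Sum>a\<in>insert (0,0) ({1} \<times> {..<M1} \<union> {2} \<times> {..<M2}). e0 a * e0 a) = 1"
  proof -
    have "(\<Sum>a\<in>insert (0,0) ({1} \<times> {..<M1} \<union> {2} \<times> {..<M2}). e0 a * e0 a) = (\<Sum>a\<in>{(0,0)}. e0 a * e0 a)"
      by (intro sum.mono_neutral_right) (auto simp: e0_def)
    thus ?thesis by (simp add: e0_def)
  qed
  have iso: "rip S (ten e0 f) (ten e0 g) = rip {..<d} f g" for f g
    unfolding S_def rip_ten_ten e0_sum D_def by simp
  have K: "0 < K" using M by (simp add: K_def)
  obtain L where L: "\<And>j. j < K \<Longrightarrow> psd d (L j)" "msum d L {..<K} = 1\<^sub>m d"
    "\<And>j h. j < K \<Longrightarrow> rip {..<d} h h - rip {..<d} h (mop d (L j) h) \<le> seq_fail S Tk j (ten e0 h)"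
    by (rule sequential_povm[where S = S and T = Tk and K = K and J = "ten e0" and d = d, OF S eff K linop_ten iso])
      (assumption, rule that)
  define Lm where "Lm m1 m2 = L (m1 * M2 + m2)" for m1 m2
  have jK: "m1 * M2 + m2 < K" if "m1 < M1" "m2 < M2" for m1 m2
    using mult_index_less[OF that] by (simp add: K_def)
  have "msum d (\<lambda>(m1,m2). Lm m1 m2) ({..<M1} \<times> {..<M2}) = msum d L {..<K}"
  proof -
    have "(\<Sum>p\<in>{..<M1}\<times>{..<M2}. (case p of (m1,m2) \<Rightarrow> Lm m1 m2) $$ ij) = (\<Sum>j<K. L j $$ ij)" for ij
      unfolding K_def sum_mult_index by (simp add: Lm_def sum.cartesian_product case_prod_unfold)
    thus ?thesis by (simp add: msum_def)
  qed
  moreover have "rip D h h - rip D h (mop d (Lm m1 m2) h) \<le>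
       8 * ((\<Sum>m1'<M1. \<Sum>m2'<M2. if m1' = m1 \<and> m2' = m2 then 0 else
              2 * (rip D h (E (if m2' = m2 then 0 else if m1' = m1 then 1 else 2) m1' m2' h) + k * rip D h h))
            + 16 / s\<^sup>2 * (\<Sum>i<3. rip D h h - rip D h (E i m1 m2 h)))
       + 4 * s\<^sup>2 * rip D h h" if m: "m1 < M1" "m2 < M2" for m1 m2 h
  proof -
    define j where "j = m1 * M2 + m2"
    have j: "j < K" "j div M2 = m1" "j mod M2 = m2" using jK[OF m] m by (auto simp: j_def)
    define v where "v = tilt_v s m1 m2"
    define x where "x = ten v h"
    \<comment> \<open>The tilt: what separates the analysed vector \<open>x\<close> from the vector
      \<open>ten e0 h\<close> on which the decoder really acts.\<close>
    define y where "y = ten (\<lambda>a. v a - e0 a) h"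
    have "ten e0 h = x - y"
      by (auto simp: fun_eq_iff fun_apply x_def y_def ten_def algebra_simps)
    moreover have "rip S y y = 2 * s\<^sup>2 * rip D h h"
    proof -
      have y0: "y z = 0" if "z \<notin> tilt_supp m1 m2 \<times> D" "snd z \<in> D" for z
        using that by (cases z) (auto simp: y_def ten_def v_def tilt_v_def e0_def tilt_supp_def split: if_splits)
      have "y z = 0" if z: "z \<in> S - tilt_supp m1 m2 \<times> D" for z
      proof -
        have "snd z \<in> D" using z by (auto simp: S_def)
        with z show ?thesis by (intro y0) auto
      qed
      hence "rip S y y = rip (tilt_supp m1 m2 \<times> D) y y"
        unfolding rip_def by (intro sum.mono_neutral_right S sub[OF m]) simp
      thus ?thesis
        by (simp add: y_def rip_ten_ten tilt_supp_def v_def tilt_v_def e0_def power2_eq_square)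
    qed
    ultimately have 1: "seq_fail S Tk j (ten e0 h) \<le> 2 * seq_fail S Tk j x + 4 * s\<^sup>2 * rip D h h"
      using seq_fail_diff[of j S Tk x y] eff j(1) by simp
    have 2: "seq_fail S Tk j x \<le> 4 * ((\<Sum>i<j. rip S x (Tk i x)) + (rip S x x - rip S x (Tk j x)))"
      unfolding seq_fail_def using eff j(1) by (intro sequential_decoding_bound) auto
    have x0: "x z = 0" if "z \<notin> tilt_supp m1 m2 \<times> D" "snd z \<in> D" for z
      using that by (cases z) (auto simp: x_def ten_def v_def tilt_v_def tilt_supp_def split: if_splits)
    have "x z = 0" if z: "z \<in> S - tilt_supp m1 m2 \<times> D" for z
    proof -
      have "snd z \<in> D" using z by (auto simp: S_def)
      with z show ?thesis by (intro x0) auto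
    qed
    hence "rip S x x = rip (tilt_supp m1 m2 \<times> D) x x"
      unfolding rip_def by (intro sum.mono_neutral_right S sub[OF m]) simp
    hence 3: "rip S x x - rip S x (Tk j x) \<le> 16 / s\<^sup>2 * (\<Sum>i<3. rip D h h - rip D h (E i m1 m2 h))"
      using Tv[OF m, of h] by (simp add: Tk_def j ripT[OF m] x_def v_def)
    have wrong: "rip S x (T m1' m2' x) \<le>
       2 * (rip D h (E (if m2' = m2 then 0 else if m1' = m1 then 1 else 2) m1' m2' h) + k * rip D h h)"
      if m': "m1' < M1" "m2' < M2" and ne: "\<not> (m1' = m1 \<and> m2' = m2)" for m1' m2'
    proof -
      define i :: nat where "i = (if m2' = m2 then 0 else if m1' = m1 then 1 else 2)"
      have i: "i < 3" by (simp add: i_def)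
      let ?S = "tilt_supp m1' m2' \<times> D" and ?w = "ten (tilt_w s m1' m2' i) h"
      \<comment> \<open>A wrong test sees only its own register vectors, and there the state tilted
        towards \<open>(m1, m2)\<close> agrees with one of the three vectors for which the test was
        built.\<close>
      have eq: "x z = ?w z" if "z \<in> ?S" for z
        using that ne by (auto simp: x_def v_def tilt_v_def tilt_w_def tilt_supp_def ten_def i_def)
      have fS: "finite ?S" using finite_subset[OF sub[OF m'] S] .
      have "rip S x (T m1' m2' x) = rip ?S x (T m1' m2' x)" by (rule ripT[OF m'])
      also have "\<dots> = rip ?S ?w (T m1' m2' ?w)"
        by (rule rip_cong[OF eq posop_local[OF fS effect_posop[OF T[OF m']] eq]])
      also have "\<dots> \<le> 2 * (rip D h (E i m1' m2' h) + k * rip D h h)" by (rule Tw[OF m' i])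
      finally show ?thesis unfolding i_def .
    qed
    \<comment> \<open>Only the tests applied before \<open>j\<close> can do harm. Adding the later
      ones, which contribute nonnegative terms, makes the bound independent of the order of the
      pairs.\<close>
    have "(\<Sum>i<j. rip S x (Tk i x)) \<le> (\<Sum>i<K. if i = j then 0 else rip S x (Tk i x))"
    proof -
      have "(\<Sum>i<j. rip S x (Tk i x)) = (\<Sum>i<j. if i = j then 0 else rip S x (Tk i x))"
        by (intro sum.cong) auto
      also have "\<dots> \<le> (\<Sum>i<K. if i = j then 0 else rip S x (Tk i x))"
        using j(1) eff by (intro sum_mono2) (auto intro: posop_nonneg effect_posop)
      finally show ?thesis .
    qed
    also have "\<dots> = (\<Sum>m1'<M1. \<Sum>m2'<M2. if m1' = m1 \<and> m2' = m2 then 0 else rip S x (T m1' m2' x))"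
      unfolding K_def sum_mult_index
    proof (intro sum.cong refl)
      fix m1' m2' assume "m1' \<in> {..<M1}" "m2' \<in> {..<M2}"
      hence dm: "(m1' * M2 + m2') div M2 = m1'" "(m1' * M2 + m2') mod M2 = m2'" by auto
      hence "(m1' * M2 + m2' = j) = (m1' = m1 \<and> m2' = m2)" using j by (auto simp: j_def)
      thus "(if m1' * M2 + m2' = j then 0 else rip S x (Tk (m1' * M2 + m2') x)) =
          (if m1' = m1 \<and> m2' = m2 then 0 else rip S x (T m1' m2' x))"
        unfolding Tk_def dm by simp
    qed
    also have "\<dots> \<le> (\<Sum>m1'<M1. \<Sum>m2'<M2. if m1' = m1 \<and> m2' = m2 then 0 else
              2 * (rip D h (E (if m2' = m2 then 0 else if m1' = m1 then 1 else 2) m1' m2' h) + k * rip D h h))"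
      (is "_ \<le> ?W")
    proof (intro sum_mono)
      fix m1' m2' assume "m1' \<in> {..<M1}" "m2' \<in> {..<M2}"
      hence m': "m1' < M1" "m2' < M2" by auto
      show "(if m1' = m1 \<and> m2' = m2 then 0 else rip S x (T m1' m2' x)) \<le> (if m1' = m1 \<and> m2' = m2 then 0 else
              2 * (rip D h (E (if m2' = m2 then 0 else if m1' = m1 then 1 else 2) m1' m2' h) + k * rip D h h))"
      proof (cases "m1' = m1 \<and> m2' = m2")
        case False
        show ?thesis unfolding if_not_P[OF False] by (rule wrong[OF m' False])
      qed simp
    qed
    finally have 4: "(\<Sum>i<j. rip S x (Tk i x)) \<le> ?W" .
    have 5: "rip D h h - rip D h (mop d (Lm m1 m2) h) \<le> seq_fail S Tk j (ten e0 h)"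
      using L(3)[OF j(1), of h] by (simp add: Lm_def j_def D_def)
    have arith: "a \<le> 8 * (W + Q) + c" if "a \<le> f" "f \<le> 2 * g + c" "g \<le> 4 * (p + q)" "q \<le> Q" "p \<le> W"
      for a f g c p q Q W :: real
      using that by (simp add: algebra_simps)
    show ?thesis by (rule arith[OF 5 1 2 3 4])
  qed
  moreover have "psd d (Lm m1 m2)" if "m1 < M1" "m2 < M2" for m1 m2
    unfolding Lm_def by (rule L(1)[OF jK[OF that]])
  ultimately show ?thesis unfolding D_def by (intro exI[of _ Lm] conjI allI impI) (simp_all only: L(2))
qed

section \<open>Matrices as operators\<close>

lemma linop_mop: "linop (mop d M)"
  by (auto simp: linop_def mop_def fun_apply fun_eq_iff algebra_simps sum.distrib sum_distrib_left)

text \<open>\<open>psd\<close> speaks of the diagonal of the form only. Symmetry follows by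
  polarisation, because the form is also real at \<open>f + smul \<i> g\<close>.\<close>

lemma psd_posop:
  assumes "psd d M"
  shows "posop {..<d} (mop d M)"
proof -
  define b where "b f g = (\<Sum>i<d. \<Sum>j<d. cnj (f i) * M $$ (i,j) * g j)" for f g :: "nat \<Rightarrow> complex"
  have re: "rip {..<d} f (mop d M g) = Re (b f g)" for f g by (simp add: rip_mop b_def)
  have im: "Im (b f f) = 0" and pos: "0 \<le> Re (b f f)" for f using assms by (auto simp: psd_def b_def)
  have add: "b (f + g) (f + g) = b f f + b g g + b f g + b g f" for f g
    by (simp add: b_def fun_apply algebra_simps sum.distrib)
  have sm: "b f (smul \<i> g) = \<i> * b f g" "b (smul \<i> f) g = - \<i> * b f g" for f g
    by (simp_all add: b_def fun_apply sum_distrib_left sum_negf algebra_simps)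
  have "Re (b f g) = Re (b g f)" for f g
    using im[of "f + smul \<i> g"] im[of f] im[of "smul \<i> g"] unfolding add by (simp add: sm(1)[of f g] sm(2)[of g f])
  hence "symop {..<d} (mop d M)" by (simp add: symop_def re rip_sym[of _ "mop d M _"])
  thus ?thesis using pos linop_mop by (auto simp: posop_def re)
qed

lemma mop_one_minus:
  assumes "P \<in> carrier_mat d d"
  shows "rip {..<d} f (mop d (1\<^sub>m d - P) f) = rip {..<d} f f - rip {..<d} f (mop d P f)"
proof -
  have "mop d (1\<^sub>m d - P) f i = (f - mop d P f) i" if "i < d" for i
  proof -
    have "mop d (1\<^sub>m d - P) f i = (\<Sum>j<d. (if i = j then f j else 0) - P $$ (i,j) * f j)"
      unfolding mop_def using that assms by (intro sum.cong) (auto simp: algebra_simps)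
    thus ?thesis using that by (simp add: sum_subtractf mop_def fun_apply)
  qed
  hence "rip {..<d} f (mop d (1\<^sub>m d - P) f) = rip {..<d} f (f - mop d P f)"
    by (intro rip_cong) auto
  thus ?thesis by simp
qed

lemma povm_effect:
  assumes "povm_elem d P"
  shows "effect {..<d} (mop d P)"
proof -
  have P: "psd d P" "psd d (1\<^sub>m d - P)" "P \<in> carrier_mat d d" using assms by (auto simp: povm_elem_def psd_def)
  have "0 \<le> rip {..<d} f (mop d (1\<^sub>m d - P) f)" for f
    by (rule posop_nonneg[OF psd_posop[OF P(2)]])
  thus ?thesis using psd_posop[OF P(1)] by (auto simp: effect_def mop_one_minus[OF P(3)])
qed

section \<open>Gram decompositions of positive semidefinite matrices\<close>

text \<open>Cholesky elimination: split off a rank-one kernel that reproduces row and column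
  \<open>a\<close>, and apply the induction hypothesis to the Schur complement. The index set is an
  arbitrary finite set because one index disappears in each round.\<close>

lemma kernel_gram_decomposition:
  fixes K :: "'i \<Rightarrow> 'i \<Rightarrow> complex"
  assumes "finite S" and "\<And>i j. i \<in> S \<Longrightarrow> j \<in> S \<Longrightarrow> K j i = cnj (K i j)"
    and "\<And>v. 0 \<le> Re (\<Sum>i\<in>S. \<Sum>j\<in>S. cnj (v i) * K i j * v j)"
  shows "\<exists>r. \<forall>i\<in>S. \<forall>j\<in>S. K i j = (\<Sum>k\<in>S. r k i * cnj (r k j))"
  using assms
proof (induction S arbitrary: K rule: finite_induct)
  case (insert a S)
  have herm: "K j i = cnj (K i j)" if "i \<in> insert a S" "j \<in> insert a S" for i j
    using insert.prems(1) that by blast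
  have split: "(\<Sum>i\<in>insert a S. \<Sum>j\<in>insert a S. cnj (v i) * K i j * v j)
      = cnj (v a) * K a a * v a + (\<Sum>j\<in>S. cnj (v a) * K a j * v j) + (\<Sum>i\<in>S. cnj (v i) * K i a * v a)
        + (\<Sum>i\<in>S. \<Sum>j\<in>S. cnj (v i) * K i j * v j)" for v
    using insert.hyps by (simp add: sum.distrib algebra_simps)
  have q: "0 \<le> Re (cnj (v a) * K a a * v a) + 2 * Re (\<Sum>i\<in>S. cnj (v i) * K i a * v a)
        + Re (\<Sum>i\<in>S. \<Sum>j\<in>S. cnj (v i) * K i j * v j)" for v
  proof -
    define Y where "Y = (\<Sum>i\<in>S. cnj (v i) * K i a * v a)"
    have e: "(\<Sum>j\<in>S. cnj (v a) * K a j * v j) = cnj Y"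
      unfolding Y_def cnj_sum by (intro sum.cong refl) (simp add: herm[of _ a] algebra_simps)
    have "Re (cnj Y) = Re Y" by simp
    thus ?thesis using insert.prems(2)[of v] unfolding split e Y_def[symmetric] by (simp only: plus_complex.sel)
  qed
  have Kaa: "Im (K a a) = 0" using herm[of a a] by (simp add: complex_eq_iff)
  have Kaa0: "0 \<le> Re (K a a)"
    using q[of "delta a"] insert.hyps by (auto simp: delta_def sum.neutral)
  define t where "t = Re (K a a)"
  have Kt: "K a a = complex_of_real t" using Kaa by (simp add: t_def complex_eq_iff)
  define c where "c i = (if t = 0 then 0 else K i a / complex_of_real (sqrt t))" for i
  have cc: "t > 0 \<Longrightarrow> c i * cnj (c j) = K i a * cnj (K j a) / complex_of_real t" for i j
    by (simp add: c_def flip: of_real_mult)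
  have z: "K i a = 0" if t0: "t = 0" and i: "i \<in> S" for i
  proof (rule ccontr)
    assume nz: "K i a \<noteq> 0"
    define n where "n = (cmod (K i a))\<^sup>2"
    have n: "0 < n" using nz by (simp add: n_def)
    \<comment> \<open>Large enough to make the form negative: with a zero diagonal entry at
      \<open>a\<close>, its value at \<open>?v\<close> is \<open>Re (K i i) - 2 * x * n\<close>, and
      \<open>x * n\<close> exceeds the absolute value of \<open>Re (K i i)\<close>.\<close>
    define x where "x = (\<bar>Re (K i i)\<bar> + 1) / n"
    let ?v = "\<lambda>j. if j = a then - complex_of_real x * cnj (K i a) else if j = i then 1 else 0"
    have ai: "a \<noteq> i" using i insert.hyps by auto
    have nn: "complex_of_real n = K i a * cnj (K i a)"
      unfolding n_def by (rule complex_norm_square)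
    have vS: "?v j = (if j = i then 1 else 0)" if "j \<in> S" for j
      using that insert.hyps by auto
    have "(\<Sum>j\<in>S. cnj (?v j) * K j a * ?v a) = (\<Sum>j\<in>S. if j = i then K i a * ?v a else 0)"
      using insert.hyps by (intro sum.cong) auto
    also have "\<dots> = K i a * ?v a" using i insert.hyps by simp
    also have "\<dots> = - complex_of_real (x * n)"
      by (simp add: nn algebra_simps)
    finally have 1: "(\<Sum>j\<in>S. cnj (?v j) * K j a * ?v a) = - complex_of_real (x * n)" .
    have "(\<Sum>k\<in>S. \<Sum>j\<in>S. cnj (?v k) * K k j * ?v j) = (\<Sum>k\<in>S. \<Sum>j\<in>S. if j = i then (if k = i then K i i else 0) else 0)"
      by (intro sum.cong refl, simp only: vS) simp
    also have "\<dots> = K i i" using i insert.hyps by simp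
    finally have 2: "(\<Sum>k\<in>S. \<Sum>j\<in>S. cnj (?v k) * K k j * ?v j) = K i i" .
    have "0 \<le> Re (cnj (?v a) * K a a * ?v a) + 2 * Re (- complex_of_real (x * n)) + Re (K i i)"
      using q[of ?v] unfolding 1 2 .
    hence "0 \<le> - 2 * (x * n) + Re (K i i)" by (simp add: Kt t0)
    moreover have "x * n = \<bar>Re (K i i)\<bar> + 1" using n by (simp add: x_def)
    ultimately show False by linarith
  qed
  have ca: "K i a = c i * cnj (c a)" if "i \<in> insert a S" for i
  proof (cases "t = 0")
    case True
    thus ?thesis using that z Kt by (auto simp: c_def)
  next
    case False
    hence "t > 0" using Kaa0 t_def by simp
    from cc[OF this, of i a] False show ?thesis by (simp add: Kt)
  qed
  \<comment> \<open>The Schur complement of the entry at \<open>a\<close>. For \<open>t = 0\<close>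
    the column at \<open>a\<close> vanishes by \<open>z\<close>, so nothing is subtracted.\<close>
  define K' where "K' i j = K i j - c i * cnj (c j)" for i j
  have "\<exists>r. \<forall>i\<in>S. \<forall>j\<in>S. K' i j = (\<Sum>k\<in>S. r k i * cnj (r k j))"
  proof (rule insert.IH)
    show "K' j i = cnj (K' i j)" if "i \<in> S" "j \<in> S" for i j
      using herm[of i j] that by (simp add: K'_def)
    fix v :: "'i \<Rightarrow> complex"
    define y where "y = (\<Sum>j\<in>S. cnj (c j) * v j)"
    have yc: "(\<Sum>i\<in>S. cnj (v i) * c i) = cnj y" by (simp add: y_def algebra_simps)
    have cy: "(\<Sum>i\<in>S. \<Sum>j\<in>S. cnj (v i) * (c i * cnj (c j)) * v j) = cnj y * y"
    proof -
      have "cnj y * y = (\<Sum>i\<in>S. cnj (v i) * c i) * (\<Sum>j\<in>S. cnj (c j) * v j)"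
        by (simp only: yc y_def[symmetric])
      thus ?thesis unfolding sum_product by (simp add: algebra_simps)
    qed
    have K'y: "(\<Sum>i\<in>S. \<Sum>j\<in>S. cnj (v i) * K' i j * v j)
        = (\<Sum>i\<in>S. \<Sum>j\<in>S. cnj (v i) * K i j * v j) - cnj y * y"
      unfolding cy[symmetric] by (simp add: K'_def sum_subtractf algebra_simps)
    show "0 \<le> Re (\<Sum>i\<in>S. \<Sum>j\<in>S. cnj (v i) * K' i j * v j)"
    proof (cases "t = 0")
      case True
      hence y0: "y = 0" by (simp add: y_def c_def)
      define u where "u = v(a := 0)"
      have ua: "u a = 0" by (simp add: u_def)
      have "(\<Sum>i\<in>S. \<Sum>j\<in>S. cnj (u i) * K i j * u j) = (\<Sum>i\<in>S. \<Sum>j\<in>S. cnj (v i) * K i j * v j)"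
        using insert.hyps by (intro sum.cong refl) (auto simp: u_def)
      with q[of u] have "0 \<le> Re (\<Sum>i\<in>S. \<Sum>j\<in>S. cnj (v i) * K i j * v j)"
        unfolding ua by simp
      thus ?thesis unfolding K'y y0 by simp
    next
      case False
      hence t: "t > 0" using Kaa0 t_def by simp
      \<comment> \<open>The entry at \<open>a\<close> is the minimiser of the form when the other
        entries are those of \<open>v\<close>; the minimum is the form of \<open>K'\<close>.\<close>
      define u where "u = v(a := - y / complex_of_real (sqrt t))"
      have uS: "u i = v i" if "i \<in> S" for i using that insert.hyps by (auto simp: u_def)
      have st: "complex_of_real (sqrt t) * complex_of_real (sqrt t) = complex_of_real t"
        using t by (simp flip: of_real_mult)
      have "cnj (u a) * K a a * u a = cnj y * y"
        using t st by (simp add: u_def Kt field_simps)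
      moreover have "(\<Sum>i\<in>S. cnj (u i) * K i a * u a) = - (cnj y * y)"
      proof -
        have "(\<Sum>i\<in>S. cnj (u i) * K i a * u a) = (\<Sum>i\<in>S. cnj (v i) * c i * (- y))"
          using t insert.hyps by (intro sum.cong refl) (auto simp: c_def u_def)
        also have "\<dots> = (\<Sum>i\<in>S. cnj (v i) * c i) * (- y)" by (rule sum_distrib_right[symmetric])
        finally show ?thesis by (simp add: yc)
      qed
      moreover have "(\<Sum>i\<in>S. \<Sum>j\<in>S. cnj (u i) * K i j * u j) = (\<Sum>i\<in>S. \<Sum>j\<in>S. cnj (v i) * K i j * v j)"
        by (intro sum.cong refl) (simp add: uS)
      ultimately show ?thesis using q[of u] unfolding K'y by simp
    qed
  qed
  then obtain r where r: "\<And>i j. i \<in> S \<Longrightarrow> j \<in> S \<Longrightarrow> K' i j = (\<Sum>k\<in>S. r k i * cnj (r k j))" by blast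
  define r' where "r' k i = (if k = a then c i else if i = a then 0 else r k i)" for k i
  have "K i j = (\<Sum>k\<in>insert a S. r' k i * cnj (r' k j))" if ij: "i \<in> insert a S" "j \<in> insert a S" for i j
  proof -
    have "(\<Sum>k\<in>insert a S. r' k i * cnj (r' k j)) = c i * cnj (c j) + (\<Sum>k\<in>S. r' k i * cnj (r' k j))"
      using insert.hyps by (simp add: r'_def)
    also have "(\<Sum>k\<in>S. r' k i * cnj (r' k j)) = (if i = a \<or> j = a then 0 else (\<Sum>k\<in>S. r k i * cnj (r k j)))"
      using insert.hyps by (auto simp: r'_def intro!: sum.cong sum.neutral)
    also have "c i * cnj (c j) + \<dots> = K i j"
    proof (cases "i = a \<or> j = a")
      case True
      have "K a j = cnj (K j a)" using herm[of j a] ij by simp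
      thus ?thesis using True ca[of i] ca[of j] ij by auto
    next
      case False
      thus ?thesis using r[of i j, symmetric] ij by (auto simp: K'_def)
    qed
    finally show ?thesis ..
  qed
  thus ?case by blast
qed simp

lemma rip_delta_left: "i < d \<Longrightarrow> rip {..<d} (delta i) f = Re (f i)" for d :: nat
proof -
  assume "i < d"
  have "rip {..<d} (delta i) f = (\<Sum>j<d. if j = i then Re (f j) else 0)"
    unfolding rip_def by (intro sum.cong) (auto simp: delta_def)
  thus ?thesis using \<open>i < d\<close> by simp
qed

lemma mop_delta: "j < d \<Longrightarrow> mop d M (delta j) i = M $$ (i,j)"
proof -
  assume "j < d"
  have "mop d M (delta j) i = (\<Sum>k<d. if k = j then M $$ (i,k) else 0)"
    unfolding mop_def by (intro sum.cong) (auto simp: delta_def)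
  thus ?thesis using \<open>j < d\<close> by simp
qed

lemma psd_hermitian:
  assumes M: "psd d M" and ij: "i < d" "j < d"
  shows "M $$ (j,i) = cnj (M $$ (i,j))"
proof -
  note P = psd_posop[OF M]
  have "Re (M $$ (j,i)) = Re (M $$ (i,j))"
    using posop_sym[OF P, of "delta j" "delta i"] ij
    by (simp add: rip_delta_left mop_delta rip_sym[of _ "mop d M (delta j)"])
  moreover have "Im (M $$ (j,i)) = - Im (M $$ (i,j))"
  proof -
    have "rip {..<d} (delta j) (mop d M (smul \<i> (delta i))) = rip {..<d} (smul \<i> (delta i)) (mop d M (delta j))"
      using posop_sym[OF P, of "delta j" "smul \<i> (delta i)"] by (simp add: rip_sym)
    moreover have "rip {..<d} (delta j) (mop d M (smul \<i> (delta i))) = - Im (M $$ (j,i))"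
      using ij by (simp add: linop_smul[OF linop_mop] rip_delta_left mop_delta fun_apply)
    moreover have "rip {..<d} (smul \<i> (delta i)) g = Im (g i)" for g
    proof -
      have "rip {..<d} (smul \<i> (delta i)) g = (\<Sum>j<d. if j = i then Im (g j) else 0)"
        unfolding rip_def by (intro sum.cong) (auto simp: delta_def fun_apply)
      thus ?thesis using ij by simp
    qed
    ultimately show ?thesis using ij by (simp add: mop_delta)
  qed
  ultimately show ?thesis by (simp add: complex_eq_iff)
qed

text \<open>Stands in for the spectral theorem: a state is a sum of rank-one terms, whose vectors
  need be neither orthogonal nor normalised. With \<open>mtrace_gram\<close>, inequalities between
  quadratic forms become inequalities between traces.\<close>

lemma psd_gram:
  assumes M: "psd d M"
  obtains r where "\<And>i j. i < d \<Longrightarrow> j < d \<Longrightarrow> M $$ (i,j) = (\<Sum>k<d. r k i * cnj (r k j))"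
proof -
  have "\<exists>r. \<forall>i\<in>{..<d}. \<forall>j\<in>{..<d}. M $$ (i,j) = (\<Sum>k<d. r k i * cnj (r k j))"
  proof (rule kernel_gram_decomposition)
    show "M $$ (j,i) = cnj (M $$ (i,j))" if "i \<in> {..<d}" "j \<in> {..<d}" for i j
      using psd_hermitian[OF M] that by blast
    show "0 \<le> Re (\<Sum>i<d. \<Sum>j<d. cnj (v i) * M $$ (i,j) * v j)" for v
      using M unfolding psd_def by blast
  qed simp
  thus ?thesis using that by (meson lessThan_iff)
qed

lemma gram_psd:
  fixes r :: "'k \<Rightarrow> nat \<Rightarrow> complex"
  assumes M: "M \<in> carrier_mat d d"
    and r: "\<And>i j. i < d \<Longrightarrow> j < d \<Longrightarrow> M $$ (i,j) = (\<Sum>k\<in>K. r k i * cnj (r k j))"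
  shows "psd d M"
proof -
  have "(\<Sum>i<d. \<Sum>j<d. cnj (v i) * M $$ (i,j) * v j) = complex_of_real (\<Sum>k\<in>K. (cmod (\<Sum>j<d. cnj (r k j) * v j))\<^sup>2)" for v
  proof -
    have "(\<Sum>i<d. \<Sum>j<d. cnj (v i) * M $$ (i,j) * v j)
       = (\<Sum>i<d. \<Sum>j<d. \<Sum>k\<in>K. (cnj (v i) * r k i) * (cnj (r k j) * v j))"
      by (intro sum.cong refl) (simp add: r sum_distrib_left sum_distrib_right algebra_simps)
    also have "\<dots> = (\<Sum>i<d. \<Sum>k\<in>K. \<Sum>j<d. (cnj (v i) * r k i) * (cnj (r k j) * v j))"
      by (rule sum.cong[OF refl], rule sum.swap)
    also have "\<dots> = (\<Sum>k\<in>K. \<Sum>i<d. \<Sum>j<d. (cnj (v i) * r k i) * (cnj (r k j) * v j))"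
      by (rule sum.swap)
    also have "\<dots> = (\<Sum>k\<in>K. cnj (\<Sum>j<d. cnj (r k j) * v j) * (\<Sum>j<d. cnj (r k j) * v j))"
      unfolding sum_product cnj_sum by (simp add: algebra_simps)
    also have "\<dots> = (\<Sum>k\<in>K. complex_of_real ((cmod (\<Sum>j<d. cnj (r k j) * v j))\<^sup>2))"
      by (intro sum.cong refl) (simp only: complex_norm_square mult.commute)
    finally show ?thesis by (simp only: of_real_sum)
  qed
  thus ?thesis using M unfolding psd_def by (auto intro: sum_nonneg simp del: of_real_sum)
qed

lemma mtrace_mult:
  assumes "P \<in> carrier_mat d d" "R \<in> carrier_mat d d"
  shows "mtrace (P * R) = (\<Sum>i<d. \<Sum>j<d. P $$ (i,j) * R $$ (j,i))"
  using assms by (simp add: mtrace_def scalar_prod_def lessThan_atLeast0)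

lemma mtrace_gram:
  assumes P: "P \<in> carrier_mat d d" and R: "R \<in> carrier_mat d d"
    and r: "\<And>i j. i < d \<Longrightarrow> j < d \<Longrightarrow> R $$ (i,j) = (\<Sum>k<d. r k i * cnj (r k j))"
  shows "Re (mtrace (P * R)) = (\<Sum>k<d. rip {..<d} (r k) (mop d P (r k)))"
proof -
  have "mtrace (P * R) = (\<Sum>i<d. \<Sum>j<d. \<Sum>k<d. cnj (r k i) * P $$ (i,j) * r k j)"
    unfolding mtrace_mult[OF P R]
    by (intro sum.cong refl) (simp add: r sum_distrib_left algebra_simps)
  also have "\<dots> = (\<Sum>i<d. \<Sum>k<d. \<Sum>j<d. cnj (r k i) * P $$ (i,j) * r k j)"
    by (rule sum.cong[OF refl], rule sum.swap)
  also have "\<dots> = (\<Sum>k<d. \<Sum>i<d. \<Sum>j<d. cnj (r k i) * P $$ (i,j) * r k j)"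
    by (rule sum.swap)
  finally show ?thesis by (simp only: Re_sum[of _ "{..<d}"] rip_mop)
qed

section \<open>Kronecker products, channels and diagonal blocks\<close>

lemma index_div_mod: "z < d \<Longrightarrow> (b * d + z) div d = b" "z < d \<Longrightarrow> (b * d + z) mod d = z" for b d z :: nat
  by auto

lemma index_eq_iff: "z < d \<Longrightarrow> z' < d \<Longrightarrow> b * d + z = b' * d + z' \<longleftrightarrow> b = b' \<and> z = z'" for b d z :: nat
  by (metis index_div_mod)

lemma kron_index:
  assumes "A \<in> carrier_mat ra ca" "B \<in> carrier_mat rb cb" "i < ra" "j < ca" "k < rb" "l < cb"
  shows "kron A B $$ (i * rb + k, j * cb + l) = A $$ (i,j) * B $$ (k,l)"
  using assms mult_index_less[of i ra k rb] mult_index_less[of j ca l cb]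
  by (auto simp: kron_def index_div_mod)

lemma kron_carrier: "A \<in> carrier_mat ra ca \<Longrightarrow> B \<in> carrier_mat rb cb \<Longrightarrow> kron A B \<in> carrier_mat (ra * rb) (ca * cb)"
  by (auto simp: kron_def)

text \<open>Products of Gram vectors of the factors are Gram vectors of the Kronecker product, and
  the trace is multiplicative.\<close>

lemma density_kron:
  assumes A: "density a A" and B: "density b B"
  shows "density (a * b) (kron A B)"
proof -
  have pA: "psd a A" and pB: "psd b B" using A B by (auto simp: density_def)
  have cA: "A \<in> carrier_mat a a" and cB: "B \<in> carrier_mat b b" using pA pB by (auto simp: psd_def)
  obtain f where f: "\<And>i j. i < a \<Longrightarrow> j < a \<Longrightarrow> A $$ (i,j) = (\<Sum>k<a. f k i * cnj (f k j))"
    using psd_gram[OF pA] by blast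
  obtain g where g: "\<And>i j. i < b \<Longrightarrow> j < b \<Longrightarrow> B $$ (i,j) = (\<Sum>k<b. g k i * cnj (g k j))"
    using psd_gram[OF pB] by blast
  have "psd (a * b) (kron A B)"
  proof (rule gram_psd[OF kron_carrier[OF cA cB],
        where K = "{..<a} \<times> {..<b}" and r = "\<lambda>(k,l) i. f k (i div b) * g l (i mod b)"])
    fix i j assume ij: "i < a * b" "j < a * b"
    hence b0: "0 < b" by (cases b) auto
    have d: "i div b < a" "j div b < a" "i mod b < b" "j mod b < b"
      using ij b0 by (auto simp: less_mult_imp_div_less)
    have "kron A B $$ (i,j) = A $$ (i div b, j div b) * B $$ (i mod b, j mod b)"
      using ij cA cB by (auto simp: kron_def)
    thus "kron A B $$ (i,j) = (\<Sum>kl\<in>{..<a} \<times> {..<b}. (case kl of (k,l) \<Rightarrow> \<lambda>i. f k (i div b) * g l (i mod b)) i *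
        cnj ((case kl of (k,l) \<Rightarrow> \<lambda>i. f k (i div b) * g l (i mod b)) j))"
      using d by (simp add: f g sum_product sum.cartesian_product case_prod_unfold algebra_simps)
  qed
  moreover have "mtrace (kron A B) = mtrace A * mtrace B"
  proof -
    have "mtrace (kron A B) = (\<Sum>i<a*b. kron A B $$ (i,i))"
      using cA cB by (simp add: mtrace_def kron_def)
    also have "\<dots> = (\<Sum>x<a. \<Sum>y<b. A $$ (x,x) * B $$ (y,y))"
      unfolding sum_mult_index using cA cB by (intro sum.cong refl kron_index) auto
    also have "\<dots> = mtrace A * mtrace B"
      using cA cB by (simp add: mtrace_def sum_product)
    finally show ?thesis .
  qed
  ultimately show ?thesis using A B by (simp add: density_def)
qed

text \<open>Positivity is complete positivity with a one-dimensional ancilla.\<close>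

lemma channel_density:
  assumes C: "quantum_channel m n C" and A: "density m A"
  shows "density n (C A)"
proof -
  have cA: "A \<in> carrier_mat m m" and pA: "psd m A" and tA: "mtrace A = 1" using A by (auto simp: density_def psd_def)
  have CA: "C A \<in> carrier_mat n n" and t: "mtrace (C A) = mtrace A"
    using C cA unfolding quantum_channel_def by blast+
  have "\<forall>k M. psd (k * m) M \<longrightarrow> psd (k * n) (id_tensor k m n C M)"
    using C unfolding quantum_channel_def by blast
  hence "psd n (id_tensor 1 m n C A)" using pA by (metis mult_1)
  moreover have "id_tensor 1 m n C A = C A"
  proof (rule eq_matI)
    fix i j assume "i < dim_row (C A)" "j < dim_col (C A)"
    hence ij: "i < n" "j < n" using CA by auto
    have "mat m m (\<lambda>(k,l). A $$ (i div n * m + k, j div n * m + l)) = A"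
      using ij cA by (intro eq_matI) auto
    thus "id_tensor 1 m n C A $$ (i,j) = C A $$ (i,j)" using ij by (simp add: id_tensor_def)
  qed (use CA in \<open>auto simp: id_tensor_def\<close>)
  ultimately show ?thesis using t tA by (simp add: density_def)
qed

lemma sum_single_block:
  fixes f :: "nat \<Rightarrow> 'c :: comm_monoid_add"
  assumes b: "b < n" and f: "\<And>x z. x < n \<Longrightarrow> z < d \<Longrightarrow> x \<noteq> b \<Longrightarrow> f (x * d + z) = 0"
  shows "(\<Sum>i<n*d. f i) = (\<Sum>z<d. f (b * d + z))"
proof -
  have "(\<Sum>i<n*d. f i) = (\<Sum>x<n. if x = b then (\<Sum>z<d. f (b * d + z)) else 0)"
    unfolding sum_mult_index using f by (intro sum.cong refl) (auto intro: sum.neutral)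
  thus ?thesis using b by simp
qed

lemma psd_cblock:
  assumes M: "psd (n * d) M" and b: "b < n"
  shows "psd d (cblock d M b)"
proof -
  define e where "e v i = (if i div d = b then v (i mod d) else 0)" for v :: "nat \<Rightarrow> complex" and i
  have e: "e v (x * d + z) = (if x = b then v z else 0)" if "z < d" for v x z
    using that by (simp add: e_def index_div_mod)
  have form: "(\<Sum>i<n*d. \<Sum>j<n*d. cnj (e v i) * M $$ (i,j) * e v j)
      = (\<Sum>z<d. \<Sum>z'<d. cnj (v z) * cblock d M b $$ (z,z') * v z')" for v
  proof -
    have "(\<Sum>i<n*d. \<Sum>j<n*d. cnj (e v i) * M $$ (i,j) * e v j)
        = (\<Sum>z<d. \<Sum>j<n*d. cnj (e v (b*d+z)) * M $$ (b*d+z,j) * e v j)"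
      by (rule sum_single_block[OF b]) (simp add: e)
    also have "\<dots> = (\<Sum>z<d. \<Sum>z'<d. cnj (e v (b*d+z)) * M $$ (b*d+z,b*d+z') * e v (b*d+z'))"
      by (rule sum.cong[OF refl], rule sum_single_block[OF b]) (simp add: e)
    also have "\<dots> = (\<Sum>z<d. \<Sum>z'<d. cnj (v z) * cblock d M b $$ (z,z') * v z')"
      by (intro sum.cong refl) (simp add: e cblock_def)
    finally show ?thesis .
  qed
  have "cblock d M b \<in> carrier_mat d d" by (simp add: cblock_def)
  thus ?thesis using M unfolding psd_def form[symmetric] by blast
qed

lemma povm_cblock:
  assumes P: "povm_elem (n * d) P" and b: "b < n"
  shows "povm_elem d (cblock d P b)"
proof -
  have cP: "P \<in> carrier_mat (n*d) (n*d)" using P by (auto simp: povm_elem_def psd_def)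
  have "cblock d (1\<^sub>m (n*d) - P) b = 1\<^sub>m d - cblock d P b"
    using cP mult_index_less[OF b] by (intro eq_matI) (auto simp: cblock_def)
  thus ?thesis using psd_cblock[OF _ b] P unfolding povm_elem_def by metis
qed

section \<open>Traces of classical-quantum operators\<close>

lemma msum_index: "i < d \<Longrightarrow> j < d \<Longrightarrow> msum d f S $$ (i,j) = (\<Sum>s\<in>S. f s $$ (i,j))"
  by (simp add: msum_def)

lemma ket_proj_carrier: "ket_proj n k \<in> carrier_mat n n"
  by (simp add: ket_proj_def)

lemma ket_proj_index: "i < n \<Longrightarrow> j < n \<Longrightarrow> ket_proj n k $$ (i,j) = (if i = k \<and> j = k then 1 else 0)"
  by (simp add: ket_proj_def)

lemma ptrace_mid_carrier: "ptrace_mid a b c M \<in> carrier_mat (a * c) (a * c)"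
  by (simp add: ptrace_mid_def)

lemma ptrace_mid_index:
  assumes "i < a" "j < a" "k < c" "l < c"
  shows "ptrace_mid a b c M $$ (i * c + k, j * c + l) = (\<Sum>t<b. M $$ ((i * b + t) * c + k, (j * b + t) * c + l))"
  using assms by (simp add: ptrace_mid_def mult_index_less index_div_mod)

lemma ptrace_mid_index_left:
  "k < c \<Longrightarrow> l < c \<Longrightarrow> ptrace_mid 1 b c M $$ (k, l) = (\<Sum>t<b. M $$ (t * c + k, t * c + l))"
  using ptrace_mid_index[of 0 1 0 k c l b M] by simp

lemma ptrace_mid_index_right:
  "i < a \<Longrightarrow> j < a \<Longrightarrow> ptrace_mid a b 1 M $$ (i, j) = (\<Sum>t<b. M $$ (i * b + t, j * b + t))"
  using ptrace_mid_index[of i a j 0 1 0 b M] by simp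

lemma smult_sum_mtrace:
  assumes B: "B \<in> carrier_mat d d" and Y: "Y \<in> carrier_mat d d"
    and W: "\<And>s. s \<in> A \<Longrightarrow> W s \<in> carrier_mat d d"
    and e: "\<And>z z'. z < d \<Longrightarrow> z' < d \<Longrightarrow> Y $$ (z,z') = (\<Sum>s\<in>A. complex_of_real (c s) * W s $$ (z,z'))"
  shows "Re (mtrace (B * Y)) = (\<Sum>s\<in>A. c s * Re (mtrace (B * W s)))"
proof -
  have "mtrace (B * Y) = (\<Sum>i<d. \<Sum>j<d. \<Sum>s\<in>A. complex_of_real (c s) * (B $$ (i,j) * W s $$ (j,i)))"
    unfolding mtrace_mult[OF B Y] by (intro sum.cong refl) (simp add: e sum_distrib_left algebra_simps)
  also have "\<dots> = (\<Sum>i<d. \<Sum>s\<in>A. \<Sum>j<d. complex_of_real (c s) * (B $$ (i,j) * W s $$ (j,i)))"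
    by (rule sum.cong[OF refl], rule sum.swap)
  also have "\<dots> = (\<Sum>s\<in>A. \<Sum>i<d. \<Sum>j<d. complex_of_real (c s) * (B $$ (i,j) * W s $$ (j,i)))"
    by (rule sum.swap)
  also have "\<dots> = (\<Sum>s\<in>A. complex_of_real (c s) * mtrace (B * W s))"
    by (intro sum.cong refl) (simp add: mtrace_mult[OF B W] sum_distrib_left)
  finally show ?thesis by simp
qed

section \<open>The source state, its blocks and its conditional states\<close>

locale mac_source =
  fixes dX dY dZ nU nX nY :: nat
    and C :: "complex mat \<Rightarrow> complex mat"
    and \<sigma>X \<sigma>Y :: "nat \<Rightarrow> complex mat"
    and pU :: "nat \<Rightarrow> real" and pX pY :: "nat \<Rightarrow> nat \<Rightarrow> real"
  assumes chan: "quantum_channel (dX * dY) dZ C"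
    and sX: "\<And>x. x < nX \<Longrightarrow> density dX (\<sigma>X x)"
    and sY: "\<And>y. y < nY \<Longrightarrow> density dY (\<sigma>Y y)"
    and pU_nonneg: "\<And>u. u < nU \<Longrightarrow> pU u \<ge> 0" and pU_sum: "(\<Sum>u<nU. pU u) = 1"
    and pX_nonneg: "\<And>u x. u < nU \<Longrightarrow> x < nX \<Longrightarrow> pX u x \<ge> 0"
    and pX_sum: "\<And>u. u < nU \<Longrightarrow> (\<Sum>x<nX. pX u x) = 1"
    and pY_nonneg: "\<And>u y. u < nU \<Longrightarrow> y < nY \<Longrightarrow> pY u y \<ge> 0"
    and pY_sum: "\<And>u. u < nU \<Longrightarrow> (\<Sum>y<nY. pY u y) = 1"
begin

definition out :: "nat \<Rightarrow> nat \<Rightarrow> complex mat" where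
  "out x y = C (kron (\<sigma>X x) (\<sigma>Y y))"

definition rho :: "complex mat" where
  "rho = rhoUXYZ nU nX nY dZ pU pX pY \<sigma>X \<sigma>Y C"

definition lab :: "nat \<Rightarrow> nat \<Rightarrow> nat \<Rightarrow> nat" where
  "lab u x y = (u * nX + x) * nY + y"

text \<open>The probability that the block of the test with label \<open>(u, x, y)\<close> accepts
  the output for inputs \<open>(x', y')\<close>: correct acceptance when the inputs agree with the
  label, otherwise confusion of codewords.\<close>

definition acc :: "complex mat \<Rightarrow> nat \<Rightarrow> nat \<Rightarrow> nat \<Rightarrow> nat \<Rightarrow> nat \<Rightarrow> real" where
  "acc P u x y x' y' = Re (mtrace (cblock dZ P (lab u x y) * out x' y'))"

lemma out_density: "x < nX \<Longrightarrow> y < nY \<Longrightarrow> density dZ (out x y)"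
  unfolding out_def by (rule channel_density[OF chan density_kron[OF sX sY]])

lemma out_carrier: "x < nX \<Longrightarrow> y < nY \<Longrightarrow> out x y \<in> carrier_mat dZ dZ"
  using out_density by (auto simp: density_def psd_def)

lemma out_trace: "x < nX \<Longrightarrow> y < nY \<Longrightarrow> (\<Sum>z<dZ. out x y $$ (z,z)) = 1"
  using out_density[of x y] out_carrier[of x y] by (auto simp: density_def mtrace_def)

lemma lab_less: "u < nU \<Longrightarrow> x < nX \<Longrightarrow> y < nY \<Longrightarrow> lab u x y < nU * nX * nY"
  unfolding lab_def by (intro mult_index_less)

lemma lab_eq_iff:
  "x < nX \<Longrightarrow> y < nY \<Longrightarrow> x' < nX \<Longrightarrow> y' < nY \<Longrightarrow> lab u x y = lab u' x' y' \<longleftrightarrow> u = u' \<and> x = x' \<and> y = y'"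
  by (simp add: lab_def index_eq_iff)

lemma lab_surj:
  assumes "b < nU * nX * nY"
  obtains u x y where "u < nU" "x < nX" "y < nY" "b = lab u x y"
proof -
  have 1: "b div nY < nU * nX" "nY > 0" using assms by (auto simp: less_mult_imp_div_less intro: gr0I)
  hence "b div nY div nX < nU" "nX > 0" by (auto simp: less_mult_imp_div_less intro: gr0I)
  thus ?thesis using 1 that[of "b div nY div nX" "b div nY mod nX" "b mod nY"] by (simp add: lab_def)
qed

text \<open>Against an operator that is block diagonal in the labels, only the diagonal blocks of
  \<open>P\<close> count. The set \<open>A\<close> allows each block to be a mixture: a single
  output for \<open>rho\<close>, an average over fresh codeword symbols for the reference
  operators.\<close>

lemma mtrace_cq:
  fixes A :: "'s set"
  assumes P: "P \<in> carrier_mat (nU*nX*nY*dZ) (nU*nX*nY*dZ)" and X: "X \<in> carrier_mat (nU*nX*nY*dZ) (nU*nX*nY*dZ)"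
    and W: "\<And>u x y s. u < nU \<Longrightarrow> x < nX \<Longrightarrow> y < nY \<Longrightarrow> s \<in> A \<Longrightarrow> W u x y s \<in> carrier_mat dZ dZ"
    and e: "\<And>u x y z u' x' y' z'. u < nU \<Longrightarrow> x < nX \<Longrightarrow> y < nY \<Longrightarrow> z < dZ \<Longrightarrow>
       u' < nU \<Longrightarrow> x' < nX \<Longrightarrow> y' < nY \<Longrightarrow> z' < dZ \<Longrightarrow>
       X $$ (lab u x y * dZ + z, lab u' x' y' * dZ + z') =
       (if u = u' \<and> x = x' \<and> y = y' then \<Sum>s\<in>A. complex_of_real (c u x y s) * W u x y s $$ (z,z') else 0)"
  shows "Re (mtrace (P * X)) = (\<Sum>u<nU. \<Sum>x<nX. \<Sum>y<nY. \<Sum>s\<in>A.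
     c u x y s * Re (mtrace (cblock dZ P (lab u x y) * W u x y s)))"
proof -
  have off: "X $$ (b' * dZ + z', b * dZ + z) = 0"
    if b: "b < nU*nX*nY" "b' < nU*nX*nY" "b' \<noteq> b" "z < dZ" "z' < dZ" for b b' z z'
  proof -
    obtain u x y where 1: "u < nU" "x < nX" "y < nY" "b = lab u x y" using lab_surj[OF b(1)] .
    obtain u' x' y' where 2: "u' < nU" "x' < nX" "y' < nY" "b' = lab u' x' y'" using lab_surj[OF b(2)] .
    show ?thesis using e[OF 2(1-3) b(5) 1(1-3) b(4)] b(3) 1(4) 2(4) by auto
  qed
  have "mtrace (P * X) = (\<Sum>b<nU*nX*nY. \<Sum>z<dZ. \<Sum>j<nU*nX*nY*dZ. P $$ (b*dZ+z,j) * X $$ (j,b*dZ+z))"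
    unfolding mtrace_mult[OF P X] by (rule sum_mult_index)
  also have "\<dots> = (\<Sum>b<nU*nX*nY. \<Sum>z<dZ. \<Sum>z'<dZ. P $$ (b*dZ+z,b*dZ+z') * X $$ (b*dZ+z',b*dZ+z))"
    by (rule sum.cong[OF refl], rule sum.cong[OF refl], rule sum_single_block) (auto simp: off)
  also have "\<dots> = (\<Sum>b<nU*nX*nY. mtrace (cblock dZ P b * cblock dZ X b))"
  proof (rule sum.cong[OF refl])
    fix b
    show "(\<Sum>z<dZ. \<Sum>z'<dZ. P $$ (b*dZ+z,b*dZ+z') * X $$ (b*dZ+z',b*dZ+z)) = mtrace (cblock dZ P b * cblock dZ X b)"
      by (subst mtrace_mult[of _ dZ]) (auto simp: cblock_def)
  qed
  also have "\<dots> = (\<Sum>u<nU. \<Sum>x<nX. \<Sum>y<nY. mtrace (cblock dZ P (lab u x y) * cblock dZ X (lab u x y)))"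
    unfolding sum_mult_index lab_def ..
  finally have "Re (mtrace (P * X)) = (\<Sum>u<nU. \<Sum>x<nX. \<Sum>y<nY. Re (mtrace (cblock dZ P (lab u x y) * cblock dZ X (lab u x y))))"
    by simp
  also have "\<dots> = (\<Sum>u<nU. \<Sum>x<nX. \<Sum>y<nY. \<Sum>s\<in>A. c u x y s * Re (mtrace (cblock dZ P (lab u x y) * W u x y s)))"
  proof (rule sum.cong[OF refl], rule sum.cong[OF refl], rule sum.cong[OF refl], rule smult_sum_mtrace)
    fix u x y assume "u \<in> {..<nU}" "x \<in> {..<nX}" "y \<in> {..<nY}"
    hence uxy: "u < nU" "x < nX" "y < nY" by auto
    show "W u x y s \<in> carrier_mat dZ dZ" if "s \<in> A" for s using W[OF uxy that] .
    show "cblock dZ X (lab u x y) $$ (z,z') = (\<Sum>s\<in>A. complex_of_real (c u x y s) * W u x y s $$ (z,z'))"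
      if "z < dZ" "z' < dZ" for z z'
      using e[OF uxy that(1) uxy that(2)] that by (simp add: cblock_def)
  qed (auto simp: cblock_def)
  finally show ?thesis .
qed

lemma rho_carrier: "rho \<in> carrier_mat (nU*nX*nY*dZ) (nU*nX*nY*dZ)"
  by (simp add: rho_def rhoUXYZ_def msum_def)

lemma rho_entry:
  assumes "u < nU" "x < nX" "y < nY" "z < dZ" "u' < nU" "x' < nX" "y' < nY" "z' < dZ"
  shows "rho $$ (lab u x y * dZ + z, lab u' x' y' * dZ + z') =
    (if u = u' \<and> x = x' \<and> y = y' then complex_of_real (pU u * pX u x * pY u y) * out x y $$ (z,z') else 0)"
proof -
  let ?N = "nU * nX * nY"
  let ?i = "lab u x y * dZ + z" and ?j = "lab u' x' y' * dZ + z'"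
  have ij: "?i < ?N * dZ" "?j < ?N * dZ" using assms by (auto intro!: mult_index_less lab_less)
  have "rho $$ (?i,?j) = (\<Sum>t\<in>{..<nU} \<times> {..<nX} \<times> {..<nY}. if t = (u,x,y) then
      (if u = u' \<and> x = x' \<and> y = y' then complex_of_real (pU u * pX u x * pY u y) * out x y $$ (z,z') else 0) else 0)"
    unfolding rho_def rhoUXYZ_def msum_index[OF ij]
  proof (rule sum.cong[OF refl])
    fix t assume "t \<in> {..<nU} \<times> {..<nX} \<times> {..<nY}"
    then obtain u0 x0 y0 where t: "t = (u0,x0,y0)" and b0: "u0 \<in> {..<nU}" "x0 \<in> {..<nX}" "y0 \<in> {..<nY}"
      by auto
    let ?K = "kron (ket_proj ?N (lab u0 x0 y0)) (out x0 y0)"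
    have W: "out x0 y0 \<in> carrier_mat dZ dZ" using b0 by (auto intro: out_carrier)
    have "?K \<in> carrier_mat (?N * dZ) (?N * dZ)" by (rule kron_carrier[OF ket_proj_carrier W])
    hence 1: "(complex_of_real (pU u0 * pX u0 x0 * pY u0 y0) \<cdot>\<^sub>m ?K) $$ (?i,?j)
        = complex_of_real (pU u0 * pX u0 x0 * pY u0 y0) * ?K $$ (?i,?j)" using ij by auto
    have 2: "?K $$ (?i,?j) = ket_proj ?N (lab u0 x0 y0) $$ (lab u x y, lab u' x' y') * out x0 y0 $$ (z,z')"
      using assms by (intro kron_index[OF ket_proj_carrier W] lab_less)
    have 3: "ket_proj ?N (lab u0 x0 y0) $$ (lab u x y, lab u' x' y') =
       (if (u0,x0,y0) = (u,x,y) \<and> u = u' \<and> x = x' \<and> y = y' then 1 else 0)"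
      using assms b0 by (auto simp: ket_proj_index lab_less lab_eq_iff)
    have "(case t of (u,x,y) \<Rightarrow> complex_of_real (pU u * pX u x * pY u y) \<cdot>\<^sub>m
          kron (ket_proj ?N ((u * nX + x) * nY + y)) (C (kron (\<sigma>X x) (\<sigma>Y y)))) $$ (?i,?j)
        = (complex_of_real (pU u0 * pX u0 x0 * pY u0 y0) \<cdot>\<^sub>m ?K) $$ (?i,?j)"
      by (simp only: t prod.case lab_def out_def)
    also have "\<dots> = (if t = (u,x,y) then (if u = u' \<and> x = x' \<and> y = y'
          then complex_of_real (pU u * pX u x * pY u y) * out x y $$ (z,z') else 0) else 0)"
    proof (cases "t = (u,x,y)")
      case True
      thus ?thesis unfolding 1 2 3 t by simp
    next
      case False
      thus ?thesis unfolding 1 2 3 t by (simp only: simp_thms if_False mult_zero_left mult_zero_right)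
    qed
    finally show "(case t of (u,x,y) \<Rightarrow> complex_of_real (pU u * pX u x * pY u y) \<cdot>\<^sub>m
          kron (ket_proj ?N ((u * nX + x) * nY + y)) (C (kron (\<sigma>X x) (\<sigma>Y y)))) $$ (?i,?j) =
       (if t = (u,x,y) then (if u = u' \<and> x = x' \<and> y = y'
          then complex_of_real (pU u * pX u x * pY u y) * out x y $$ (z,z') else 0) else 0)" .
  qed
  also have "\<dots> = (if u = u' \<and> x = x' \<and> y = y' then complex_of_real (pU u * pX u x * pY u y) * out x y $$ (z,z') else 0)"
    using assms by (subst sum.delta) auto
  finally show ?thesis .
qed

lemma mtrace_rho:
  assumes "P \<in> carrier_mat (nU*nX*nY*dZ) (nU*nX*nY*dZ)"
  shows "Re (mtrace (P * rho)) = (\<Sum>u<nU. \<Sum>x<nX. \<Sum>y<nY. pU u * pX u x * pY u y * acc P u x y x y)"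
  using mtrace_cq[OF assms rho_carrier, of "{()}" "\<lambda>u x y s. out x y" "\<lambda>u x y s. pU u * pX u x * pY u y"]
  by (simp add: rho_entry out_carrier acc_def)

lemma cprob_rho:
  assumes u: "u < nU" shows "cprob (nX*nY*dZ) rho u = pU u"
proof -
  have "mtrace (cblock (nX*nY*dZ) rho u) = (\<Sum>x<nX. \<Sum>y<nY. \<Sum>z<dZ. rho $$ (lab u x y * dZ + z, lab u x y * dZ + z))"
  proof -
    have i: "u * (nX*nY*dZ) + ((x*nY+y)*dZ+z) = lab u x y * dZ + z" for x y z by (simp add: lab_def algebra_simps)
    have "mtrace (cblock (nX*nY*dZ) rho u) = (\<Sum>j<nX*nY*dZ. rho $$ (u * (nX*nY*dZ) + j, u * (nX*nY*dZ) + j))"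
      by (simp add: mtrace_def cblock_def)
    thus ?thesis unfolding sum_mult_index i .
  qed
  also have "\<dots> = (\<Sum>x<nX. \<Sum>y<nY. complex_of_real (pU u * pX u x * pY u y))"
    using u by (intro sum.cong refl) (simp add: rho_entry sum_distrib_left[symmetric] out_trace)
  also have "\<dots> = complex_of_real (\<Sum>x<nX. pU u * pX u x * (\<Sum>y<nY. pY u y))"
    by (simp add: sum_distrib_left)
  also have "\<dots> = complex_of_real (pU u)"
    using pX_sum[OF u] pY_sum[OF u] by (simp add: sum_distrib_left[symmetric] del: of_real_sum)
  finally show ?thesis by (simp add: cprob_def)
qed

definition cnd :: "nat \<Rightarrow> complex mat" where "cnd u = ccond (nX*nY*dZ) rho u"

lemma cnd_entry:
  assumes "u < nU" "pU u \<noteq> 0" "x < nX" "y < nY" "z < dZ" "x' < nX" "y' < nY" "z' < dZ"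
  shows "cnd u $$ ((x*nY+y)*dZ+z, (x'*nY+y')*dZ+z') =
    (if x = x' \<and> y = y' then complex_of_real (pX u x * pY u y) * out x y $$ (z,z') else 0)"
proof -
  have b: "(x*nY+y)*dZ+z < nX*nY*dZ" "(x'*nY+y')*dZ+z' < nX*nY*dZ" using assms by (auto intro!: mult_index_less)
  have i: "u * (nX*nY*dZ) + ((x*nY+y)*dZ+z) = lab u x y * dZ + z" for x y z by (simp add: lab_def algebra_simps)
  have "cnd u $$ ((x*nY+y)*dZ+z, (x'*nY+y')*dZ+z')
      = complex_of_real (1 / pU u) * rho $$ (lab u x y * dZ + z, lab u x' y' * dZ + z')"
    unfolding cnd_def ccond_def cprob_rho[OF assms(1)] cblock_def using b by (simp add: i)
  thus ?thesis using assms by (simp add: rho_entry)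
qed

end

text \<open>\<open>DH\<close> is a supremum, so a test is extracted from a strict inequality; the
  constant 2 supplies the room between \<open>R + 1 + log 2 (1 / \<epsilon>)\<close> and
  \<open>DH\<close>. The logarithmic term becomes the factor \<open>\<epsilon>\<close> in the false
  acceptance bound.\<close>

lemma DH_test:
  assumes "ereal R \<le> DH d \<epsilon> \<alpha> \<beta> - ereal (2 + log 2 (1 / \<epsilon>))" and e: "0 < \<epsilon>"
  obtains P where "povm_elem d P" "Re (mtrace (P * \<alpha>)) \<ge> 1 - \<epsilon>" "Re (mtrace (P * \<beta>)) \<le> 2 powr (- R) * \<epsilon>"
proof -
  have "ereal (R + 1 + log 2 (1 / \<epsilon>)) < DH d \<epsilon> \<alpha> \<beta>"
    using assms(1) by (cases "DH d \<epsilon> \<alpha> \<beta>") auto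
  then obtain P where P: "povm_elem d P" "Re (mtrace (P * \<alpha>)) \<ge> 1 - \<epsilon>" and
    l: "ereal (R + 1 + log 2 (1 / \<epsilon>)) <
      (if Re (mtrace (P * \<beta>)) \<le> 0 then \<infinity> else ereal (- log 2 (Re (mtrace (P * \<beta>)))))"
    unfolding DH_def less_SUP_iff by auto
  have "Re (mtrace (P * \<beta>)) \<le> 2 powr (- R) * \<epsilon>"
  proof (cases "Re (mtrace (P * \<beta>)) \<le> 0")
    \<comment> \<open>This is the case in which \<open>DH\<close> assigns the value infinity to the
      test.\<close>
    case True
    also have "0 \<le> 2 powr (- R) * \<epsilon>" using e by simp
    finally show ?thesis .
  next
    case False
    have "log 2 (Re (mtrace (P * \<beta>))) < - R - 1 + log 2 \<epsilon>"
      using l False e by (simp add: log_divide)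
    also have "\<dots> \<le> - R + log 2 \<epsilon>" by simp
    also have "\<dots> = log 2 (2 powr (- R) * \<epsilon>)" using e by (simp add: log_mult)
    finally show ?thesis using False e by simp
  qed
  thus ?thesis using that P by blast
qed

section \<open>Marginals and entries of the three reference operators\<close>

context mac_source
begin

lemma sum_if_eq_const: "(\<Sum>t\<in>A. if b then f t else 0) = (if b then (\<Sum>t\<in>A. f t) else (0::complex))"
  by simp

lemma marg_X:
  assumes u: "u < nU" "pU u \<noteq> 0" and x: "x < nX" "x' < nX"
  shows "ptrace_mid nX (nY*dZ) 1 (cnd u) $$ (x, x') = (if x = x' then complex_of_real (pX u x) else 0)"
proof -
  have i: "x * (nY*dZ) + (y*dZ+z) = (x*nY+y)*dZ+z" for x y z by (simp add: algebra_simps)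
  have "ptrace_mid nX (nY*dZ) 1 (cnd u) $$ (x, x') = (\<Sum>y<nY. \<Sum>z<dZ. cnd u $$ ((x*nY+y)*dZ+z, (x'*nY+y)*dZ+z))"
    unfolding ptrace_mid_index_right[OF x] sum_mult_index i ..
  also have "\<dots> = (\<Sum>y<nY. if x = x' then complex_of_real (pX u x * pY u y) * (\<Sum>z<dZ. out x y $$ (z,z)) else 0)"
    using u x by (intro sum.cong refl) (simp add: cnd_entry sum_distrib_left)
  also have "\<dots> = (if x = x' then complex_of_real (pX u x * (\<Sum>y<nY. pY u y)) else 0)"
    using x by (simp add: out_trace sum_distrib_left)
  finally show ?thesis using pY_sum[OF u(1)] by simp
qed

lemma marg_YZ:
  assumes u: "u < nU" "pU u \<noteq> 0" and y: "y < nY" "z < dZ" "y' < nY" "z' < dZ"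
  shows "ptrace_mid 1 nX (nY*dZ) (cnd u) $$ (y*dZ+z, y'*dZ+z') =
    (if y = y' then (\<Sum>x<nX. complex_of_real (pX u x * pY u y) * out x y $$ (z,z')) else 0)"
proof -
  have i: "x * (nY*dZ) + (y*dZ+z) = (x*nY+y)*dZ+z" for x y z by (simp add: algebra_simps)
  have "ptrace_mid 1 nX (nY*dZ) (cnd u) $$ (y*dZ+z, y'*dZ+z') = (\<Sum>x<nX. cnd u $$ ((x*nY+y)*dZ+z, (x*nY+y')*dZ+z'))"
    using y by (subst ptrace_mid_index_left) (auto simp: mult_index_less i)
  also have "\<dots> = (\<Sum>x<nX. if y = y' then complex_of_real (pX u x * pY u y) * out x y $$ (z,z') else 0)"
    using u y by (intro sum.cong refl) (simp add: cnd_entry)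
  finally show ?thesis by (simp only: sum_if_eq_const)
qed

lemma marg_XZ:
  assumes u: "u < nU" "pU u \<noteq> 0" and x: "x < nX" "z < dZ" "x' < nX" "z' < dZ"
  shows "ptrace_mid nX nY dZ (cnd u) $$ (x*dZ+z, x'*dZ+z') =
    (if x = x' then (\<Sum>y<nY. complex_of_real (pX u x * pY u y) * out x y $$ (z,z')) else 0)"
proof -
  have "ptrace_mid nX nY dZ (cnd u) $$ (x*dZ+z, x'*dZ+z') = (\<Sum>y<nY. cnd u $$ ((x*nY+y)*dZ+z, (x'*nY+y)*dZ+z'))"
    using x by (intro ptrace_mid_index)
  also have "\<dots> = (\<Sum>y<nY. if x = x' then complex_of_real (pX u x * pY u y) * out x y $$ (z,z') else 0)"
    using u x by (intro sum.cong refl) (simp add: cnd_entry)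
  finally show ?thesis by (simp only: sum_if_eq_const)
qed

lemma marg_Y:
  assumes u: "u < nU" "pU u \<noteq> 0" and y: "y < nY" "y' < nY"
  shows "ptrace_mid nY dZ 1 (ptrace_mid 1 nX (nY*dZ) (cnd u)) $$ (y, y') = (if y = y' then complex_of_real (pY u y) else 0)"
proof -
  have "ptrace_mid nY dZ 1 (ptrace_mid 1 nX (nY*dZ) (cnd u)) $$ (y, y')
      = (\<Sum>z<dZ. if y = y' then (\<Sum>x<nX. complex_of_real (pX u x * pY u y) * out x y $$ (z,z)) else 0)"
    unfolding ptrace_mid_index_right[OF y] using u y by (intro sum.cong[OF refl] marg_YZ) auto
  also have "\<dots> = (if y = y' then (\<Sum>x<nX. \<Sum>z<dZ. complex_of_real (pX u x * pY u y) * out x y $$ (z,z)) else 0)"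
    unfolding sum_if_eq_const by (subst sum.swap) simp
  also have "\<dots> = (if y = y' then (\<Sum>x<nX. complex_of_real (pX u x * pY u y) * (\<Sum>z<dZ. out x y $$ (z,z))) else 0)"
    by (simp only: sum_distrib_left)
  also have "\<dots> = (if y = y' then complex_of_real ((\<Sum>x<nX. pX u x) * pY u y) else 0)"
    using y by (simp add: out_trace sum_distrib_right)
  finally show ?thesis using pX_sum[OF u(1)] by simp
qed

lemma marg_XY:
  assumes u: "u < nU" "pU u \<noteq> 0" and x: "x < nX" "y < nY" "x' < nX" "y' < nY"
  shows "ptrace_mid (nX*nY) dZ 1 (cnd u) $$ (x*nY+y, x'*nY+y') =
    (if x = x' \<and> y = y' then complex_of_real (pX u x * pY u y) else 0)"
proof -
  have "ptrace_mid (nX*nY) dZ 1 (cnd u) $$ (x*nY+y, x'*nY+y') = (\<Sum>z<dZ. cnd u $$ ((x*nY+y)*dZ+z, (x'*nY+y')*dZ+z))"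
    using x by (intro ptrace_mid_index_right mult_index_less)
  also have "\<dots> = (\<Sum>z<dZ. if x = x' \<and> y = y' then complex_of_real (pX u x * pY u y) * out x y $$ (z,z) else 0)"
    using u x by (intro sum.cong refl) (simp add: cnd_entry)
  also have "\<dots> = (if x = x' \<and> y = y' then complex_of_real (pX u x * pY u y) * (\<Sum>z<dZ. out x y $$ (z,z)) else 0)"
    unfolding sum_if_eq_const sum_distrib_left ..
  finally show ?thesis using x by (simp add: out_trace)
qed

lemma marg_Z:
  assumes u: "u < nU" "pU u \<noteq> 0" and z: "z < dZ" "z' < dZ"
  shows "ptrace_mid 1 (nX*nY) dZ (cnd u) $$ (z, z') =
    (\<Sum>x<nX. \<Sum>y<nY. complex_of_real (pX u x * pY u y) * out x y $$ (z,z'))"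
  unfolding ptrace_mid_index_left[OF z] sum_mult_index
  using u z by (intro sum.cong refl) (simp add: cnd_entry)

lemma smult_index: "K \<in> carrier_mat N N \<Longrightarrow> i < N \<Longrightarrow> j < N \<Longrightarrow> (c \<cdot>\<^sub>m K) $$ (i,j) = c * K $$ (i,j)"
  for K :: "complex mat"
  by auto

lemma ket_sum:
  assumes T: "\<And>u. u < nU \<Longrightarrow> T u \<in> carrier_mat R R" and b: "u < nU" "u' < nU" "k < R" "k' < R"
  shows "(\<Sum>v<nU. complex_of_real (cprob (nX*nY*dZ) rho v) * kron (ket_proj nU v) (T v) $$ (u*R+k, u'*R+k'))
    = (if u = u' then complex_of_real (pU u) * T u $$ (k,k') else 0)"
proof -
  have "(\<Sum>v<nU. complex_of_real (cprob (nX*nY*dZ) rho v) * kron (ket_proj nU v) (T v) $$ (u*R+k, u'*R+k'))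
    = (\<Sum>v<nU. if v = u then (if u = u' then complex_of_real (pU u) * T u $$ (k,k') else 0) else 0)"
  proof (rule sum.cong[OF refl])
    fix v assume v: "v \<in> {..<nU}"
    have "kron (ket_proj nU v) (T v) $$ (u*R+k, u'*R+k') = ket_proj nU v $$ (u,u') * T v $$ (k,k')"
      using v b by (intro kron_index[OF ket_proj_carrier T]) auto
    thus "complex_of_real (cprob (nX*nY*dZ) rho v) * kron (ket_proj nU v) (T v) $$ (u*R+k, u'*R+k')
      = (if v = u then (if u = u' then complex_of_real (pU u) * T u $$ (k,k') else 0) else 0)"
      using v b by (auto simp: cprob_rho ket_proj_index)
  qed
  thus ?thesis using b(1) by simp
qed

definition ref_X :: "complex mat" where
  "ref_X = msum (nU*(nX*nY*dZ)) (\<lambda>u. complex_of_real (cprob (nX*nY*dZ) rho u) \<cdot>\<^sub>m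
     kron (ket_proj nU u) (kron (ptrace_mid nX (nY*dZ) 1 (cnd u)) (ptrace_mid 1 nX (nY*dZ) (cnd u)))) {..<nU}"

definition ref_Y :: "complex mat" where
  "ref_Y = msum (nU*(nX*nY*dZ)) (\<lambda>u. complex_of_real (cprob (nX*nY*dZ) rho u) \<cdot>\<^sub>m
     swap_mid nU nY nX dZ (kron (ket_proj nU u)
       (kron (ptrace_mid nY dZ 1 (ptrace_mid 1 nX (nY*dZ) (cnd u))) (ptrace_mid nX nY dZ (cnd u))))) {..<nU}"

definition ref_XY :: "complex mat" where
  "ref_XY = msum (nU*(nX*nY*dZ)) (\<lambda>u. complex_of_real (cprob (nX*nY*dZ) rho u) \<cdot>\<^sub>m
     kron (ket_proj nU u) (kron (ptrace_mid (nX*nY) dZ 1 (cnd u)) (ptrace_mid 1 (nX*nY) dZ (cnd u)))) {..<nU}"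

lemma IH_eq:
  "IH_X_YZ nU nX nY dZ \<epsilon> rho = DH (nU*nX*nY*dZ) \<epsilon> rho ref_X"
  "IH_Y_XZ nU nX nY dZ \<epsilon> rho = DH (nU*nX*nY*dZ) \<epsilon> rho ref_Y"
  "IH_XY_Z nU nX nY dZ \<epsilon> rho = DH (nU*nX*nY*dZ) \<epsilon> rho ref_XY"
  by (simp_all only: IH_X_YZ_def IH_Y_XZ_def IH_XY_Z_def ref_X_def ref_Y_def ref_XY_def cnd_def Let_def mult.assoc)

lemma ref_carrier:
  "ref_X \<in> carrier_mat (nU*nX*nY*dZ) (nU*nX*nY*dZ)"
  "ref_Y \<in> carrier_mat (nU*nX*nY*dZ) (nU*nX*nY*dZ)"
  "ref_XY \<in> carrier_mat (nU*nX*nY*dZ) (nU*nX*nY*dZ)"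
  by (simp_all add: ref_X_def ref_Y_def ref_XY_def msum_def mult.assoc)

lemma lab_bound: "u < nU \<Longrightarrow> x < nX \<Longrightarrow> y < nY \<Longrightarrow> z < dZ \<Longrightarrow> lab u x y * dZ + z < nU*(nX*nY*dZ)"
  using mult_index_less[OF lab_less, of u x y z dZ] by (simp add: mult.assoc)

text \<open>The X marginal is diagonal with weights \<open>pX u x\<close>, while the YZ marginal
  averages over the symbol \<open>s\<close> that produced the output. The label \<open>x\<close> of
  the test and the actual input \<open>s\<close> are thus independent given \<open>u\<close>, just
  as two distinct codewords of a random code.\<close>

lemma ref_X_entry:
  assumes b: "u < nU" "x < nX" "y < nY" "z < dZ" "u' < nU" "x' < nX" "y' < nY" "z' < dZ"
  shows "ref_X $$ (lab u x y * dZ + z, lab u' x' y' * dZ + z') =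
    (if u = u' \<and> x = x' \<and> y = y'
     then \<Sum>s<nX. complex_of_real (pU u * pX u x * pY u y * pX u s) * out s y $$ (z,z') else 0)"
proof -
  define T where "T u = kron (ptrace_mid nX (nY*dZ) 1 (cnd u)) (ptrace_mid 1 nX (nY*dZ) (cnd u))" for u
  have cX: "ptrace_mid nX (nY*dZ) 1 (cnd u) \<in> carrier_mat nX nX"
    and cYZ: "ptrace_mid 1 nX (nY*dZ) (cnd u) \<in> carrier_mat (nY*dZ) (nY*dZ)" for u
    using ptrace_mid_carrier[of nX "nY*dZ" 1] ptrace_mid_carrier[of 1 nX "nY*dZ"] by auto
  have T: "T u \<in> carrier_mat (nX*(nY*dZ)) (nX*(nY*dZ))" for u
    unfolding T_def by (rule kron_carrier[OF cX cYZ])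
  have i: "lab u x y * dZ + z = u * (nX*(nY*dZ)) + (x * (nY*dZ) + (y*dZ+z))" for u x y z
    by (simp add: lab_def algebra_simps)
  have k: "x * (nY*dZ) + (y*dZ+z) < nX*(nY*dZ)" "x' * (nY*dZ) + (y'*dZ+z') < nX*(nY*dZ)"
    using b by (auto intro!: mult_index_less)
  have "ref_X $$ (lab u x y * dZ + z, lab u' x' y' * dZ + z') =
    (\<Sum>v<nU. complex_of_real (cprob (nX*nY*dZ) rho v) * kron (ket_proj nU v) (T v) $$ (lab u x y * dZ + z, lab u' x' y' * dZ + z'))"
    unfolding ref_X_def T_def[symmetric] msum_index[OF lab_bound[OF b(1-4)] lab_bound[OF b(5-8)]]
  proof (rule sum.cong[OF refl], rule smult_index[OF _ lab_bound[OF b(1-4)] lab_bound[OF b(5-8)]])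
    show "kron (ket_proj nU v) (T v) \<in> carrier_mat (nU*(nX*nY*dZ)) (nU*(nX*nY*dZ))" for v
      using kron_carrier[OF ket_proj_carrier T, of nU v v] by (simp only: mult.assoc)
  qed
  also have "\<dots> = (if u = u' then complex_of_real (pU u) * T u $$ (x * (nY*dZ) + (y*dZ+z), x' * (nY*dZ) + (y'*dZ+z')) else 0)"
    unfolding i using b k by (intro ket_sum T)
  also have "T u $$ (x * (nY*dZ) + (y*dZ+z), x' * (nY*dZ) + (y'*dZ+z'))
     = ptrace_mid nX (nY*dZ) 1 (cnd u) $$ (x,x') * ptrace_mid 1 nX (nY*dZ) (cnd u) $$ (y*dZ+z, y'*dZ+z')"
    unfolding T_def using b by (intro kron_index[OF cX cYZ] mult_index_less)
  finally have r: "ref_X $$ (lab u x y * dZ + z, lab u' x' y' * dZ + z') = (if u = u' then complex_of_real (pU u) *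
     (ptrace_mid nX (nY*dZ) 1 (cnd u) $$ (x,x') * ptrace_mid 1 nX (nY*dZ) (cnd u) $$ (y*dZ+z, y'*dZ+z')) else 0)" .
  show ?thesis
  \<comment> \<open>For \<open>pU u = 0\<close> the conditional state divides by zero and
    \<open>cnd_entry\<close> says nothing, but the weight in front cancels the whole term.\<close>
  proof (cases "pU u = 0")
    case True
    thus ?thesis unfolding r by (cases "u = u'") auto
  next
    case False
    show ?thesis
      unfolding r marg_X[OF b(1) False b(2,6)] marg_YZ[OF b(1) False b(3,4,7,8)]
      by (cases "u = u' \<and> x = x' \<and> y = y'") (auto simp: sum_distrib_left algebra_simps)
  qed
qed


lemma ref_XY_entry:
  assumes b: "u < nU" "x < nX" "y < nY" "z < dZ" "u' < nU" "x' < nX" "y' < nY" "z' < dZ"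
  shows "ref_XY $$ (lab u x y * dZ + z, lab u' x' y' * dZ + z') =
    (if u = u' \<and> x = x' \<and> y = y'
     then \<Sum>s\<in>{..<nX}\<times>{..<nY}. complex_of_real (pU u * pX u x * pY u y * (pX u (fst s) * pY u (snd s))) * out (fst s) (snd s) $$ (z,z')
     else 0)"
proof -
  define T where "T u = kron (ptrace_mid (nX*nY) dZ 1 (cnd u)) (ptrace_mid 1 (nX*nY) dZ (cnd u))" for u
  have cXY: "ptrace_mid (nX*nY) dZ 1 (cnd u) \<in> carrier_mat (nX*nY) (nX*nY)"
    and cZ: "ptrace_mid 1 (nX*nY) dZ (cnd u) \<in> carrier_mat dZ dZ" for u
    using ptrace_mid_carrier[of "nX*nY" dZ 1] ptrace_mid_carrier[of 1 "nX*nY" dZ] by auto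
  have T: "T u \<in> carrier_mat (nX*nY*dZ) (nX*nY*dZ)" for u
    unfolding T_def by (rule kron_carrier[OF cXY cZ])
  have i: "lab u x y * dZ + z = u * (nX*nY*dZ) + ((x*nY+y)*dZ+z)" for u x y z
    by (simp add: lab_def algebra_simps)
  have k: "(x*nY+y)*dZ+z < nX*nY*dZ" "(x'*nY+y')*dZ+z' < nX*nY*dZ"
    using b by (auto intro!: mult_index_less)
  have "ref_XY $$ (lab u x y * dZ + z, lab u' x' y' * dZ + z') =
    (\<Sum>v<nU. complex_of_real (cprob (nX*nY*dZ) rho v) * kron (ket_proj nU v) (T v) $$ (lab u x y * dZ + z, lab u' x' y' * dZ + z'))"
    unfolding ref_XY_def T_def[symmetric] msum_index[OF lab_bound[OF b(1-4)] lab_bound[OF b(5-8)]]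
    by (rule sum.cong[OF refl], rule smult_index[OF kron_carrier[OF ket_proj_carrier T] lab_bound[OF b(1-4)] lab_bound[OF b(5-8)]])
  also have "\<dots> = (if u = u' then complex_of_real (pU u) * T u $$ ((x*nY+y)*dZ+z, (x'*nY+y')*dZ+z') else 0)"
    unfolding i using b k by (intro ket_sum T)
  also have "T u $$ ((x*nY+y)*dZ+z, (x'*nY+y')*dZ+z')
     = ptrace_mid (nX*nY) dZ 1 (cnd u) $$ (x*nY+y,x'*nY+y') * ptrace_mid 1 (nX*nY) dZ (cnd u) $$ (z, z')"
    unfolding T_def using b by (intro kron_index[OF cXY cZ] mult_index_less)
  finally have r: "ref_XY $$ (lab u x y * dZ + z, lab u' x' y' * dZ + z') = (if u = u' then complex_of_real (pU u) *
     (ptrace_mid (nX*nY) dZ 1 (cnd u) $$ (x*nY+y,x'*nY+y') * ptrace_mid 1 (nX*nY) dZ (cnd u) $$ (z, z')) else 0)" .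
  show ?thesis
  proof (cases "pU u = 0")
    case True
    thus ?thesis unfolding r by (cases "u = u'") auto
  next
    case False
    show ?thesis
      unfolding r marg_XY[OF b(1) False b(2,3,6,7)] marg_Z[OF b(1) False b(4,8)]
      by (cases "u = u' \<and> x = x' \<and> y = y'")
        (auto simp: sum_distrib_left sum.cartesian_product case_prod_unfold algebra_simps)
  qed
qed

lemma ref_Y_entry:
  assumes b: "u < nU" "x < nX" "y < nY" "z < dZ" "u' < nU" "x' < nX" "y' < nY" "z' < dZ"
  shows "ref_Y $$ (lab u x y * dZ + z, lab u' x' y' * dZ + z') =
    (if u = u' \<and> x = x' \<and> y = y'
     then \<Sum>s<nY. complex_of_real (pU u * pX u x * pY u y * pY u s) * out x s $$ (z,z') else 0)"
proof -
  define T where "T u = kron (ptrace_mid nY dZ 1 (ptrace_mid 1 nX (nY*dZ) (cnd u))) (ptrace_mid nX nY dZ (cnd u))" for u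
  have cY: "ptrace_mid nY dZ 1 M \<in> carrier_mat nY nY" for M
    using ptrace_mid_carrier[of nY dZ 1] by auto
  have T: "T u \<in> carrier_mat (nY*(nX*dZ)) (nY*(nX*dZ))" for u
    unfolding T_def by (rule kron_carrier[OF cY ptrace_mid_carrier])
  \<comment> \<open>The position of \<open>(u, x, y, z)\<close> in the order U X Y Z goes to that of
    \<open>(u, y, x, z)\<close> in the order U Y X Z, where the Kronecker product can be read
    off.\<close>
  have sw: "swap_mid_idx nU nY nX dZ (lab u x y * dZ + z) = u * (nY*(nX*dZ)) + (y * (nX*dZ) + (x*dZ+z))"
    if "x < nX" "y < nY" "z < dZ" for u x y z
  proof -
    have "lab u x y * dZ + z = u * (nX*nY*dZ) + ((x*nY+y)*dZ+z)" by (simp add: lab_def algebra_simps)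
    moreover have "(x*nY+y)*dZ+z < nX*nY*dZ" using that by (auto intro!: mult_index_less)
    ultimately have 1: "(lab u x y * dZ + z) div (nX*nY*dZ) = u" by (simp only: index_div_mod)
    have "lab u x y * dZ + z = (u*nX+x) * (nY*dZ) + (y*dZ+z)" by (simp add: lab_def algebra_simps)
    moreover have "y*dZ+z < nY*dZ" using that by (auto intro!: mult_index_less)
    ultimately have 2: "(lab u x y * dZ + z) div (nY*dZ) mod nX = x" using that(1) by (simp only: index_div_mod)
    have 3: "(lab u x y * dZ + z) div dZ mod nY = y" "(lab u x y * dZ + z) mod dZ = z"
      using that by (simp_all only: index_div_mod lab_def)
    show ?thesis unfolding swap_mid_idx_def Let_def 1 2 3 by (simp add: algebra_simps)
  qed
  have k: "y * (nX*dZ) + (x*dZ+z) < nY*(nX*dZ)" "y' * (nX*dZ) + (x'*dZ+z') < nY*(nX*dZ)"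
    using b by (auto intro!: mult_index_less)
  have c: "swap_mid nU nY nX dZ M \<in> carrier_mat (nU*(nX*nY*dZ)) (nU*(nX*nY*dZ))" for M
    by (simp add: swap_mid_def mult.assoc)
  have si: "swap_mid nU nY nX dZ M $$ (lab u x y * dZ + z, lab u' x' y' * dZ + z') =
      M $$ (u * (nY*(nX*dZ)) + (y * (nX*dZ) + (x*dZ+z)), u' * (nY*(nX*dZ)) + (y' * (nX*dZ) + (x'*dZ+z')))" for M
    unfolding swap_mid_def using lab_bound[OF b(1-4)] lab_bound[OF b(5-8)] b by (simp add: sw mult.assoc)
  have "ref_Y $$ (lab u x y * dZ + z, lab u' x' y' * dZ + z') =
    (\<Sum>v<nU. complex_of_real (cprob (nX*nY*dZ) rho v) * kron (ket_proj nU v) (T v) $$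
       (u * (nY*(nX*dZ)) + (y * (nX*dZ) + (x*dZ+z)), u' * (nY*(nX*dZ)) + (y' * (nX*dZ) + (x'*dZ+z'))))"
    unfolding ref_Y_def T_def[symmetric] msum_index[OF lab_bound[OF b(1-4)] lab_bound[OF b(5-8)]] si[symmetric]
    by (rule sum.cong[OF refl], rule smult_index[OF c lab_bound[OF b(1-4)] lab_bound[OF b(5-8)]])
  also have "\<dots> = (if u = u' then complex_of_real (pU u) * T u $$ (y * (nX*dZ) + (x*dZ+z), y' * (nX*dZ) + (x'*dZ+z')) else 0)"
    using b k by (intro ket_sum T)
  also have "T u $$ (y * (nX*dZ) + (x*dZ+z), y' * (nX*dZ) + (x'*dZ+z'))
     = ptrace_mid nY dZ 1 (ptrace_mid 1 nX (nY*dZ) (cnd u)) $$ (y,y') * ptrace_mid nX nY dZ (cnd u) $$ (x*dZ+z, x'*dZ+z')"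
    unfolding T_def using b by (intro kron_index[OF cY ptrace_mid_carrier] mult_index_less)
  finally have r: "ref_Y $$ (lab u x y * dZ + z, lab u' x' y' * dZ + z') = (if u = u' then complex_of_real (pU u) *
     (ptrace_mid nY dZ 1 (ptrace_mid 1 nX (nY*dZ) (cnd u)) $$ (y,y') * ptrace_mid nX nY dZ (cnd u) $$ (x*dZ+z, x'*dZ+z')) else 0)" .
  show ?thesis
  proof (cases "pU u = 0")
    case True
    thus ?thesis unfolding r by (cases "u = u'") auto
  next
    case False
    show ?thesis
      unfolding r marg_Y[OF b(1) False b(3,7)] marg_XZ[OF b(1) False b(2,4,6,8)]
      by (cases "u = u' \<and> x = x' \<and> y = y'") (auto simp: sum_distrib_left algebra_simps)
  qed
qed

lemma mtrace_ref:
  assumes P: "P \<in> carrier_mat (nU*nX*nY*dZ) (nU*nX*nY*dZ)"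
  shows "Re (mtrace (P * ref_X)) = (\<Sum>u<nU. \<Sum>x<nX. \<Sum>y<nY. \<Sum>x'<nX. pU u * pX u x * pY u y * pX u x' * acc P u x y x' y)"
    and "Re (mtrace (P * ref_Y)) = (\<Sum>u<nU. \<Sum>x<nX. \<Sum>y<nY. \<Sum>y'<nY. pU u * pX u x * pY u y * pY u y' * acc P u x y x y')"
    and "Re (mtrace (P * ref_XY)) = (\<Sum>u<nU. \<Sum>x<nX. \<Sum>y<nY. \<Sum>x'<nX. \<Sum>y'<nY.
           pU u * pX u x * pY u y * (pX u x' * pY u y') * acc P u x y x' y')"
proof -
  show "Re (mtrace (P * ref_X)) = (\<Sum>u<nU. \<Sum>x<nX. \<Sum>y<nY. \<Sum>x'<nX. pU u * pX u x * pY u y * pX u x' * acc P u x y x' y)"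
    unfolding acc_def by (rule mtrace_cq[OF P ref_carrier(1)]) (auto intro: out_carrier simp: ref_X_entry)
  show "Re (mtrace (P * ref_Y)) = (\<Sum>u<nU. \<Sum>x<nX. \<Sum>y<nY. \<Sum>y'<nY. pU u * pX u x * pY u y * pY u y' * acc P u x y x y')"
    unfolding acc_def by (rule mtrace_cq[OF P ref_carrier(2)]) (auto intro: out_carrier simp: ref_Y_entry)
  have "Re (mtrace (P * ref_XY)) = (\<Sum>u<nU. \<Sum>x<nX. \<Sum>y<nY. \<Sum>s\<in>{..<nX}\<times>{..<nY}.
           pU u * pX u x * pY u y * (pX u (fst s) * pY u (snd s)) * Re (mtrace (cblock dZ P (lab u x y) * out (fst s) (snd s))))"
    by (rule mtrace_cq[OF P ref_carrier(3)]) (auto intro: out_carrier simp: ref_XY_entry)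
  thus "Re (mtrace (P * ref_XY)) = (\<Sum>u<nU. \<Sum>x<nX. \<Sum>y<nY. \<Sum>x'<nX. \<Sum>y'<nY.
           pU u * pX u x * pY u y * (pX u x' * pY u y') * acc P u x y x' y')"
    by (simp add: acc_def sum.cartesian_product case_prod_unfold)
qed

end

section \<open>Random coding\<close>

lemma exists_le_average:
  fixes w F :: "'a \<Rightarrow> real"
  assumes A: "finite A" and w: "\<And>a. a \<in> A \<Longrightarrow> 0 \<le> w a" "(\<Sum>a\<in>A. w a) = 1" and le: "(\<Sum>a\<in>A. w a * F a) \<le> \<eta>"
  shows "\<exists>a\<in>A. F a \<le> \<eta>"
proof (rule ccontr)
  assume "\<not> (\<exists>a\<in>A. F a \<le> \<eta>)"
  hence gt: "\<eta> < F a" if "a \<in> A" for a using that by auto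
  have "(\<Sum>a\<in>A. w a * (F a - \<eta>)) = (\<Sum>a\<in>A. w a * F a) - (\<Sum>a\<in>A. w a) * \<eta>"
    by (simp add: algebra_simps sum_subtractf sum_distrib_left)
  hence "(\<Sum>a\<in>A. w a * (F a - \<eta>)) \<le> 0" using le w(2) by simp
  moreover have nn: "0 \<le> w a * (F a - \<eta>)" if "a \<in> A" for a using gt[OF that] w(1)[OF that] by simp
  ultimately have "(\<Sum>a\<in>A. w a * (F a - \<eta>)) = 0" by (meson order_antisym sum_nonneg)
  hence "\<forall>a\<in>A. w a * (F a - \<eta>) = 0" using sum_nonneg_eq_0_iff[OF A, of "\<lambda>a. w a * (F a - \<eta>)"] nn by blast
  hence "\<forall>a\<in>A. w a = 0" using gt by fastforce
  thus False using w(2) by simp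
qed

definition codes :: "nat \<Rightarrow> nat \<Rightarrow> (nat \<Rightarrow> nat) set" where
  "codes M n = PiE {..<M} (\<lambda>_. {..<n})"

text \<open>The expectation over a codebook of \<open>M\<close> independent symbols with law
  \<open>p\<close>.\<close>

definition code_avg :: "(nat \<Rightarrow> real) \<Rightarrow> nat \<Rightarrow> nat \<Rightarrow> ((nat \<Rightarrow> nat) \<Rightarrow> real) \<Rightarrow> real" where
  "code_avg p n M G = (\<Sum>f\<in>codes M n. (\<Prod>m<M. p (f m)) * G f)"

lemma finite_codes: "finite (codes M n)"
  by (auto simp: codes_def intro: finite_PiE)

lemma codes_less: "f \<in> codes M n \<Longrightarrow> m < M \<Longrightarrow> f m < n"
  by (auto simp: codes_def PiE_def Pi_def)

text \<open>Independence of the symbols. Marginals of one or two symbols are derived from it by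
  taking most factors constant or by inserting indicators.\<close>

lemma code_avg_prod: "code_avg p n M (\<lambda>f. \<Prod>m<M. h m (f m)) = (\<Prod>m<M. \<Sum>z<n. p z * h m z)"
  unfolding code_avg_def codes_def by (subst prod_sum_PiE) (auto simp: prod.distrib)

lemma code_avg_add: "code_avg p n M (\<lambda>f. G f + H f) = code_avg p n M G + code_avg p n M H"
  by (simp add: code_avg_def algebra_simps sum.distrib)

lemma code_avg_cmult: "code_avg p n M (\<lambda>f. c * G f) = c * code_avg p n M G"
  by (simp add: code_avg_def sum_distrib_left algebra_simps)

lemma code_avg_sum: "code_avg p n M (\<lambda>f. \<Sum>i\<in>I. G i f) = (\<Sum>i\<in>I. code_avg p n M (G i))"
  unfolding code_avg_def by (subst sum.swap) (simp add: sum_distrib_left)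

lemma code_avg_cong: "(\<And>f. f \<in> codes M n \<Longrightarrow> G f = H f) \<Longrightarrow> code_avg p n M G = code_avg p n M H"
  by (simp add: code_avg_def)

context
  fixes p :: "nat \<Rightarrow> real" and n :: nat
  assumes p_sum: "(\<Sum>x<n. p x) = 1"
begin

lemma code_avg_const: "code_avg p n M (\<lambda>_. c) = c"
  using code_avg_prod[of p n M "\<lambda>_ _. 1"] code_avg_cmult[of p n M c "\<lambda>_. 1"] p_sum by simp

lemma code_avg_one:
  assumes a: "a < M"
  shows "code_avg p n M (\<lambda>f. F (f a)) = (\<Sum>x<n. p x * F x)"
proof -
  have "code_avg p n M (\<lambda>f. F (f a)) = code_avg p n M (\<lambda>f. \<Prod>m<M. if m = a then F (f m) else 1)"
    using a by (intro code_avg_cong) simp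
  also have "\<dots> = (\<Prod>m<M. \<Sum>z<n. p z * (if m = a then F z else 1))" by (rule code_avg_prod)
  also have "\<dots> = (\<Prod>m<M. if m = a then (\<Sum>z<n. p z * F z) else 1)"
    using p_sum by (intro prod.cong) auto
  finally show ?thesis using a by simp
qed

lemma code_avg_two:
  assumes a: "a < M" "b < M" "a \<noteq> b"
  shows "code_avg p n M (\<lambda>f. F (f a) (f b)) = (\<Sum>x<n. \<Sum>x'<n. p x * p x' * F x x')"
proof -
  \<comment> \<open>The product of these factors over \<open>m\<close> is the indicator of
    \<open>f a = x\<close> and \<open>f b = x'\<close>; expanding \<open>F\<close> in such
    indicators makes \<open>code_avg_prod\<close> applicable.\<close>
  define h where "h x x' m z = (if m = a \<and> z \<noteq> x \<or> m = b \<and> z \<noteq> x' then 0 else 1::real)" for x x' m z :: nat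
  have ind: "(\<Prod>m<M. h x x' m (f m)) = (if f b = x' then (if f a = x then 1 else 0) else 0)" for x x' f
  proof (cases "f a = x \<and> f b = x'")
    case True
    hence "(\<Prod>m<M. h x x' m (f m)) = 1" by (intro prod.neutral) (auto simp: h_def)
    thus ?thesis using True by simp
  next
    case False
    hence "\<exists>m\<in>{..<M}. h x x' m (f m) = 0" using a by (auto simp: h_def)
    hence "(\<Prod>m<M. h x x' m (f m)) = 0" by (intro prod_zero) auto
    thus ?thesis using False by auto
  qed
  have dec: "F (f a) (f b) = (\<Sum>x<n. \<Sum>x'<n. F x x' * (\<Prod>m<M. h x x' m (f m)))" if "f \<in> codes M n" for f
  proof -
    have "(\<Sum>x<n. \<Sum>x'<n. F x x' * (\<Prod>m<M. h x x' m (f m)))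
        = (\<Sum>x<n. \<Sum>x'<n. if x' = f b then (if f a = x then F x x' else 0) else 0)"
      unfolding ind by (intro sum.cong refl) auto
    also have "\<dots> = (\<Sum>x<n. if x = f a then F x (f b) else 0)"
      using codes_less[OF that a(2)] by (intro sum.cong refl) auto
    finally show ?thesis using codes_less[OF that a(1)] by simp
  qed
  have marg: "(\<Prod>m<M. \<Sum>z<n. p z * h x x' m z) = p x * p x'" if "x < n" "x' < n" for x x'
  proof -
    have "(\<Sum>z<n. p z * h x x' m z) = (if m = a then p x else 1) * (if m = b then p x' else 1)" for m
    proof -
      have pick: "(\<Sum>z<n. p z * (if z \<noteq> y then 0 else 1)) = p y" if "y < n" for y
      proof -
        have "(\<Sum>z<n. p z * (if z \<noteq> y then 0 else 1)) = (\<Sum>z<n. if z = y then p z else 0)"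
          by (intro sum.cong) auto
        thus ?thesis using that by simp
      qed
      show ?thesis using pick[OF that(1)] pick[OF that(2)] p_sum a(3) by (auto simp: h_def)
    qed
    thus ?thesis using a by (simp add: prod.distrib)
  qed
  have "code_avg p n M (\<lambda>f. F (f a) (f b)) = code_avg p n M (\<lambda>f. \<Sum>x<n. \<Sum>x'<n. F x x' * (\<Prod>m<M. h x x' m (f m)))"
    by (intro code_avg_cong dec)
  also have "\<dots> = (\<Sum>x<n. \<Sum>x'<n. F x x' * (\<Prod>m<M. \<Sum>z<n. p z * h x x' m z))"
    by (simp only: code_avg_sum code_avg_cmult code_avg_prod)
  also have "\<dots> = (\<Sum>x<n. \<Sum>x'<n. p x * p x' * F x x')"
    by (intro sum.cong refl) (simp add: marg)
  finally show ?thesis .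
qed

lemma exists_le_code_avg:
  assumes p: "\<And>x. x < n \<Longrightarrow> 0 \<le> p x" and le: "code_avg p n M G \<le> \<eta>"
  shows "\<exists>f\<in>codes M n. G f \<le> \<eta>"
proof (rule exists_le_average[OF finite_codes])
  show "0 \<le> (\<Prod>m<M. p (f m))" if "f \<in> codes M n" for f
    using p codes_less[OF that] by (intro prod_nonneg) auto
  show "(\<Sum>f\<in>codes M n. \<Prod>m<M. p (f m)) = 1"
    using code_avg_const[of M 1] by (simp add: code_avg_def)
  show "(\<Sum>f\<in>codes M n. (\<Prod>m<M. p (f m)) * G f) \<le> \<eta>" using le by (simp add: code_avg_def)
qed

end

lemma num_msgs_pos: "0 < num_msgs R"
  by (simp add: num_msgs_def)

text \<open>Also valid for negative \<open>R\<close>, where \<open>num_msgs R = 1\<close> and there are no wrong messages.\<close>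

lemma num_msgs_le: "real (num_msgs R) - 1 \<le> 2 powr R"
proof -
  have "real (nat \<lfloor>2 powr R\<rfloor>) \<le> 2 powr R" by (simp add: of_nat_nat)
  hence "real (nat \<lfloor>2 powr R\<rfloor>) - 1 \<le> 2 powr R" by linarith
  thus ?thesis by (auto simp: num_msgs_def max_def simp del: of_nat_nat)
qed

lemma sum_single_exception:
  assumes "m < (M::nat)"
  shows "(\<Sum>m'<M. if m' = m then a else b) = a + (real M - 1) * (b::real)"
proof -
  have "(\<Sum>m'<M. if m' = m then a else b) = (\<Sum>m'<M. (if m' = m then a - b else 0) + b)"
    by (intro sum.cong) auto
  thus ?thesis using assms by (simp add: sum.distrib algebra_simps)
qed

lemma sum_wrong_pairs:
  fixes c :: "nat \<Rightarrow> real"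
  assumes "m1 < M1" "m2 < M2"
  shows "(\<Sum>m1'<M1. \<Sum>m2'<M2. if m1' = m1 \<and> m2' = m2 then 0 else c (if m2' = m2 then 0 else if m1' = m1 then 1 else 2))
    = (real M1 - 1) * c 0 + (real M2 - 1) * c 1 + (real M1 - 1) * (real M2 - 1) * c 2"
proof -
  have "(\<Sum>m1'<M1. \<Sum>m2'<M2. if m1' = m1 \<and> m2' = m2 then 0 else c (if m2' = m2 then 0 else if m1' = m1 then 1 else 2))
     = (\<Sum>m1'<M1. if m1' = m1 then (\<Sum>m2'<M2. if m2' = m2 then 0 else c 1) else (\<Sum>m2'<M2. if m2' = m2 then c 0 else c 2))"
    by (intro sum.cong refl) (auto intro!: sum.cong)
  thus ?thesis using assms by (simp add: sum_single_exception algebra_simps)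
qed

section \<open>Decoding a fixed pair of codebooks\<close>

context mac_source
begin

text \<open>\<open>mac_decoder\<close> is applied to the blocks of the tests at the labels of the
  codeword pairs. Its bound is linear in quadratic forms, so summing over the Gram vectors of an
  output turns every form into an acceptance probability and the squared norm into the trace
  1.\<close>

lemma code_with_error:
  fixes M1 M2 :: nat and f g :: "nat \<Rightarrow> nat" and k s :: real and P :: "nat \<Rightarrow> complex mat"
  assumes u: "u < nU" and P: "\<And>i. i < 3 \<Longrightarrow> povm_elem (nU*nX*nY*dZ) (P i)"
    and f: "\<And>m. m < M1 \<Longrightarrow> f m < nX" and g: "\<And>m. m < M2 \<Longrightarrow> g m < nY"
    and M: "0 < M1" "0 < M2" and k: "0 < k" and s: "0 < s" "s \<le> 1"
  shows "\<exists>L. (\<forall>m1<M1. \<forall>m2<M2. psd dZ (L m1 m2)) \<and>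
    msum dZ (\<lambda>(m1,m2). L m1 m2) ({..<M1} \<times> {..<M2}) = 1\<^sub>m dZ \<and>
    (\<forall>m1<M1. \<forall>m2<M2. Re (mtrace ((1\<^sub>m dZ - L m1 m2) * out (f m1) (g m2))) \<le>
       8 * ((\<Sum>m1'<M1. \<Sum>m2'<M2. if m1' = m1 \<and> m2' = m2 then 0 else
              2 * (acc (P (if m2' = m2 then 0 else if m1' = m1 then 1 else 2)) u (f m1') (g m2') (f m1) (g m2) + k))
            + 16 / s\<^sup>2 * (\<Sum>i<3. 1 - acc (P i) u (f m1) (g m2) (f m1) (g m2)))
       + 4 * s\<^sup>2)"
proof -
  define B where "B i m1 m2 = cblock dZ (P i) (lab u (f m1) (g m2))" for i m1 m2
  have pB: "povm_elem dZ (B i m1 m2)" if "i < 3" "m1 < M1" "m2 < M2" for i m1 m2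
    unfolding B_def using P[OF that(1)] by (rule povm_cblock) (use that u f g in \<open>auto intro: lab_less\<close>)
  have cB: "B i m1 m2 \<in> carrier_mat dZ dZ" for i m1 m2 by (simp add: B_def cblock_def)
  obtain L where L: "\<forall>m1<M1. \<forall>m2<M2. psd dZ (L m1 m2)"
      "msum dZ (\<lambda>(m1,m2). L m1 m2) ({..<M1} \<times> {..<M2}) = 1\<^sub>m dZ"
    and err: "\<forall>m1<M1. \<forall>m2<M2. \<forall>h. rip {..<dZ} h h - rip {..<dZ} h (mop dZ (L m1 m2) h) \<le>
       8 * ((\<Sum>m1'<M1. \<Sum>m2'<M2. if m1' = m1 \<and> m2' = m2 then 0 else
              2 * (rip {..<dZ} h (mop dZ (B (if m2' = m2 then 0 else if m1' = m1 then 1 else 2) m1' m2') h) + k * rip {..<dZ} h h))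
            + 16 / s\<^sup>2 * (\<Sum>i<3. rip {..<dZ} h h - rip {..<dZ} h (mop dZ (B i m1 m2) h)))
       + 4 * s\<^sup>2 * rip {..<dZ} h h"
    using mac_decoder[of M1 M2 dZ "\<lambda>i m1 m2. mop dZ (B i m1 m2)" k s, OF povm_effect[OF pB] M k s] by blast
  have "Re (mtrace ((1\<^sub>m dZ - L m1 m2) * out (f m1) (g m2))) \<le>
       8 * ((\<Sum>m1'<M1. \<Sum>m2'<M2. if m1' = m1 \<and> m2' = m2 then 0 else
              2 * (acc (P (if m2' = m2 then 0 else if m1' = m1 then 1 else 2)) u (f m1') (g m2') (f m1) (g m2) + k))
            + 16 / s\<^sup>2 * (\<Sum>i<3. 1 - acc (P i) u (f m1) (g m2) (f m1) (g m2)))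
       + 4 * s\<^sup>2" if m: "m1 < M1" "m2 < M2" for m1 m2
  proof -
    let ?W = "out (f m1) (g m2)"
    have W: "density dZ ?W" by (rule out_density[OF f[OF m(1)] g[OF m(2)]])
    have cW: "?W \<in> carrier_mat dZ dZ" by (rule out_carrier[OF f[OF m(1)] g[OF m(2)]])
    obtain r where r: "\<And>i j. i < dZ \<Longrightarrow> j < dZ \<Longrightarrow> ?W $$ (i,j) = (\<Sum>k<dZ. r k i * cnj (r k j))"
      using psd_gram[of dZ ?W] W unfolding density_def by blast
    have cL: "L m1 m2 \<in> carrier_mat dZ dZ" using L(1) m by (auto simp: psd_def)
    define N where "N j = rip {..<dZ} (r j) (r j)" for j
    define Q where "Q i m1' m2' j = rip {..<dZ} (r j) (mop dZ (B i m1' m2') (r j))" for i m1' m2' j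
    have Q: "(\<Sum>j<dZ. Q i m1' m2' j) = acc (P i) u (f m1') (g m2') (f m1) (g m2)" for i m1' m2'
      unfolding Q_def acc_def B_def[symmetric] by (rule mtrace_gram[OF cB cW r, symmetric])
    have N: "(\<Sum>j<dZ. N j) = 1"
    proof -
      have "mop dZ (1\<^sub>m dZ) h i = h i" if "i < dZ" for h i
      proof -
        have "mop dZ (1\<^sub>m dZ) h i = (\<Sum>j<dZ. if j = i then h j else 0)"
          unfolding mop_def using that by (intro sum.cong) auto
        thus ?thesis using that by simp
      qed
      hence "N j = rip {..<dZ} (r j) (mop dZ (1\<^sub>m dZ) (r j))" for j
        unfolding N_def by (intro rip_cong) auto
      hence "(\<Sum>j<dZ. N j) = Re (mtrace (1\<^sub>m dZ * ?W))"
        using mtrace_gram[OF one_carrier_mat cW r] by simp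
      thus ?thesis using W cW by (simp add: density_def)
    qed
    have "Re (mtrace ((1\<^sub>m dZ - L m1 m2) * ?W)) = (\<Sum>j<dZ. rip {..<dZ} (r j) (mop dZ (1\<^sub>m dZ - L m1 m2) (r j)))"
      using cL by (intro mtrace_gram[OF _ cW r]) auto
    also have "\<dots> = (\<Sum>j<dZ. N j - rip {..<dZ} (r j) (mop dZ (L m1 m2) (r j)))"
      unfolding mop_one_minus[OF cL] N_def ..
    also have "\<dots> \<le> (\<Sum>j<dZ. 8 * ((\<Sum>m1'<M1. \<Sum>m2'<M2. if m1' = m1 \<and> m2' = m2 then 0 else
              2 * (Q (if m2' = m2 then 0 else if m1' = m1 then 1 else 2) m1' m2' j + k * N j))
            + 16 / s\<^sup>2 * (\<Sum>i<3. N j - Q i m1 m2 j)) + 4 * s\<^sup>2 * N j)"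
      unfolding N_def Q_def using err m by (intro sum_mono) blast
    also have "\<dots> = 8 * ((\<Sum>m1'<M1. \<Sum>m2'<M2. \<Sum>j<dZ. if m1' = m1 \<and> m2' = m2 then 0 else
              2 * (Q (if m2' = m2 then 0 else if m1' = m1 then 1 else 2) m1' m2' j + k * N j))
            + 16 / s\<^sup>2 * (\<Sum>i<3. \<Sum>j<dZ. N j - Q i m1 m2 j)) + 4 * s\<^sup>2 * (\<Sum>j<dZ. N j)"
    proof -
      have 1: "(\<Sum>j<dZ. \<Sum>m1'<M1. \<Sum>m2'<M2. F j m1' m2') = (\<Sum>m1'<M1. \<Sum>m2'<M2. \<Sum>j<dZ. F j m1' m2')"
        for F :: "nat \<Rightarrow> nat \<Rightarrow> nat \<Rightarrow> real"
        by (subst sum.swap, rule sum.cong[OF refl], rule sum.swap)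
      have 2: "(\<Sum>j<dZ. \<Sum>i<3. N j - Q i m1 m2 j) = (\<Sum>i<3. \<Sum>j<dZ. N j - Q i m1 m2 j)"
        by (rule sum.swap)
      have 3: "(\<Sum>j<dZ. 8 * (F j + c * G j) + c' * N j) = 8 * ((\<Sum>j<dZ. F j) + c * (\<Sum>j<dZ. G j)) + c' * (\<Sum>j<dZ. N j)"
        for F G and c c' :: real
        by (simp only: sum.distrib distrib_left sum_distrib_left mult.assoc)
      show ?thesis unfolding 3 1 2 ..
    qed
    also have "\<dots> = 8 * ((\<Sum>m1'<M1. \<Sum>m2'<M2. if m1' = m1 \<and> m2' = m2 then 0 else
              2 * (acc (P (if m2' = m2 then 0 else if m1' = m1 then 1 else 2)) u (f m1') (g m2') (f m1) (g m2) + k))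
            + 16 / s\<^sup>2 * (\<Sum>i<3. 1 - acc (P i) u (f m1) (g m2) (f m1) (g m2)))
       + 4 * s\<^sup>2"
    proof -
      have 1: "(\<Sum>j<dZ. if c then 0 else 2 * (Q i m1' m2' j + k * N j))
          = (if c then 0 else 2 * (acc (P i) u (f m1') (g m2') (f m1) (g m2) + k))" for c i m1' m2'
        by (cases c) (simp_all add: sum_distrib_left[symmetric] sum.distrib Q N)
      show ?thesis unfolding 1 sum_subtractf Q N by simp
    qed
    finally show ?thesis .
  qed
  thus ?thesis using L by blast
qed

end

section \<open>Expectation over \<open>u\<close> and two conditionally independent codebooks\<close>

context mac_source
begin

definition avg :: "nat \<Rightarrow> nat \<Rightarrow> (nat \<Rightarrow> (nat \<Rightarrow> nat) \<Rightarrow> (nat \<Rightarrow> nat) \<Rightarrow> real) \<Rightarrow> real" where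
  "avg M1 M2 F = (\<Sum>u<nU. pU u * code_avg (pX u) nX M1 (\<lambda>f. code_avg (pY u) nY M2 (\<lambda>g. F u f g)))"

lemma avg_add: "avg M1 M2 (\<lambda>u f g. F u f g + G u f g) = avg M1 M2 F + avg M1 M2 G"
  by (simp add: avg_def code_avg_add algebra_simps sum.distrib)

lemma avg_cmult: "avg M1 M2 (\<lambda>u f g. c * F u f g) = c * avg M1 M2 F"
  by (simp add: avg_def code_avg_cmult sum_distrib_left algebra_simps)

lemma avg_diff: "avg M1 M2 (\<lambda>u f g. F u f g - G u f g) = avg M1 M2 F - avg M1 M2 G"
  using avg_add[of M1 M2 F "\<lambda>u f g. - 1 * G u f g"] avg_cmult[of M1 M2 "- 1" G] by simp

lemma avg_sum: "avg M1 M2 (\<lambda>u f g. \<Sum>i\<in>I. F i u f g) = (\<Sum>i\<in>I. avg M1 M2 (F i))"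
  unfolding avg_def code_avg_sum sum_distrib_left by (rule sum.swap)

lemma avg_const: "avg M1 M2 (\<lambda>_ _ _. c) = c"
proof -
  have "avg M1 M2 (\<lambda>_ _ _. c) = (\<Sum>u<nU. pU u * c)"
    unfolding avg_def by (intro sum.cong refl) (simp add: code_avg_const[OF pX_sum] code_avg_const[OF pY_sum])
  thus ?thesis by (simp add: sum_distrib_right[symmetric] pU_sum)
qed

lemma avg_acc_rho:
  assumes P: "P \<in> carrier_mat (nU*nX*nY*dZ) (nU*nX*nY*dZ)" and m: "m1 < M1" "m2 < M2"
  shows "avg M1 M2 (\<lambda>u f g. acc P u (f m1) (g m2) (f m1) (g m2)) = Re (mtrace (P * rho))"
proof -
  have "code_avg (pX u) nX M1 (\<lambda>f. code_avg (pY u) nY M2 (\<lambda>g. acc P u (f m1) (g m2) (f m1) (g m2)))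
      = (\<Sum>x<nX. pX u x * (\<Sum>y<nY. pY u y * acc P u x y x y))" if u: "u < nU" for u
    unfolding code_avg_one[OF pY_sum[OF u] m(2), of "\<lambda>y. acc P u _ y _ y"]
    by (rule code_avg_one[OF pX_sum[OF u] m(1)])
  thus ?thesis unfolding mtrace_rho[OF P] avg_def by (simp add: sum_distrib_left algebra_simps)
qed

text \<open>The test of a wrong first message carries a codeword independent of the one sent, while
  both labels share the second codeword. These are the weights in \<open>mtrace_ref\<close>; the
  next two lemmas treat the other kinds of confusion alike.\<close>

lemma avg_acc_X:
  assumes P: "P \<in> carrier_mat (nU*nX*nY*dZ) (nU*nX*nY*dZ)" and m: "m1' < M1" "m1 < M1" "m1' \<noteq> m1" "m2 < M2"
  shows "avg M1 M2 (\<lambda>u f g. acc P u (f m1') (g m2) (f m1) (g m2)) = Re (mtrace (P * ref_X))"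
proof -
  have "code_avg (pX u) nX M1 (\<lambda>f. code_avg (pY u) nY M2 (\<lambda>g. acc P u (f m1') (g m2) (f m1) (g m2)))
      = (\<Sum>x<nX. \<Sum>x'<nX. pX u x * pX u x' * (\<Sum>y<nY. pY u y * acc P u x y x' y))" if u: "u < nU" for u
    unfolding code_avg_one[OF pY_sum[OF u] m(4), of "\<lambda>y. acc P u _ y _ y"]
    by (rule code_avg_two[OF pX_sum[OF u] m(1-3)])
  hence "avg M1 M2 (\<lambda>u f g. acc P u (f m1') (g m2) (f m1) (g m2))
      = (\<Sum>u<nU. \<Sum>x<nX. \<Sum>x'<nX. \<Sum>y<nY. pU u * pX u x * pY u y * pX u x' * acc P u x y x' y)"
    unfolding avg_def by (simp add: sum_distrib_left algebra_simps)
  also have "\<dots> = (\<Sum>u<nU. \<Sum>x<nX. \<Sum>y<nY. \<Sum>x'<nX. pU u * pX u x * pY u y * pX u x' * acc P u x y x' y)"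
    by (rule sum.cong[OF refl], rule sum.cong[OF refl], rule sum.swap)
  finally show ?thesis unfolding mtrace_ref(1)[OF P] .
qed

lemma avg_acc_Y:
  assumes P: "P \<in> carrier_mat (nU*nX*nY*dZ) (nU*nX*nY*dZ)" and m: "m2' < M2" "m2 < M2" "m2' \<noteq> m2" "m1 < M1"
  shows "avg M1 M2 (\<lambda>u f g. acc P u (f m1) (g m2') (f m1) (g m2)) = Re (mtrace (P * ref_Y))"
proof -
  have "code_avg (pX u) nX M1 (\<lambda>f. code_avg (pY u) nY M2 (\<lambda>g. acc P u (f m1) (g m2') (f m1) (g m2)))
      = (\<Sum>x<nX. pX u x * (\<Sum>y<nY. \<Sum>y'<nY. pY u y * pY u y' * acc P u x y x y'))" if u: "u < nU" for u
    unfolding code_avg_two[OF pY_sum[OF u] m(1-3), of "\<lambda>y y'. acc P u _ y _ y'"]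
    by (rule code_avg_one[OF pX_sum[OF u] m(4)])
  thus ?thesis unfolding mtrace_ref(2)[OF P] avg_def by (simp add: sum_distrib_left algebra_simps)
qed

lemma avg_acc_XY:
  assumes P: "P \<in> carrier_mat (nU*nX*nY*dZ) (nU*nX*nY*dZ)"
    and m: "m1' < M1" "m1 < M1" "m1' \<noteq> m1" "m2' < M2" "m2 < M2" "m2' \<noteq> m2"
  shows "avg M1 M2 (\<lambda>u f g. acc P u (f m1') (g m2') (f m1) (g m2)) = Re (mtrace (P * ref_XY))"
proof -
  have "code_avg (pX u) nX M1 (\<lambda>f. code_avg (pY u) nY M2 (\<lambda>g. acc P u (f m1') (g m2') (f m1) (g m2)))
      = (\<Sum>x<nX. \<Sum>x'<nX. pX u x * pX u x' * (\<Sum>y<nY. \<Sum>y'<nY. pY u y * pY u y' * acc P u x y x' y'))" if u: "u < nU" for u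
    unfolding code_avg_two[OF pY_sum[OF u] m(4-6), of "\<lambda>y y'. acc P u _ y _ y'"]
    by (rule code_avg_two[OF pX_sum[OF u] m(1-3)])
  hence "avg M1 M2 (\<lambda>u f g. acc P u (f m1') (g m2') (f m1) (g m2))
      = (\<Sum>u<nU. \<Sum>x<nX. \<Sum>x'<nX. \<Sum>y<nY. \<Sum>y'<nY. pU u * pX u x * pY u y * (pX u x' * pY u y') * acc P u x y x' y')"
    unfolding avg_def by (simp add: sum_distrib_left algebra_simps)
  also have "\<dots> = (\<Sum>u<nU. \<Sum>x<nX. \<Sum>y<nY. \<Sum>x'<nX. \<Sum>y'<nY. pU u * pX u x * pY u y * (pX u x' * pY u y') * acc P u x y x' y')"
    by (rule sum.cong[OF refl], rule sum.cong[OF refl], rule sum.swap)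
  finally show ?thesis unfolding mtrace_ref(3)[OF P] .
qed

text \<open>Derandomisation in three stages: first \<open>u\<close>, then the first codebook, then
  the second. Each stage keeps a choice no worse than its average.\<close>

lemma exists_le_avg:
  assumes "avg M1 M2 F \<le> \<eta>"
  obtains u f g where "u < nU" "f \<in> codes M1 nX" "g \<in> codes M2 nY" "F u f g \<le> \<eta>"
proof -
  have "\<exists>u\<in>{..<nU}. code_avg (pX u) nX M1 (\<lambda>f. code_avg (pY u) nY M2 (\<lambda>g. F u f g)) \<le> \<eta>"
  proof (rule exists_le_average[where w = pU])
    show "(\<Sum>u<nU. pU u * code_avg (pX u) nX M1 (\<lambda>f. code_avg (pY u) nY M2 (\<lambda>g. F u f g))) \<le> \<eta>"
      using assms unfolding avg_def .
  qed (use pU_nonneg pU_sum in auto)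
  then obtain u where u: "u < nU" "code_avg (pX u) nX M1 (\<lambda>f. code_avg (pY u) nY M2 (\<lambda>g. F u f g)) \<le> \<eta>"
    by auto
  obtain f where f: "f \<in> codes M1 nX" "code_avg (pY u) nY M2 (\<lambda>g. F u f g) \<le> \<eta>"
    using exists_le_code_avg[OF pX_sum[OF u(1)] pX_nonneg[OF u(1)] u(2)] by blast
  obtain g where "g \<in> codes M2 nY" "F u f g \<le> \<eta>"
    using exists_le_code_avg[OF pY_sum[OF u(1)] pY_nonneg[OF u(1)] f(2)] by blast
  thus ?thesis using that u f by blast
qed

definition code_bound ::
  "nat \<Rightarrow> nat \<Rightarrow> real \<Rightarrow> real \<Rightarrow> (nat \<Rightarrow> complex mat) \<Rightarrow> nat \<Rightarrow> nat \<Rightarrow> nat \<Rightarrow> (nat \<Rightarrow> nat) \<Rightarrow> (nat \<Rightarrow> nat) \<Rightarrow> real" where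
  "code_bound M1 M2 k s P m1 m2 u f g =
     8 * ((\<Sum>m1'<M1. \<Sum>m2'<M2. if m1' = m1 \<and> m2' = m2 then 0 else
              2 * (acc (P (if m2' = m2 then 0 else if m1' = m1 then 1 else 2)) u (f m1') (g m2') (f m1) (g m2) + k))
            + 16 / s\<^sup>2 * (\<Sum>i<3. 1 - acc (P i) u (f m1) (g m2) (f m1) (g m2)))
       + 4 * s\<^sup>2"

lemma avg_code_bound:
  assumes P: "\<And>i. i < 3 \<Longrightarrow> P i \<in> carrier_mat (nU*nX*nY*dZ) (nU*nX*nY*dZ)" and m: "m1 < M1" "m2 < M2"
  shows "avg M1 M2 (code_bound M1 M2 k s P m1 m2) =
    8 * (2 * ((real M1 - 1) * (Re (mtrace (P 0 * ref_X)) + k) + (real M2 - 1) * (Re (mtrace (P 1 * ref_Y)) + k)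
           + (real M1 - 1) * (real M2 - 1) * (Re (mtrace (P 2 * ref_XY)) + k))
      + 16 / s\<^sup>2 * (\<Sum>i<3. 1 - Re (mtrace (P i * rho)))) + 4 * s\<^sup>2"
proof -
  define t where "t i = (if i = 0 then Re (mtrace (P 0 * ref_X)) else if i = 1 then Re (mtrace (P 1 * ref_Y))
     else Re (mtrace (P 2 * ref_XY)))" for i :: nat
  have wrong: "avg M1 M2 (\<lambda>u f g. if m1' = m1 \<and> m2' = m2 then 0 else
              2 * (acc (P (if m2' = m2 then 0 else if m1' = m1 then 1 else 2)) u (f m1') (g m2') (f m1) (g m2) + k))
     = (if m1' = m1 \<and> m2' = m2 then 0 else 2 * (t (if m2' = m2 then 0 else if m1' = m1 then 1 else 2) + k))"
    if m': "m1' < M1" "m2' < M2" for m1' m2'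
  proof -
    consider "m1' = m1" "m2' = m2" | "m1' \<noteq> m1" "m2' = m2" | "m1' = m1" "m2' \<noteq> m2" | "m1' \<noteq> m1" "m2' \<noteq> m2" by blast
    thus ?thesis
    proof cases
      case 1
      thus ?thesis by (simp add: avg_const)
    next
      case 2
      thus ?thesis using avg_acc_X[OF P m'(1) m(1) _ m(2), of 0] by (simp add: avg_cmult avg_add avg_const t_def)
    next
      case 3
      thus ?thesis using avg_acc_Y[OF P m'(2) m(2) _ m(1), of 1] by (simp add: avg_cmult avg_add avg_const t_def)
    next
      case 4
      thus ?thesis using avg_acc_XY[OF P m'(1) m(1) _ m'(2) m(2), of 2] by (simp add: avg_cmult avg_add avg_const t_def)
    qed
  qed
  have "avg M1 M2 (code_bound M1 M2 k s P m1 m2) =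
    8 * ((\<Sum>m1'<M1. \<Sum>m2'<M2. avg M1 M2 (\<lambda>u f g. if m1' = m1 \<and> m2' = m2 then 0 else
              2 * (acc (P (if m2' = m2 then 0 else if m1' = m1 then 1 else 2)) u (f m1') (g m2') (f m1) (g m2) + k)))
      + 16 / s\<^sup>2 * (\<Sum>i<3. 1 - avg M1 M2 (\<lambda>u f g. acc (P i) u (f m1) (g m2) (f m1) (g m2)))) + 4 * s\<^sup>2"
    unfolding code_bound_def avg_add avg_cmult avg_sum avg_diff avg_const ..
  also have "(\<Sum>m1'<M1. \<Sum>m2'<M2. avg M1 M2 (\<lambda>u f g. if m1' = m1 \<and> m2' = m2 then 0 else
              2 * (acc (P (if m2' = m2 then 0 else if m1' = m1 then 1 else 2)) u (f m1') (g m2') (f m1) (g m2) + k)))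
      = (\<Sum>m1'<M1. \<Sum>m2'<M2. if m1' = m1 \<and> m2' = m2 then 0 else 2 * (t (if m2' = m2 then 0 else if m1' = m1 then 1 else 2) + k))"
    by (intro sum.cong[OF refl] wrong) auto
  also have "\<dots> = (real M1 - 1) * (2 * (t 0 + k)) + (real M2 - 1) * (2 * (t 1 + k)) + (real M1 - 1) * (real M2 - 1) * (2 * (t 2 + k))"
    by (rule sum_wrong_pairs[OF m])
  also have "\<dots> = 2 * ((real M1 - 1) * (Re (mtrace (P 0 * ref_X)) + k) + (real M2 - 1) * (Re (mtrace (P 1 * ref_Y)) + k)
           + (real M1 - 1) * (real M2 - 1) * (Re (mtrace (P 2 * ref_XY)) + k))"
    by (simp add: t_def algebra_simps)
  also have "(\<Sum>i<3. 1 - avg M1 M2 (\<lambda>u f g. acc (P i) u (f m1) (g m2) (f m1) (g m2))) = (\<Sum>i<3. 1 - Re (mtrace (P i * rho)))"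
    by (intro sum.cong refl) (simp add: avg_acc_rho[OF P m])
  finally show ?thesis .
qed

text \<open>In terms of \<open>q = sqrt \<epsilon>\<close>: three kinds of wrong pairs at
  \<open>2 * \<epsilon>\<close> each, times 16, give \<open>96 * q\<^sup>2\<close>; the correct
  tests give \<open>8 * 48 * q\<close>; the tilt gives \<open>4 * q\<close>. As
  \<open>q \<le> 1\<close>, the total is at most
  \<open>(96 + 384 + 4) * q = 484 * q\<close>.\<close>

theorem mac_code_exists:
  assumes eps: "0 < \<epsilon>" "\<epsilon> < 1"
    and R1: "ereal R1 \<le> IH_X_YZ nU nX nY dZ \<epsilon> rho - ereal (2 + log 2 (1 / \<epsilon>))"
    and R2: "ereal R2 \<le> IH_Y_XZ nU nX nY dZ \<epsilon> rho - ereal (2 + log 2 (1 / \<epsilon>))"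
    and R12: "ereal (R1 + R2) \<le> IH_XY_Z nU nX nY dZ \<epsilon> rho - ereal (2 + log 2 (1 / \<epsilon>))"
  shows "mac_code dX dY dZ C R1 R2 (484 * sqrt \<epsilon>)"
proof -
  let ?N = "nU*nX*nY*dZ"
  define M1 where "M1 = num_msgs R1"
  define M2 where "M2 = num_msgs R2"
  have M: "0 < M1" "0 < M2" by (simp_all add: M1_def M2_def num_msgs_pos)
  obtain P0 where P0: "povm_elem ?N P0" "Re (mtrace (P0 * rho)) \<ge> 1 - \<epsilon>" "Re (mtrace (P0 * ref_X)) \<le> 2 powr (- R1) * \<epsilon>"
    using DH_test[OF R1[unfolded IH_eq] eps(1)] .
  obtain P1 where P1: "povm_elem ?N P1" "Re (mtrace (P1 * rho)) \<ge> 1 - \<epsilon>" "Re (mtrace (P1 * ref_Y)) \<le> 2 powr (- R2) * \<epsilon>"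
    using DH_test[OF R2[unfolded IH_eq] eps(1)] .
  obtain P2 where P2: "povm_elem ?N P2" "Re (mtrace (P2 * rho)) \<ge> 1 - \<epsilon>" "Re (mtrace (P2 * ref_XY)) \<le> 2 powr (- (R1 + R2)) * \<epsilon>"
    using DH_test[OF R12[unfolded IH_eq] eps(1)] .
  define P where "P i = (if i = 0 then P0 else if i = 1 then P1 else P2)" for i :: nat
  have P012: "P 0 = P0" "P 1 = P1" "P 2 = P2" by (simp_all add: P_def)
  have povm: "povm_elem ?N (P i)" for i using P0(1) P1(1) P2(1) by (simp add: P_def)
  hence cP: "P i \<in> carrier_mat ?N ?N" for i by (auto simp: povm_elem_def psd_def)
  have accept: "1 - Re (mtrace (P i * rho)) \<le> \<epsilon>" for i using P0(2) P1(2) P2(2) by (simp add: P_def)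
  define q where "q = sqrt \<epsilon>"
  have q: "0 < q" "q \<le> 1" "q * q = \<epsilon>" using eps by (auto simp: q_def)
  \<comment> \<open>Balances the loss of the correct tests, of order
    \<open>\<epsilon> / s\<^sup>2\<close>, against the cost \<open>s\<^sup>2\<close> of the
    tilt.\<close>
  define s where "s = sqrt q"
  have s: "0 < s" "s \<le> 1" "s\<^sup>2 = q" using q by (auto simp: s_def)
  define k where "k = \<epsilon> / real (M1 * M2)"
  have k: "0 < k" using eps M by (simp add: k_def)
  \<comment> \<open>Here \<open>x\<close> counts the wrong pairs of one kind. The rate bound gives
    one \<open>\<epsilon>\<close>; the regularisation gives the other, since there are at most
    \<open>M1 * M2\<close> pairs.\<close>
  have wrong: "x * (t + k) \<le> 2 * \<epsilon>" if x: "0 \<le> x" "x \<le> 2 powr R" "x \<le> real (M1 * M2)" and t: "t \<le> 2 powr (- R) * \<epsilon>" for x t R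
  proof -
    have "x * t \<le> x * (2 powr (- R) * \<epsilon>)" using x t by (intro mult_left_mono) auto
    also have "\<dots> \<le> 2 powr R * (2 powr (- R) * \<epsilon>)" using x eps by (intro mult_right_mono) auto
    also have "\<dots> = \<epsilon>" by (simp add: powr_minus)
    finally have 1: "x * t \<le> \<epsilon>" .
    have "x * k \<le> real (M1 * M2) * k" using x k by (intro mult_right_mono) auto
    also have "\<dots> = \<epsilon>" using M by (simp add: k_def)
    finally show ?thesis using 1 by (simp add: algebra_simps)
  qed
  have M1': "0 \<le> real M1 - 1" "real M1 - 1 \<le> 2 powr R1" "real M1 - 1 \<le> real (M1 * M2)"
    and M2': "0 \<le> real M2 - 1" "real M2 - 1 \<le> 2 powr R2" "real M2 - 1 \<le> real (M1 * M2)"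
  proof -
    have "1 \<le> M1" "1 \<le> M2" "M1 \<le> M1 * M2" "M2 \<le> M1 * M2" using M by auto
    hence "1 \<le> real M1" "1 \<le> real M2" "real M1 \<le> real (M1 * M2)" "real M2 \<le> real (M1 * M2)"
      by (auto simp del: of_nat_mult)
    thus "0 \<le> real M1 - 1" "real M1 - 1 \<le> real (M1 * M2)" "0 \<le> real M2 - 1" "real M2 - 1 \<le> real (M1 * M2)"
      by linarith+
  qed (simp_all add: M1_def M2_def num_msgs_le)
  have M12: "0 \<le> (real M1 - 1) * (real M2 - 1)" "(real M1 - 1) * (real M2 - 1) \<le> 2 powr (R1 + R2)"
    "(real M1 - 1) * (real M2 - 1) \<le> real (M1 * M2)"
    using M1' M2' by (auto simp: powr_add intro: mult_mono)
  have bound: "avg M1 M2 (code_bound M1 M2 k s P m1 m2) \<le> 484 * q" if m: "m1 < M1" "m2 < M2" for m1 m2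
  proof -
    have "avg M1 M2 (code_bound M1 M2 k s P m1 m2) =
      8 * (2 * ((real M1 - 1) * (Re (mtrace (P0 * ref_X)) + k) + (real M2 - 1) * (Re (mtrace (P1 * ref_Y)) + k)
           + (real M1 - 1) * (real M2 - 1) * (Re (mtrace (P2 * ref_XY)) + k))
      + 16 / s\<^sup>2 * (\<Sum>i<3. 1 - Re (mtrace (P i * rho)))) + 4 * s\<^sup>2"
      using avg_code_bound[of P, OF cP m, of k s] unfolding P012 .
    also have "\<dots> \<le> 8 * (2 * (2 * \<epsilon> + 2 * \<epsilon> + 2 * \<epsilon>) + 16 / s\<^sup>2 * (\<Sum>i<3::nat. \<epsilon>)) + 4 * s\<^sup>2"
      by (intro add_mono mult_left_mono order_refl wrong[OF M1' P0(3)] wrong[OF M2' P1(3)] wrong[OF M12 P2(3)]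
          sum_mono accept) auto
    also have "16 / s\<^sup>2 * (\<Sum>i<3::nat. \<epsilon>) = 48 * q"
      unfolding s(3) using q by (simp add: field_simps)
    also have "8 * (2 * (2 * \<epsilon> + 2 * \<epsilon> + 2 * \<epsilon>) + 48 * q) + 4 * s\<^sup>2 = 96 * (q * q) + 388 * q"
      unfolding s(3) q(3) by simp
    also have "\<dots> \<le> 484 * q" using mult_left_mono[OF q(2), of q] q(1) by simp
    finally show ?thesis .
  qed
  have "avg M1 M2 (\<lambda>u f g. 1 / real (M1 * M2) * (\<Sum>m1<M1. \<Sum>m2<M2. code_bound M1 M2 k s P m1 m2 u f g))
      = 1 / real (M1 * M2) * (\<Sum>m1<M1. \<Sum>m2<M2. avg M1 M2 (code_bound M1 M2 k s P m1 m2))"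
    unfolding avg_cmult avg_sum ..
  also have "\<dots> \<le> 1 / real (M1 * M2) * (\<Sum>m1<M1. \<Sum>m2<M2. 484 * q)"
    using bound by (intro mult_left_mono sum_mono) auto
  also have "\<dots> = 484 * q" using M by simp
  \<comment> \<open>One choice must serve all message pairs, hence the average over messages is
    taken inside the expectation before the choice is made.\<close>
  finally obtain u f g where u: "u < nU" and f: "f \<in> codes M1 nX" and g: "g \<in> codes M2 nY"
    and ufg: "1 / real (M1 * M2) * (\<Sum>m1<M1. \<Sum>m2<M2. code_bound M1 M2 k s P m1 m2 u f g) \<le> 484 * q"
    by (rule exists_le_avg)
  note f = codes_less[OF f] and g = codes_less[OF g]
  obtain L where L: "\<forall>m1<M1. \<forall>m2<M2. psd dZ (L m1 m2)"
      "msum dZ (\<lambda>(m1,m2). L m1 m2) ({..<M1} \<times> {..<M2}) = 1\<^sub>m dZ"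
      "\<forall>m1<M1. \<forall>m2<M2. Re (mtrace ((1\<^sub>m dZ - L m1 m2) * out (f m1) (g m2))) \<le> code_bound M1 M2 k s P m1 m2 u f g"
    using code_with_error[where P = P and f = f and g = g, OF u povm f g M k s(1,2)] unfolding code_bound_def by blast
  have "1 / real (M1 * M2) * (\<Sum>m1<M1. \<Sum>m2<M2. Re (mtrace ((1\<^sub>m dZ - L m1 m2) * out (f m1) (g m2))))
      \<le> 1 / real (M1 * M2) * (\<Sum>m1<M1. \<Sum>m2<M2. code_bound M1 M2 k s P m1 m2 u f g)"
    using L(3) by (intro mult_left_mono sum_mono) auto
  also note ufg
  finally have err: "1 / real (M1 * M2) * (\<Sum>m1<M1. \<Sum>m2<M2. Re (mtrace ((1\<^sub>m dZ - L m1 m2) * C (kron (\<sigma>X (f m1)) (\<sigma>Y (g m2)))))) \<le> 484 * sqrt \<epsilon>"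
    unfolding out_def q_def .
  have enc: "\<forall>m1<M1. density dX (\<sigma>X (f m1))" "\<forall>m2<M2. density dY (\<sigma>Y (g m2))"
    using f g sX sY by auto
  show ?thesis
    unfolding mac_code_def M1_def[symmetric] M2_def[symmetric]
    by (intro exI[of _ "\<lambda>m. \<sigma>X (f m)"] exI[of _ "\<lambda>m. \<sigma>Y (g m)"] exI[of _ L] conjI enc L(1,2) err)
qed

end

lemma mac_code_mono:
  assumes "mac_code dX dY dZ C R1 R2 \<eta>" "\<eta> \<le> \<eta>'"
  shows "mac_code dX dY dZ C R1 R2 \<eta>'"
proof -
  from assms(1) obtain \<alpha> \<beta> \<Lambda> where c:
    "\<forall>m1 < num_msgs R1. density dX (\<alpha> m1)" "\<forall>m2 < num_msgs R2. density dY (\<beta> m2)"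
    "\<forall>m1 < num_msgs R1. \<forall>m2 < num_msgs R2. psd dZ (\<Lambda> m1 m2)"
    "msum dZ (\<lambda>(m1,m2). \<Lambda> m1 m2) ({..<num_msgs R1} \<times> {..<num_msgs R2}) = 1\<^sub>m dZ"
    "(1 / real (num_msgs R1 * num_msgs R2)) * (\<Sum>m1 < num_msgs R1. \<Sum>m2 < num_msgs R2.
       Re (mtrace ((1\<^sub>m dZ - \<Lambda> m1 m2) * C (kron (\<alpha> m1) (\<beta> m2))))) \<le> \<eta>"
    unfolding mac_code_def by blast
  show ?thesis
    unfolding mac_code_def
    by (intro exI[of _ \<alpha>] exI[of _ \<beta>] exI[of _ \<Lambda>] conjI c(1-4) order_trans[OF c(5) assms(2)])
qed

theorem theorem1:
  fixes dX dY dZ nU nX nY :: nat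
    and C :: "complex mat \<Rightarrow> complex mat"
    and \<sigma>X \<sigma>Y :: "nat \<Rightarrow> complex mat"
    and pU :: "nat \<Rightarrow> real" and pX pY :: "nat \<Rightarrow> nat \<Rightarrow> real"
    and \<epsilon> R1 R2 :: real
  assumes chan: "quantum_channel (dX * dY) dZ C"
    and sX: "\<forall>x < nX. density dX (\<sigma>X x)"
    and sY: "\<forall>y < nY. density dY (\<sigma>Y y)"
    and pU_nonneg: "\<forall>u < nU. pU u \<ge> 0" and pU_sum: "(\<Sum>u<nU. pU u) = 1"
    and pX_nonneg: "\<forall>u < nU. \<forall>x < nX. pX u x \<ge> 0" and pX_sum: "\<forall>u < nU. (\<Sum>x<nX. pX u x) = 1"
    and pY_nonneg: "\<forall>u < nU. \<forall>y < nY. pY u y \<ge> 0" and pY_sum: "\<forall>u < nU. (\<Sum>y<nY. pY u y) = 1"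
    and eps: "0 < \<epsilon>" "\<epsilon> < 1"
    and R1: "ereal R1 \<le> IH_X_YZ nU nX nY dZ \<epsilon> (rhoUXYZ nU nX nY dZ pU pX pY \<sigma>X \<sigma>Y C)
                         - ereal (2 + log 2 (1 / \<epsilon>))"
    and R2: "ereal R2 \<le> IH_Y_XZ nU nX nY dZ \<epsilon> (rhoUXYZ nU nX nY dZ pU pX pY \<sigma>X \<sigma>Y C)
                         - ereal (2 + log 2 (1 / \<epsilon>))"
    and R12: "ereal (R1 + R2) \<le> IH_XY_Z nU nX nY dZ \<epsilon> (rhoUXYZ nU nX nY dZ pU pX pY \<sigma>X \<sigma>Y C)
                         - ereal (2 + log 2 (1 / \<epsilon>))"
  shows "mac_code dX dY dZ C R1 R2 (2 powr 135 * \<epsilon> powr (1/3))"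
proof -
  interpret mac_source dX dY dZ nU nX nY C \<sigma>X \<sigma>Y pU pX pY
    using chan sX sY pU_nonneg pU_sum pX_nonneg pX_sum pY_nonneg pY_sum by unfold_locales auto
  have code: "mac_code dX dY dZ C R1 R2 (484 * sqrt \<epsilon>)"
    using mac_code_exists[OF eps R1[folded rho_def] R2[folded rho_def] R12[folded rho_def]] .
  have "484 * sqrt \<epsilon> \<le> 2 powr 135 * \<epsilon> powr (1/3)"
  proof (intro mult_mono)
    show "484 \<le> (2::real) powr 135" by (simp add: powr_numeral)
    have "sqrt \<epsilon> = \<epsilon> powr (1/2)" using eps by (simp add: powr_half_sqrt)
    also have "\<dots> \<le> \<epsilon> powr (1/3)" using eps by (intro powr_mono') auto
    finally show "sqrt \<epsilon> \<le> \<epsilon> powr (1/3)" .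
  qed (use eps in auto)
  with code show ?thesis by (rule mac_code_mono)
qed

end
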